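(* Let $s'>2$ and $s\in(2,s')$. For $\varepsilon,h>0$, let the initial data $(\rho_0^*,u_0^*,\rho_0)$ be $(s',h)$-truncated of order $\varepsilon^2$, with associated functions $\widetilde{\rho_0}\in H^{s'-2}(\mathbb R)$ and $\widetilde{\rho_0^*},\widetilde{u_0^*}\in H^{s'}(\mathbb R)$, and set $$M:=1+\|(\widetilde{\rho_0^*},\varepsilon\widetilde{u_0^*})\|_{H^{s'}(\mathbb R)}+\|\widetilde{u_0^*}\|_{H^{s'-1}(\mathbb R)}.$$ Let $(\rho^\varepsilon,u^\varepsilon)$ be the solution of $$\partial_t\rho^\varepsilon+\mathcal D_hu^\varepsilon=0,\qquad \varepsilon^2\partial_tu^\varepsilon+\mathcal D_h\rho^\varepsilon+u^\varepsilon=0,\qquad (\rho^\varepsilon,u^\varepsilon)(0)=(\rho_0^*,u_0^* ),$$ and $\rho$ the solution of $\partial_t\rho-\mathcal D_h^2\rho=0$, $\rho(0)=\rho_0$. (i) For every $T>0$ there is a constant $K>0$, independent of $h$, $\varepsilon$ and the initial data, such that $$\|\rho^\varepsilon-\rho\|_{L^\infty_T(\dot h^{s-2}_h)}+\|\rho^\varepsilon-\rho\|_{L^1_T(\dot h^{s}_h)}+\|\mathcal D_h\rho^\varepsilon+u^\varepsilon\|_{L^1_T(\dot h^{s-1}_h)}\le K M\varepsilon^2 .$$ (ii) If moreover $s'>5/2$, then for every $T>0$ there is a constant $K>0$, independent of $h$, $\varepsilon$ and the initial data, such that $$\|\rho^\varepsilon-\rho\|_{L^\infty_T(\ell^\infty_h)}+\|\rho^\varepsilon-\rho\|_{L^1_T(\ell^\infty_h)}+\|\mathcal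 D_h\rho^\varepsilon+u^\varepsilon\|_{L^1_T(\ell^\infty_h)}\le K M\varepsilon^2 .$$
   Context: Let $h>0$. For a sequence $v=(v_n)_{n\in\mathbb Z}$ put $\|v\|_{\ell^2_h}^2:=h\sum_{n\in\mathbb Z}|v_n|^2$ and $\|v\|_{\ell^\infty_h}:=\sup_n|v_n|$; $\ell^2_h$ is the set of sequences with $\|v\|_{\ell^2_h}<\infty$. The central finite difference operator is $(\mathcal D_hv)_n:=\frac{v_{n+1}-v_{n-1}}{2h}$, bounded on $\ell^2_h$; the unknowns are functions of $(t,n)\in[0,\infty)\times\mathbb Z$ and solutions are the unique ones in $C^1([0,\infty);\ell^2_h)$. The discrete Fourier transform of $v\in\ell^2_h$ is $\hat v(\xi)=\frac{h}{\sqrt{2\pi}}\sum_{n\in\mathbb Z}e^{-i\xi nh}v_n$, $\xi\in[-\frac\pi h,\frac\pi h]$, and for $r\in\mathbb R$ the homogeneous discrete Sobolev norm is $\|v\|_{\dot h^r_h}:=\big\|\hat v(\xi)\,\big|\tfrac{\sin(\xi h)}{h}\big|^r\big\|_{L^2(-\frac\pi h,\frac\pi h)}$. For a normed space $X$ and $p\in[1,\infty]$, $\|g\|_{L^p_T(X)}$ is the $L^p(0,T)$ norm of $t\mapsto\|g(t)\|_X$. Truncation operator: $\mathcal T_h:L^2(\mathbb R)\to\ell^2_h$, $(\mathcal T_hv)_n=\frac1{\sqrt{2\pi}}\int_{-\pi/h}^{\pi/h}e^{i\xi nh}\hat v(\xi)\,d\xi$, where here $\hat v(\xi)=\frac1{\sqrt{2\pi}}\int_{\mathbb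 R}e^{-i\xi x}v(x)\,dx$ is the (unitary) Fourier transform on $L^2(\mathbb R)$. Definition: the data $(\rho_0^*,u_0^*,\rho_0)$ are $(s',h)$-truncated of order $\varepsilon^2$ ($s'>2$) if there exist $\widetilde{\rho_0}\in H^{s'-2}(\mathbb R)$ and $\widetilde{\rho_0^*},\widetilde{u_0^*}\in H^{s'}(\mathbb R)$ such that $\|\widetilde{\rho_0}-\widetilde{\rho_0^*}\|_{H^{s'-2}(\mathbb R)}<\varepsilon^2$, $\rho_0=\mathcal T_h(\widetilde{\rho_0})$, $\rho_0^*=\mathcal T_h(\widetilde{\rho_0^*})$ and $u_0^*=\mathcal T_h(\widetilde{u_0^*})$. $H^r(\mathbb R)$ is the usual Sobolev space. *)

theory Defs
  imports "HOL-Probability.Probability"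
begin

text \<open>
  Sequences indexed by the integers and functions on the real line are complex valued; the
  real valued ones are a special case. Norms that may be infinite take values in \<^typ>\<open>ennreal\<close>.
\<close>

type_synonym zseq = "int \<Rightarrow> complex"

definition ennreal_sqrt :: "ennreal \<Rightarrow> ennreal" where
  "ennreal_sqrt x = (if x = \<top> then \<top> else ennreal (sqrt (enn2real x)))"

definition L2norm :: "'a measure \<Rightarrow> ('a \<Rightarrow> complex) \<Rightarrow> ennreal" where
  "L2norm M f = ennreal_sqrt (\<integral>\<^sup>+x. ennreal ((cmod (f x))\<^sup>2) \<partial>M)"

definition L2_line :: "(real \<Rightarrow> complex) set" where
  "L2_line = {f. f \<in> borel_measurable lborel \<and> L2norm lborel f < \<top>}"

text \<open>
  The unitary Fourier transform on the square integrable functions: the integral over the whole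
  line need not converge, and the transform is the mean-square limit of the integrals over
  bounded intervals. It is determined up to a null set, so \<open>fourier_L2\<close> picks one representative;
  everything below depends only on the class modulo null sets. By Plancherel's theorem such a
  transform exists for every square integrable function.
\<close>

definition fourier_cutoff :: "real \<Rightarrow> (real \<Rightarrow> complex) \<Rightarrow> real \<Rightarrow> complex" where
  "fourier_cutoff R f \<xi> =
     complex_of_real (1 / sqrt (2 * pi)) *
     (LINT x:{-R..R}|lborel. exp (- \<i> * complex_of_real (\<xi> * x)) * f x)"

definition has_fourier_L2 :: "(real \<Rightarrow> complex) \<Rightarrow> (real \<Rightarrow> complex) \<Rightarrow> bool" where
  "has_fourier_L2 f F \<longleftrightarrow>
     F \<in> borel_measurable lborel \<and>
     ((\<lambda>R. L2norm lborel (\<lambda>\<xi>. F \<xi> - fourier_cutoff R f \<xi>)) \<longlongrightarrow> 0) at_top"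

definition fourier_L2 :: "(real \<Rightarrow> complex) \<Rightarrow> real \<Rightarrow> complex" where
  "fourier_L2 f = (SOME F. has_fourier_L2 f F)"

definition sobolev_norm :: "real \<Rightarrow> (real \<Rightarrow> complex) \<Rightarrow> ennreal" where
  "sobolev_norm r f =
     L2norm lborel (\<lambda>\<xi>. complex_of_real ((1 + \<xi>\<^sup>2) powr (r / 2)) * fourier_L2 f \<xi>)"

text \<open>
  The Euclidean convention for pairs; other usual ones differ by at most a factor \<open>sqrt 2\<close>.
\<close>

definition sobolev_norm_pair ::
    "real \<Rightarrow> (real \<Rightarrow> complex) \<Rightarrow> (real \<Rightarrow> complex) \<Rightarrow> ennreal" where
  "sobolev_norm_pair r f g = ennreal_sqrt ((sobolev_norm r f)\<^sup>2 + (sobolev_norm r g)\<^sup>2)"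

text \<open>
  The Sobolev space of order \<open>r\<close>, for \<open>r \<ge> 0\<close> only (negative orders would require tempered
  distributions). The clause on \<open>has_fourier_L2\<close> is automatic by Plancherel's theorem; it records
  that \<open>fourier_L2 f\<close> is the transform of \<open>f\<close>.
\<close>

definition sobolev_space :: "real \<Rightarrow> (real \<Rightarrow> complex) set" where
  "sobolev_space r =
     {f \<in> L2_line. has_fourier_L2 f (fourier_L2 f) \<and> sobolev_norm r f < \<top>}"

definition l2_seq :: "zseq set" where
  "l2_seq = {v. (\<lambda>n. (cmod (v n))\<^sup>2) summable_on UNIV}"

definition l2norm :: "real \<Rightarrow> zseq \<Rightarrow> real" where
  "l2norm h v = sqrt (h * (\<Sum>\<^sub>\<infinity>n. (cmod (v n))\<^sup>2))"

definition linfnorm :: "zseq \<Rightarrow> ennreal" where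
  "linfnorm v = (SUP n. ennreal (cmod (v n)))"

definition central_diff :: "real \<Rightarrow> zseq \<Rightarrow> zseq" where
  "central_diff h v = (\<lambda>n. (v (n + 1) - v (n - 1)) / complex_of_real (2 * h))"

text \<open>
  For a square summable sequence the series defining the discrete Fourier transform converges in
  mean square on one period. As above, \<open>dft\<close> picks a representative modulo null sets.
\<close>

definition has_dft :: "real \<Rightarrow> zseq \<Rightarrow> (real \<Rightarrow> complex) \<Rightarrow> bool" where
  "has_dft h v F \<longleftrightarrow>
     F \<in> borel_measurable lborel \<and>
     (\<lambda>N. L2norm (restrict_space lborel {-pi/h..pi/h})
        (\<lambda>\<xi>. F \<xi> - complex_of_real (h / sqrt (2 * pi)) *
          (\<Sum>n = - int N..int N. exp (- \<i> * complex_of_real (\<xi> * real_of_int n * h)) * v n)))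
     \<longlonglongrightarrow> 0"

definition dft :: "real \<Rightarrow> zseq \<Rightarrow> real \<Rightarrow> complex" where
  "dft h v = (SOME F. has_dft h v F)"

text \<open>
  The values of \<open>powr\<close> at base \<open>0\<close> do not matter, since \<open>sin (\<xi> h)\<close> vanishes on a null set only.
\<close>

definition hdot_norm :: "real \<Rightarrow> real \<Rightarrow> zseq \<Rightarrow> ennreal" where
  "hdot_norm h r v =
     L2norm (restrict_space lborel {-pi/h<..<pi/h})
       (\<lambda>\<xi>. dft h v \<xi> * complex_of_real (\<bar>sin (\<xi> * h) / h\<bar> powr r))"

definition truncation :: "real \<Rightarrow> (real \<Rightarrow> complex) \<Rightarrow> zseq" where
  "truncation h f = (\<lambda>n.
     complex_of_real (1 / sqrt (2 * pi)) *
     (LINT \<xi>:{-pi/h..pi/h}|lborel.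
        exp (\<i> * complex_of_real (\<xi> * real_of_int n * h)) * fourier_L2 f \<xi>))"

text \<open>
  In the two norms in time, \<open>N\<close> is the norm of the space in which \<open>g\<close> takes its values.
\<close>

definition L1T :: "real \<Rightarrow> (zseq \<Rightarrow> ennreal) \<Rightarrow> (real \<Rightarrow> zseq) \<Rightarrow> ennreal" where
  "L1T T N g = (\<integral>\<^sup>+t. N (g t) \<partial>restrict_space lborel {0<..<T})"

definition LinfT :: "real \<Rightarrow> (zseq \<Rightarrow> ennreal) \<Rightarrow> (real \<Rightarrow> zseq) \<Rightarrow> ennreal" where
  "LinfT T N g = esssup (restrict_space lborel {0<..<T}) (\<lambda>t. N (g t))"

text \<open>
  \<open>C1_l2 h u u'\<close>: \<open>u\<close> is continuously differentiable on \<open>[0,\<infinity>)\<close> with values in the square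
  summable sequences, one-sidedly at \<open>0\<close>, with derivative \<open>u'\<close>.
\<close>

definition C1_l2 :: "real \<Rightarrow> (real \<Rightarrow> zseq) \<Rightarrow> (real \<Rightarrow> zseq) \<Rightarrow> bool" where
  "C1_l2 h u u' \<longleftrightarrow>
     (\<forall>t\<ge>0. u t \<in> l2_seq \<and> u' t \<in> l2_seq \<and>
        ((\<lambda>\<tau>. l2norm h (\<lambda>n. (u \<tau> n - u t n) / complex_of_real (\<tau> - t) - u' t n)) \<longlongrightarrow> 0)
          (at t within {0..}) \<and>
        ((\<lambda>\<tau>. l2norm h (\<lambda>n. u' \<tau> n - u' t n)) \<longlongrightarrow> 0) (at t within {0..}))"

definition relaxation_solution ::
    "real \<Rightarrow> real \<Rightarrow> zseq \<Rightarrow> zseq \<Rightarrow> (real \<Rightarrow> zseq) \<Rightarrow> (real \<Rightarrow> zseq) \<Rightarrow> bool" where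
  "relaxation_solution h \<epsilon> \<rho>0 u0 \<rho> u \<longleftrightarrow>
     (\<exists>\<rho>' u'. C1_l2 h \<rho> \<rho>' \<and> C1_l2 h u u' \<and>
        (\<forall>t\<ge>0. \<forall>n. \<rho>' t n + central_diff h (u t) n = 0 \<and>
           complex_of_real (\<epsilon>\<^sup>2) * u' t n + central_diff h (\<rho> t) n + u t n = 0)) \<and>
     \<rho> 0 = \<rho>0 \<and> u 0 = u0"

definition heat_solution :: "real \<Rightarrow> zseq \<Rightarrow> (real \<Rightarrow> zseq) \<Rightarrow> bool" where
  "heat_solution h \<rho>0 \<rho> \<longleftrightarrow>
     (\<exists>\<rho>'. C1_l2 h \<rho> \<rho>' \<and>
        (\<forall>t\<ge>0. \<forall>n. \<rho>' t n - central_diff h (central_diff h (\<rho> t)) n = 0)) \<and>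
     \<rho> 0 = \<rho>0"

text \<open>
  \<open>truncated_data s' h \<delta> \<rho>s us \<rho>0 \<rho>st ust \<rho>0t\<close>: the grid data \<open>(\<rho>s, us, \<rho>0)\<close>, i.e.
  \<open>(\<rho>\<^sub>0\<^sup>*, u\<^sub>0\<^sup>*, \<rho>\<^sub>0)\<close>, are \<open>(s',h)\<close>-truncated of order \<open>\<delta>\<close>, with associated functions
  \<open>\<rho>st\<close>, \<open>ust\<close>, \<open>\<rho>0t\<close> on the line. Being truncated means that some such functions exist; they
  are kept as arguments because the size of the data is measured through them.
\<close>

definition truncated_data ::
    "real \<Rightarrow> real \<Rightarrow> real \<Rightarrow> zseq \<Rightarrow> zseq \<Rightarrow> zseq \<Rightarrow>
     (real \<Rightarrow> complex) \<Rightarrow> (real \<Rightarrow> complex) \<Rightarrow> (real \<Rightarrow> complex) \<Rightarrow> bool" where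
  "truncated_data s' h \<delta> \<rho>s us \<rho>0 \<rho>st ust \<rho>0t \<longleftrightarrow>
     \<rho>0t \<in> sobolev_space (s' - 2) \<and> \<rho>st \<in> sobolev_space s' \<and> ust \<in> sobolev_space s' \<and>
     sobolev_norm (s' - 2) (\<lambda>x. \<rho>0t x - \<rho>st x) < ennreal \<delta> \<and>
     \<rho>0 = truncation h \<rho>0t \<and> \<rho>s = truncation h \<rho>st \<and> us = truncation h ust"

definition data_size ::
    "real \<Rightarrow> real \<Rightarrow> (real \<Rightarrow> complex) \<Rightarrow> (real \<Rightarrow> complex) \<Rightarrow> ennreal" where
  "data_size s' \<epsilon> \<rho>st ust =
     1 + sobolev_norm_pair s' \<rho>st (\<lambda>x. complex_of_real \<epsilon> * ust x) + sobolev_norm (s' - 1) ust"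

end

theory Submission
  imports Defs
begin

text \<open>
  On the Fourier side the difference operator becomes multiplication by \<open>\<i> m\<close> with
  \<open>m = sin (\<xi> h) / h\<close>, and the relaxation system is, at each frequency, a \<open>2 \<times> 2\<close> linear system
  whose only parameter after rescaling time by \<open>\<epsilon>\<^sup>2\<close> is \<open>q = \<epsilon> m\<close>. For \<open>\<bar>q\<bar> \<le> 1/4\<close> it is diagonal in a
  slow variable, which follows the heat flow up to \<open>O(q\<^sup>2)\<close>, and a fast variable close to
  \<open>\<i> m \<rho> + u\<close>, damped on the time scale \<open>\<epsilon>\<^sup>2\<close>. For \<open>\<bar>q\<bar> \<ge> 1/4\<close> a hypocoercive functional gives
  uniform exponential decay on that scale, and \<open>1 \<le> 16 \<epsilon>\<^sup>2 m\<^sup>2\<close> trades two derivatives for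
  \<open>\<epsilon>\<^sup>2\<close>. The gap \<open>s < s'\<close> pays for exchanging the \<open>L\<^sup>1\<close> norm in time with the \<open>L\<^sup>2\<close> norm in
  frequency: a smoothing factor \<open>t powr (\<theta> - 1)\<close> is integrable at \<open>0\<close> when \<open>\<theta> > 0\<close>. Since
  \<open>\<bar>m\<bar> \<le> \<bar>\<xi>\<bar>\<close>, all symbols are dominated by the Sobolev weights of the data. The norms on the
  grid are recovered from these pointwise bounds because the trigonometric system is complete.
\<close>

subsection \<open>Square integrable functions\<close>

text \<open>The transforms \<open>dft\<close> and \<open>fourier_L2\<close> are given by choice and
  the two flows only by their equations. Explicit formulas become available through uniqueness:
  mean-square limits agree almost everywhere, and the grid systems have one solution for given data.
  The threshold 1/4 keeps \<open>q\<close> away from \<open>\<bar>q\<bar> = 1/2\<close>, the double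
  root of the characteristic equation, where the slow and fast variables become parallel and the
  diagonalisation degenerates. The velocity data are not assumed close to equilibrium. The fast
  variable therefore starts at order one, and \<open>\<i> m \<rho> + u\<close> becomes small only
  after integration over a layer of width \<open>\<epsilon>\<^sup>2\<close>. The same data shift the
  slow variable by a term of size \<open>\<epsilon>\<^sup>2 \<bar>m\<bar> \<bar>u\<bar>\<close>,
  which costs one derivative and explains the velocity norm of order \<open>s' - 1\<close> without
  \<open>\<epsilon>\<close>. High frequencies see the velocity only as \<open>\<epsilon> u\<close>
  but cost two derivatives, which explains the norm of \<open>\<epsilon> u\<close> of order
  \<open>s'\<close>.\<close>

lemma power2_mono_ennreal: "(x::ennreal) \<le> y \<longleftrightarrow> x\<^sup>2 \<le> y\<^sup>2"
proof
  assume "x \<le> y" then show "x\<^sup>2 \<le> y\<^sup>2" by (simp add: power_mono)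
next
  assume *: "x\<^sup>2 \<le> y\<^sup>2"
  show "x \<le> y"
  proof (cases y)
    case (real b)
    then have "x\<^sup>2 < \<top>" using * by (auto simp: ennreal_power top_unique less_top[symmetric])
    then obtain a where "x = ennreal a" "a \<ge> 0" by (cases x) (auto simp: power_eq_top_ennreal)
    with real * show ?thesis by (simp add: ennreal_power ennreal_le_iff power2_le_iff_abs_le)
  qed simp
qed

lemma ennreal_sqrt_power2 [simp]: "(ennreal_sqrt x)\<^sup>2 = x"
  by (cases x) (auto simp: ennreal_sqrt_def ennreal_power power_eq_top_ennreal)

lemma ennreal_sqrt_le_iff: "ennreal_sqrt x \<le> y \<longleftrightarrow> x \<le> y\<^sup>2"
  using power2_mono_ennreal[of "ennreal_sqrt x" y] by simp

lemma le_ennreal_sqrt_iff: "y \<le> ennreal_sqrt x \<longleftrightarrow> y\<^sup>2 \<le> x"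
  using power2_mono_ennreal[of y "ennreal_sqrt x"] by simp

lemma ennreal_sqrt_mono: "x \<le> y \<Longrightarrow> ennreal_sqrt x \<le> ennreal_sqrt y"
  by (simp add: ennreal_sqrt_le_iff)

lemma ennreal_sqrt_eq_0_iff: "ennreal_sqrt x = 0 \<longleftrightarrow> x = 0"
  by (metis ennreal_sqrt_power2 le_zero_eq power2_mono_ennreal power_zero_numeral)

lemma ennreal_sqrt_less_iff: "ennreal_sqrt x < y \<longleftrightarrow> x < y\<^sup>2"
  using le_ennreal_sqrt_iff[of y x] by (simp add: not_le[symmetric])

lemma ennreal_sqrt_less_top: "ennreal_sqrt x < \<top> \<longleftrightarrow> x < \<top>"
  by (simp add: ennreal_sqrt_less_iff)

lemma ennreal_sqrt_cmult: "ennreal_sqrt (c\<^sup>2 * x) = c * ennreal_sqrt x"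
  by (rule antisym) (simp_all add: ennreal_sqrt_le_iff le_ennreal_sqrt_iff power_mult_distrib)

lemma measurable_ennreal_sqrt [measurable]: "ennreal_sqrt \<in> borel_measurable borel"
proof (rule borel_measurableI_le)
  fix a
  have "{w \<in> space borel. ennreal_sqrt w \<le> a} = {..a\<^sup>2}"
    by (auto simp: ennreal_sqrt_le_iff)
  then show "{w \<in> space borel. ennreal_sqrt w \<le> a} \<in> sets borel" by simp
qed

text \<open>Dominated convergence speaks about integrals of squares; this carries its conclusion
  over to \<open>L2norm\<close>.\<close>

lemma tendsto_ennreal_sqrt_0_iff:
  "((\<lambda>x. ennreal_sqrt (f x)) \<longlongrightarrow> 0) F \<longleftrightarrow> (f \<longlongrightarrow> 0) F"
proof
  assume *: "((\<lambda>x. ennreal_sqrt (f x)) \<longlongrightarrow> 0) F"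
  show "(f \<longlongrightarrow> 0) F"
  proof (rule order_tendstoI)
    fix a :: ennreal assume "0 < a"
    then have "0 < ennreal_sqrt a" by (metis ennreal_sqrt_eq_0_iff not_gr_zero)
    from order_tendstoD(2)[OF * this] show "\<forall>\<^sub>F x in F. f x < a"
      by eventually_elim (simp add: ennreal_sqrt_less_iff)
  qed simp
next
  assume *: "(f \<longlongrightarrow> 0) F"
  show "((\<lambda>x. ennreal_sqrt (f x)) \<longlongrightarrow> 0) F"
  proof (rule order_tendstoI)
    fix a :: ennreal assume "0 < a"
    then have "0 < a\<^sup>2" by (simp add: power2_eq_square ennreal_zero_less_mult_iff)
    from order_tendstoD(2)[OF * this] show "\<forall>\<^sub>F x in F. ennreal_sqrt (f x) < a"
      by eventually_elim (simp add: ennreal_sqrt_less_iff)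
  qed simp
qed

lemma L2norm_less_top_iff:
  "L2norm M f < \<top> \<longleftrightarrow> (\<integral>\<^sup>+x. ennreal ((cmod (f x))\<^sup>2) \<partial>M) < \<top>"
  by (simp add: L2norm_def ennreal_sqrt_less_top)

lemma L2norm_power2: "(L2norm M f)\<^sup>2 = (\<integral>\<^sup>+x. ennreal ((cmod (f x))\<^sup>2) \<partial>M)"
  by (simp add: L2norm_def)

lemma L2norm_mono_AE:
  assumes "AE x in M. cmod (f x) \<le> cmod (g x)"
  shows "L2norm M f \<le> L2norm M g"
  unfolding L2norm_def
  by (intro ennreal_sqrt_mono nn_integral_mono_AE) (use assms in \<open>auto elim!: eventually_mono intro!: ennreal_leI power_mono\<close>)

lemma L2norm_cong_AE:
  assumes "AE x in M. f x = g x"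
  shows "L2norm M f = L2norm M g"
  by (intro antisym L2norm_mono_AE) (use assms in auto)

lemma L2norm_cmult:
  assumes "f \<in> borel_measurable M" "0 \<le> c"
  shows "L2norm M (\<lambda>x. complex_of_real c * f x) = ennreal c * L2norm M f"
proof -
  have "L2norm M (\<lambda>x. complex_of_real c * f x) =
      ennreal_sqrt (\<integral>\<^sup>+x. (ennreal c)\<^sup>2 * ennreal ((cmod (f x))\<^sup>2) \<partial>M)"
    using assms by (simp add: L2norm_def norm_mult power_mult_distrib ennreal_mult ennreal_power)
  also have "\<dots> = ennreal_sqrt ((ennreal c)\<^sup>2 * (\<integral>\<^sup>+x. ennreal ((cmod (f x))\<^sup>2) \<partial>M))"
    using assms by (subst nn_integral_cmult) auto
  finally show ?thesis by (simp add: ennreal_sqrt_cmult L2norm_def)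
qed

text \<open>Constants are immaterial below, so the factor 2 replaces Minkowski's inequality.\<close>

lemma nn_integral_cmod_add:
  assumes [measurable]: "f \<in> borel_measurable M" "g \<in> borel_measurable M"
  shows "(\<integral>\<^sup>+x. ennreal ((cmod (f x + g x))\<^sup>2) \<partial>M) \<le>
    2 * (\<integral>\<^sup>+x. ennreal ((cmod (f x))\<^sup>2) \<partial>M) + 2 * (\<integral>\<^sup>+x. ennreal ((cmod (g x))\<^sup>2) \<partial>M)"
proof -
  have *: "ennreal ((cmod (f x + g x))\<^sup>2) \<le>
      2 * ennreal ((cmod (f x))\<^sup>2) + 2 * ennreal ((cmod (g x))\<^sup>2)" for x
  proof -
    have "(cmod (f x + g x))\<^sup>2 \<le> (cmod (f x) + cmod (g x))\<^sup>2"
      by (intro power_mono norm_triangle_ineq) auto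
    also have "\<dots> \<le> 2 * (cmod (f x))\<^sup>2 + 2 * (cmod (g x))\<^sup>2"
      using sum_squares_bound[of "cmod (f x)" "cmod (g x)"] by (simp add: power2_sum)
    finally have "ennreal ((cmod (f x + g x))\<^sup>2) \<le> ennreal (2 * (cmod (f x))\<^sup>2 + 2 * (cmod (g x))\<^sup>2)"
      by (rule ennreal_leI)
    then show ?thesis by (simp add: ennreal_plus ennreal_mult)
  qed
  have "(\<integral>\<^sup>+x. ennreal ((cmod (f x + g x))\<^sup>2) \<partial>M) \<le>
      (\<integral>\<^sup>+x. 2 * ennreal ((cmod (f x))\<^sup>2) + 2 * ennreal ((cmod (g x))\<^sup>2) \<partial>M)"
    by (intro nn_integral_mono *)
  also have "\<dots> = 2 * (\<integral>\<^sup>+x. ennreal ((cmod (f x))\<^sup>2) \<partial>M) + 2 * (\<integral>\<^sup>+x. ennreal ((cmod (g x))\<^sup>2) \<partial>M)"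
    by (subst nn_integral_add) (auto simp: nn_integral_cmult)
  finally show ?thesis .
qed

lemma L2norm_add:
  assumes "f \<in> borel_measurable M" "g \<in> borel_measurable M"
  shows "L2norm M (\<lambda>x. f x + g x) \<le> 2 * (L2norm M f + L2norm M g)"
proof -
  have "(\<integral>\<^sup>+x. ennreal ((cmod (f x + g x))\<^sup>2) \<partial>M) \<le> 2 * (L2norm M f)\<^sup>2 + 2 * (L2norm M g)\<^sup>2"
    using nn_integral_cmod_add[OF assms] by (simp add: L2norm_power2)
  also have "\<dots> \<le> (2 * (L2norm M f + L2norm M g))\<^sup>2"
  proof -
    have "2 * (L2norm M f)\<^sup>2 + 2 * (L2norm M g)\<^sup>2 = 2 * ((L2norm M f)\<^sup>2 + (L2norm M g)\<^sup>2)"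
      by (simp add: distrib_left)
    also have "\<dots> \<le> 4 * ((L2norm M f)\<^sup>2 + (L2norm M g)\<^sup>2 + 2 * L2norm M f * L2norm M g)"
      by (intro mult_mono) auto
    also have "\<dots> = (2 * (L2norm M f + L2norm M g))\<^sup>2"
      by (simp only: power_mult_distrib power2_sum) (simp add: mult_ac)
    finally show ?thesis .
  qed
  finally show ?thesis by (simp add: L2norm_def[of M "\<lambda>x. f x + g x"] ennreal_sqrt_le_iff)
qed

lemma L2norm_diff_eq_0_imp_AE:
  assumes [measurable]: "f \<in> borel_measurable M" "g \<in> borel_measurable M"
    and "L2norm M (\<lambda>x. f x - g x) = 0"
  shows "AE x in M. f x = g x"
proof -
  have "(\<integral>\<^sup>+x. ennreal ((cmod (f x - g x))\<^sup>2) \<partial>M) = 0"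
    using assms(3) by (simp add: L2norm_def ennreal_sqrt_eq_0_iff)
  then show ?thesis by (simp add: nn_integral_0_iff_AE)
qed

text \<open>Transforms defined by choice are known only as mean-square limits, and this is what
  identifies the chosen representative with an explicit one. The filter is left general: bounded
  integrals on the line converge along real \<open>at_top\<close>, series on a period along
  \<open>sequentially\<close>.\<close>

lemma L2norm_limit_unique_AE:
  assumes [measurable]: "F \<in> borel_measurable M" "G \<in> borel_measurable M"
      "\<And>n. f n \<in> borel_measurable M"
    and "((\<lambda>n. L2norm M (\<lambda>x. F x - f n x)) \<longlongrightarrow> 0) U"
      "((\<lambda>n. L2norm M (\<lambda>x. G x - f n x)) \<longlongrightarrow> 0) U"
    and "U \<noteq> bot"
  shows "AE x in M. F x = G x"
proof (rule L2norm_diff_eq_0_imp_AE)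
  have le: "L2norm M (\<lambda>x. F x - G x) \<le>
      2 * (L2norm M (\<lambda>x. F x - f n x) + L2norm M (\<lambda>x. G x - f n x))" for n
  proof -
    have "L2norm M (\<lambda>x. F x - G x) = L2norm M (\<lambda>x. (F x - f n x) + (f n x - G x))" by simp
    also have "\<dots> \<le> 2 * (L2norm M (\<lambda>x. F x - f n x) + L2norm M (\<lambda>x. f n x - G x))"
      by (rule L2norm_add) auto
    also have "L2norm M (\<lambda>x. f n x - G x) = L2norm M (\<lambda>x. G x - f n x)"
      by (simp add: L2norm_def norm_minus_commute)
    finally show ?thesis .
  qed
  have "((\<lambda>n. 2 * (L2norm M (\<lambda>x. F x - f n x) + L2norm M (\<lambda>x. G x - f n x))) \<longlongrightarrow> 2 * (0 + 0)) U"
    by (intro ennreal_tendsto_cmult tendsto_add assms) auto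
  then have "L2norm M (\<lambda>x. F x - G x) \<le> 0"
    by (intro tendsto_lowerbound[where F=U]) (use le assms(6) in auto)
  then show "L2norm M (\<lambda>x. F x - G x) = 0" by simp
qed auto

subsection \<open>The trigonometric system on one period\<close>

text \<open>A density on the whole line rather than a restricted space, so that measurability is
  plain Borel measurability and functions need no restriction. With \<open>h = pi / R\<close> it
  also serves as Lebesgue measure on [-R, R].\<close>

definition period_measure :: "real \<Rightarrow> real measure" where
  "period_measure h = density lborel (\<lambda>x. ennreal (indicator {-pi/h..pi/h} x))"

lemma sets_period_measure [measurable_cong, simp]: "sets (period_measure h) = sets borel"
  and space_period_measure [simp]: "space (period_measure h) = UNIV"
  by (simp_all add: period_measure_def)

lemma nn_integral_period_measure:
  assumes "f \<in> borel_measurable borel"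
  shows "(\<integral>\<^sup>+x. f x \<partial>period_measure h) = (\<integral>\<^sup>+x. f x * indicator {-pi/h..pi/h} x \<partial>lborel)"
  unfolding period_measure_def using assms
  by (subst nn_integral_density) (auto intro!: nn_integral_cong simp: indicator_def mult.commute)

lemma integral_period_measure:
  fixes f :: "real \<Rightarrow> complex"
  assumes "f \<in> borel_measurable borel"
  shows "(LINT x|period_measure h. f x) = (LINT x:{-pi/h..pi/h}|lborel. f x)"
  unfolding period_measure_def set_lebesgue_integral_def using assms
  by (subst integral_density) auto

lemma AE_period_measure_iff:
  "(AE x in period_measure h. P x) \<longleftrightarrow> (AE x in lborel. x \<in> {-pi/h..pi/h} \<longrightarrow> P x)"
  unfolding period_measure_def by (subst AE_density) (auto simp: indicator_def)

lemma AE_period_measure_greaterThanLessThan: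
  "AE x in period_measure h. x \<in> {-pi/h<..<pi/h}"
proof -
  have "AE x in lborel. x \<noteq> -pi/h \<and> x \<noteq> pi/h"
    using AE_lborel_singleton[of "-pi/h"] AE_lborel_singleton[of "pi/h"] by eventually_elim auto
  then show ?thesis unfolding AE_period_measure_iff by eventually_elim auto
qed

lemma emeasure_period_measure:
  assumes "h > 0"
  shows "emeasure (period_measure h) UNIV = ennreal (2 * pi / h)"
  using assms nn_integral_period_measure[of "\<lambda>_. 1" h] by (simp add: field_simps)

lemma finite_measure_period_measure:
  assumes "h > 0"
  shows "finite_measure (period_measure h)"
  by (rule finite_measureI) (simp add: emeasure_period_measure[OF assms])

lemma L2norm_restrict_closed:
  assumes [measurable]: "f \<in> borel_measurable borel"
  shows "L2norm (restrict_space lborel {-pi/h..pi/h}) f = L2norm (period_measure h) f"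
  unfolding L2norm_def by (simp add: nn_integral_restrict_space nn_integral_period_measure)

lemma L2norm_restrict_open:
  assumes [measurable]: "f \<in> borel_measurable borel"
  shows "L2norm (restrict_space lborel {-pi/h<..<pi/h}) f = L2norm (period_measure h) f"
proof -
  have "(\<integral>\<^sup>+x. ennreal ((cmod (f x))\<^sup>2) * indicator {-pi/h<..<pi/h} x \<partial>lborel) =
    (\<integral>\<^sup>+x. ennreal ((cmod (f x))\<^sup>2) * indicator {-pi/h..pi/h} x \<partial>lborel)"
  proof (rule nn_integral_cong_AE)
    show "AE x in lborel. ennreal ((cmod (f x))\<^sup>2) * indicator {-pi/h<..<pi/h} x =
        ennreal ((cmod (f x))\<^sup>2) * indicator {-pi/h..pi/h} x"
      using AE_lborel_singleton[of "-pi/h"] AE_lborel_singleton[of "pi/h"]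
      by eventually_elim (auto simp: indicator_def)
  qed
  then show ?thesis
    unfolding L2norm_def by (simp add: nn_integral_restrict_space nn_integral_period_measure)
qed

text \<open>The exponents carry the minus sign of the discrete Fourier series, so that these are
  exactly its finite sums.\<close>

inductive_set trig_polys :: "real \<Rightarrow> (real \<Rightarrow> complex) set" for h where
  monom: "(\<lambda>\<xi>. c * cis (- \<xi> * real_of_int n * h)) \<in> trig_polys h"
| add: "f \<in> trig_polys h \<Longrightarrow> g \<in> trig_polys h \<Longrightarrow> (\<lambda>\<xi>. f \<xi> + g \<xi>) \<in> trig_polys h"

lemma trig_polys_const: "(\<lambda>_. c) \<in> trig_polys h"
  using trig_polys.monom[of c 0 h] by simp

lemma trig_polys_mult:
  assumes "f \<in> trig_polys h" "g \<in> trig_polys h"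
  shows "(\<lambda>\<xi>. f \<xi> * g \<xi>) \<in> trig_polys h"
  using assms
proof (induction f rule: trig_polys.induct)
  case (monom c n)
  then show ?case
  proof (induction g rule: trig_polys.induct)
    case (monom d m)
    have "(\<lambda>\<xi>. c * cis (- \<xi> * real_of_int n * h) * (d * cis (- \<xi> * real_of_int m * h))) =
       (\<lambda>\<xi>. (c * d) * cis (- \<xi> * real_of_int (n + m) * h))"
      by (rule ext) (simp add: mult_ac cis_mult algebra_simps)
    then show ?case using trig_polys.monom[of "c * d" "n + m" h] by simp
  next
    case (add f g)
    then show ?case using trig_polys.add by (fastforce simp: distrib_left)
  qed
next
  case (add f1 f2)
  then show ?case using trig_polys.add by (fastforce simp: distrib_right)
qed

lemma measurable_trig_polys: "f \<in> trig_polys h \<Longrightarrow> f \<in> borel_measurable borel"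
  by (induction rule: trig_polys.induct)
    (auto intro!: borel_measurable_continuous_onI continuous_intros borel_measurable_add
      continuous_on_cis)

text \<open>Padding with zero coefficients lets one polynomial be written with any large enough
  cutoff. Having this for all \<open>K \<ge> N\<close> is what the comparison with every late
  Fourier partial sum requires.\<close>

lemma trig_polys_eq_sum:
  assumes "f \<in> trig_polys h"
  shows "\<exists>c N. \<forall>K\<ge>N. f = (\<lambda>\<xi>. \<Sum>n=-int K..int K. c n * cis (- \<xi> * real_of_int n * h))"
  using assms
proof (induction rule: trig_polys.induct)
  case (monom c n)
  have "(\<lambda>\<xi>. c * cis (- \<xi> * real_of_int n * h)) =
      (\<lambda>\<xi>. \<Sum>k=-int K..int K. (if k = n then c else 0) * cis (- \<xi> * real_of_int k * h))"
    if "K \<ge> nat \<bar>n\<bar>" for K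
  proof
    fix \<xi>
    have "n \<in> {-int K..int K}" using that by auto
    then show "c * cis (- \<xi> * real_of_int n * h) =
        (\<Sum>k=-int K..int K. (if k = n then c else 0) * cis (- \<xi> * real_of_int k * h))"
      by (simp add: if_distrib[of "\<lambda>x. x * _"] cong: if_cong)
  qed
  then show ?case by (intro exI[of _ "\<lambda>k. if k = n then c else 0"] exI[of _ "nat \<bar>n\<bar>"]) blast
next
  case (add f g)
  then obtain c d N M where *:
    "\<forall>K\<ge>N. f = (\<lambda>\<xi>. \<Sum>n=-int K..int K. c n * cis (- \<xi> * real_of_int n * h))"
    "\<forall>K\<ge>M. g = (\<lambda>\<xi>. \<Sum>n=-int K..int K. d n * cis (- \<xi> * real_of_int n * h))"
    by blast
  have "(\<lambda>\<xi>. f \<xi> + g \<xi>) =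
      (\<lambda>\<xi>. \<Sum>n=-int K..int K. (c n + d n) * cis (- \<xi> * real_of_int n * h))" if "K \<ge> max N M" for K
  proof
    fix \<xi>
    have f: "f \<xi> = (\<Sum>n=-int K..int K. c n * cis (- \<xi> * real_of_int n * h))"
      by (rule fun_cong[OF *(1)[rule_format]]) (use that in simp)
    have g: "g \<xi> = (\<Sum>n=-int K..int K. d n * cis (- \<xi> * real_of_int n * h))"
      by (rule fun_cong[OF *(2)[rule_format]]) (use that in simp)
    show "f \<xi> + g \<xi> = (\<Sum>n=-int K..int K. (c n + d n) * cis (- \<xi> * real_of_int n * h))"
      by (simp only: f g distrib_right sum.distrib)
  qed
  then show ?case by (intro exI[of _ "\<lambda>n. c n + d n"] exI[of _ "max N M"]) blast
qed

lemma trig_polys_real_polynomial_function: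
  assumes "real_polynomial_function p"
  shows "(\<lambda>\<xi>. complex_of_real (p (cis (\<xi> * h)))) \<in> trig_polys h"
  using assms
proof (induction rule: real_polynomial_function.induct)
  case (linear p)
  have p: "p z = Re z * p 1 + Im z * p \<i>" for z
  proof -
    have "p z = p (Re z *\<^sub>R 1 + Im z *\<^sub>R \<i>)" by (rule arg_cong[of _ _ p]) (simp add: complex_eq_iff)
    also have "\<dots> = Re z * p 1 + Im z * p \<i>"
      using linear by (simp only: linear_simps) simp
    finally show ?thesis .
  qed
  \<comment> \<open>Real and imaginary part of \<open>z = cis (\<xi> * h)\<close> are
    \<open>(z + cnj z) / 2\<close> and \<open>(z - cnj z) / (2 * \<i>)\<close>, which yields the two
    coefficients below.\<close>
  let ?a = "complex_of_real (p 1)" and ?b = "complex_of_real (p \<i>)"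
  have "(\<lambda>\<xi>. complex_of_real (p (cis (\<xi> * h)))) =
     (\<lambda>\<xi>. ((?a + \<i> * ?b) / 2) * cis (- \<xi> * real_of_int 1 * h) + ((?a - \<i> * ?b) / 2) * cis (- \<xi> * real_of_int (-1) * h))"
    by (rule ext, subst p) (simp add: complex_eq_iff field_simps)
  also have "\<dots> \<in> trig_polys h" by (intro trig_polys.add trig_polys.monom)
  finally show ?case .
next
  case (const c)
  then show ?case by (simp add: trig_polys_const)
next
  case (add f g)
  then show ?case using trig_polys.add by fastforce
next
  case (mult f g)
  then show ?case using trig_polys_mult by fastforce
qed

section \<open>Density of trigonometric polynomials in the square integrable functions on a
  period\<close>

definition trig_approximable :: "real \<Rightarrow> (real \<Rightarrow> complex) \<Rightarrow> bool" where
  "trig_approximable h F \<longleftrightarrow> F \<in> borel_measurable borel \<and>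
     (\<forall>e>0. \<exists>P\<in>trig_polys h. L2norm (period_measure h) (\<lambda>x. F x - P x) < ennreal e)"

lemma trig_approximable_measurable: "trig_approximable h F \<Longrightarrow> F \<in> borel_measurable borel"
  by (simp add: trig_approximable_def)

text \<open>Closedness in mean square is what passes approximability on from continuous functions to
  compact sets, to Borel sets and to arbitrary functions.\<close>

lemma trig_approximable_limit:
  assumes [measurable]: "F \<in> borel_measurable borel"
    and "\<And>e. e > 0 \<Longrightarrow> \<exists>G. trig_approximable h G \<and> L2norm (period_measure h) (\<lambda>x. F x - G x) < ennreal e"
  shows "trig_approximable h F"
  unfolding trig_approximable_def
proof (intro conjI allI impI)
  fix e :: real assume "e > 0"
  \<comment> \<open>The factor 2 of \<open>L2norm_add\<close> leaves a quarter of \<open>e\<close>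
    for each of the two errors.\<close>
  then have e: "e / 4 > 0" by simp
  from assms(2)[OF e] obtain G where G: "trig_approximable h G"
    "L2norm (period_measure h) (\<lambda>x. F x - G x) < ennreal (e / 4)" by blast
  from G(1) e obtain P where P: "P \<in> trig_polys h"
    "L2norm (period_measure h) (\<lambda>x. G x - P x) < ennreal (e / 4)"
    unfolding trig_approximable_def by blast
  have [measurable]: "G \<in> borel_measurable borel" "P \<in> borel_measurable borel"
    using G P measurable_trig_polys trig_approximable_measurable by auto
  have "L2norm (period_measure h) (\<lambda>x. F x - P x) =
     L2norm (period_measure h) (\<lambda>x. (F x - G x) + (G x - P x))" by simp
  also have "\<dots> \<le> 2 * (L2norm (period_measure h) (\<lambda>x. F x - G x) + L2norm (period_measure h) (\<lambda>x. G x - P x))"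
    by (rule L2norm_add) auto
  also have "\<dots> < 2 * (ennreal (e / 4) + ennreal (e / 4))"
    using G(2) P(2) by (intro ennreal_mult_strict_left_mono add_strict_mono) auto
  also have "\<dots> = ennreal e"
    using e by (simp flip: ennreal_plus ennreal_mult' add: ennreal_numeral[symmetric] del: ennreal_numeral)
  finally show "\<exists>P\<in>trig_polys h. L2norm (period_measure h) (\<lambda>x. F x - P x) < ennreal e"
    using P by blast
qed simp

lemma trig_approximable_trig_polys:
  assumes "P \<in> trig_polys h"
  shows "trig_approximable h P"
  using assms measurable_trig_polys unfolding trig_approximable_def
  by (auto intro!: bexI[of _ P] simp: L2norm_def ennreal_sqrt_def)

lemma trig_approximable_add:
  assumes "trig_approximable h F" "trig_approximable h G"
  shows "trig_approximable h (\<lambda>x. F x + G x)"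
  unfolding trig_approximable_def
proof (intro conjI allI impI)
  have [measurable]: "F \<in> borel_measurable borel" "G \<in> borel_measurable borel"
    using assms trig_approximable_measurable by auto
  then show "(\<lambda>x. F x + G x) \<in> borel_measurable borel" by simp
  fix e :: real assume "e > 0"
  then have e: "e / 4 > 0" by simp
  from assms e obtain P Q where P: "P \<in> trig_polys h"
    "L2norm (period_measure h) (\<lambda>x. F x - P x) < ennreal (e / 4)" and
    Q: "Q \<in> trig_polys h" "L2norm (period_measure h) (\<lambda>x. G x - Q x) < ennreal (e / 4)"
    unfolding trig_approximable_def by blast
  have [measurable]: "P \<in> borel_measurable borel" "Q \<in> borel_measurable borel"
    using P Q measurable_trig_polys by auto
  have "L2norm (period_measure h) (\<lambda>x. (F x + G x) - (P x + Q x)) =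
     L2norm (period_measure h) (\<lambda>x. (F x - P x) + (G x - Q x))" by (simp add: algebra_simps)
  also have "\<dots> \<le> 2 * (L2norm (period_measure h) (\<lambda>x. F x - P x) + L2norm (period_measure h) (\<lambda>x. G x - Q x))"
    by (rule L2norm_add) auto
  also have "\<dots> < 2 * (ennreal (e / 4) + ennreal (e / 4))"
    using P(2) Q(2) by (intro ennreal_mult_strict_left_mono add_strict_mono) auto
  also have "\<dots> = ennreal e"
    using e by (simp flip: ennreal_plus ennreal_mult' add: ennreal_numeral[symmetric] del: ennreal_numeral)
  finally show "\<exists>P\<in>trig_polys h. L2norm (period_measure h) (\<lambda>x. F x + G x - P x) < ennreal e"
    by (rule bexI[OF _ trig_polys.add[OF P(1) Q(1)]])
qed

text \<open>Periodicity is built in by composing with the circle map, so Stone-Weierstrass applies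
  on the unit circle. It gives uniform approximation by polynomials in the real and imaginary part,
  that is, by trigonometric polynomials.\<close>

lemma trig_approximable_continuous:
  fixes g :: "complex \<Rightarrow> real"
  assumes "h > 0" "continuous_on UNIV g"
  shows "trig_approximable h (\<lambda>\<xi>. complex_of_real (g (cis (\<xi> * h))))"
  unfolding trig_approximable_def
proof (intro conjI allI impI)
  show m: "(\<lambda>\<xi>. complex_of_real (g (cis (\<xi> * h)))) \<in> borel_measurable borel"
    by (intro borel_measurable_continuous_onI continuous_intros
        continuous_on_compose2[OF assms(2)]) auto
  fix e :: real assume "e > 0"
  \<comment> \<open>\<open>c\<close> is the mean-square size of the constant 1 on a period, so a
    uniform error of \<open>e / (2 * c)\<close> costs \<open>e / 2\<close>.\<close>
  define c where "c = sqrt (2 * pi / h)"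
  have c: "c > 0" using assms by (simp add: c_def)
  define d where "d = e / (2 * c)"
  have d: "d > 0" using c \<open>e > 0\<close> by (simp add: d_def)
  obtain p where p: "real_polynomial_function p" "\<And>z. z \<in> sphere 0 1 \<Longrightarrow> \<bar>g z - p z\<bar> < d"
    using Stone_Weierstrass_real_polynomial_function[OF _ _ d, of "sphere 0 1" g] assms(2)
    by (metis compact_sphere continuous_on_subset top_greatest)
  let ?P = "\<lambda>\<xi>. complex_of_real (p (cis (\<xi> * h)))"
  have P: "?P \<in> trig_polys h" by (rule trig_polys_real_polynomial_function[OF p(1)])
  have "L2norm (period_measure h) (\<lambda>x. complex_of_real (g (cis (x * h))) - ?P x)
      \<le> L2norm (period_measure h) (\<lambda>x. complex_of_real d * 1)"
  proof (rule L2norm_mono_AE, rule AE_I2)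
    fix x
    have "cis (x * h) \<in> sphere 0 1" by simp
    from p(2)[OF this] d show "cmod (complex_of_real (g (cis (x * h))) - ?P x) \<le> cmod (complex_of_real d * 1)"
      by (simp flip: of_real_diff)
  qed
  also have "\<dots> = ennreal d * L2norm (period_measure h) (\<lambda>x. 1)"
    using d by (intro L2norm_cmult) auto
  also have "L2norm (period_measure h) (\<lambda>x. 1) = ennreal c"
    using assms by (simp add: L2norm_def emeasure_period_measure ennreal_sqrt_def c_def)
  also have "ennreal d * ennreal c = ennreal (e / 2)"
    using c d by (simp flip: ennreal_mult) (simp add: d_def)
  also have "\<dots> < ennreal e" using \<open>e > 0\<close> by (simp add: ennreal_lessI)
  finally show "\<exists>P\<in>trig_polys h. L2norm (period_measure h) (\<lambda>x. complex_of_real (g (cis (x * h))) - P x) < ennreal e"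
    by (rule bexI[OF _ P])
qed

text \<open>The two endpoints of the period have the same image, hence the open interval; there the
  principal argument inverts the map.\<close>

lemma inj_on_cis_open_interval:
  assumes "h > 0"
  shows "inj_on (\<lambda>\<xi>. cis (\<xi> * h)) {-pi/h<..<pi/h}"
proof (rule inj_onI)
  fix x y assume xy: "x \<in> {-pi/h<..<pi/h}" "y \<in> {-pi/h<..<pi/h}" "cis (x * h) = cis (y * h)"
  have "Arg (cis (z * h)) = z * h" if "z \<in> {-pi/h<..<pi/h}" for z
    by (rule cis_Arg_unique) (use that assms in \<open>auto simp: field_simps sgn_eq\<close>)
  with xy have "x * h = y * h" by metis
  with assms show "x = y" by simp
qed

text \<open>The tent functions \<open>g k\<close> around the image \<open>C\<close> of
  \<open>K\<close> on the circle are continuous and decrease to the indicator of \<open>C\<close>.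
  Injectivity keeps the points of the open period outside \<open>K\<close> off \<open>C\<close>, and
  dominated convergence turns the pointwise limit into a mean-square one.\<close>

lemma trig_approximable_compact:
  assumes h: "h > 0" and K: "compact K" "K \<subseteq> {-pi/h<..<pi/h}"
  shows "trig_approximable h (\<lambda>x. complex_of_real (indicator K x))"
proof (cases "K = {}")
  case True
  then show ?thesis using trig_approximable_trig_polys[OF trig_polys_const[of 0]] by simp
next
  case False
  interpret finite_measure "period_measure h" by (rule finite_measure_period_measure[OF h])
  define C where "C = (\<lambda>\<xi>. cis (\<xi> * h)) ` K"
  have C: "compact C" "C \<noteq> {}"
    unfolding C_def using False K by (auto intro!: compact_continuous_image continuous_intros)
  define g :: "nat \<Rightarrow> complex \<Rightarrow> real" where "g k z = max 0 (1 - real k * infdist z C)" for k z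
  have g: "continuous_on UNIV (g k)" for k unfolding g_def by (intro continuous_intros)
  have [measurable]: "K \<in> sets borel" using K by (simp add: borel_compact)
  have gm [measurable]: "(\<lambda>\<xi>. complex_of_real (g k (cis (\<xi> * h)))) \<in> borel_measurable borel" for k
    using trig_approximable_continuous[OF h g] by (rule trig_approximable_measurable)
  have lim: "(\<lambda>k. g k (cis (x * h))) \<longlonglongrightarrow> indicator K x" if x: "x \<in> {-pi/h<..<pi/h}" for x
  proof (cases "x \<in> K")
    case True
    then have "infdist (cis (x * h)) C = 0" by (intro infdist_zero) (auto simp: C_def)
    with True show ?thesis by (simp add: g_def)
  next
    case False
    have "cis (x * h) \<notin> C"
      using False x K(2) inj_on_cis_open_interval[OF h] unfolding C_def inj_on_def by blast
    then have pos: "infdist (cis (x * h)) C > 0"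
      using C by (simp add: infdist_pos_not_in_closed compact_imp_closed)
    obtain N :: nat where N: "1 / infdist (cis (x * h)) C < real N" using reals_Archimedean2 by blast
    have "g k (cis (x * h)) = 0" if "k \<ge> N" for k
    proof -
      have "1 / infdist (cis (x * h)) C \<le> real k" using N that by linarith
      then show ?thesis using pos by (simp add: g_def field_simps)
    qed
    then have "\<forall>\<^sub>F k in sequentially. g k (cis (x * h)) = indicator K x"
      using False by (auto simp: eventually_sequentially)
    then show ?thesis by (rule tendsto_eventually)
  qed
  have "(\<lambda>k. \<integral>\<^sup>+x. ennreal ((cmod (complex_of_real (indicator K x) - complex_of_real (g k (cis (x * h)))))\<^sup>2) \<partial>period_measure h)
      \<longlonglongrightarrow> (\<integral>\<^sup>+x. 0 \<partial>period_measure h)"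
  proof (rule nn_integral_dominated_convergence[where w = "\<lambda>_. 1"])
    show "(\<integral>\<^sup>+x. 1 \<partial>period_measure h) < \<infinity>" using h by (simp add: emeasure_period_measure)
    show "AE x in period_measure h.
        ennreal ((cmod (complex_of_real (indicator K x) - complex_of_real (g k (cis (x * h)))))\<^sup>2) \<le> 1" for k
    proof (rule AE_I2)
      fix x
      have "\<bar>indicator K x - g k (cis (x * h))\<bar> \<le> 1"
        using infdist_nonneg[of "cis (x * h)" C] by (auto simp: g_def indicator_def max_def)
      then show "ennreal ((cmod (complex_of_real (indicator K x) - complex_of_real (g k (cis (x * h)))))\<^sup>2) \<le> 1"
        by (simp flip: of_real_diff ennreal_1 add: abs_square_le_1)
    qed
    show "AE x in period_measure h. (\<lambda>k. ennreal ((cmod (complex_of_real (indicator K x)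
        - complex_of_real (g k (cis (x * h)))))\<^sup>2)) \<longlonglongrightarrow> 0"
      using AE_period_measure_greaterThanLessThan
    proof eventually_elim
      case (elim x)
      have "(\<lambda>k. ennreal ((cmod (complex_of_real (indicator K x) - complex_of_real (g k (cis (x * h)))))\<^sup>2))
          \<longlonglongrightarrow> ennreal ((cmod (complex_of_real (indicator K x) - complex_of_real (indicator K x)))\<^sup>2)"
        by (intro tendsto_intros tendsto_ennrealI lim elim)
      then show ?case by simp
    qed
  qed auto
  then have "(\<lambda>k. L2norm (period_measure h) (\<lambda>x. complex_of_real (indicator K x)
       - complex_of_real (g k (cis (x * h))))) \<longlonglongrightarrow> 0"
    by (simp add: L2norm_def tendsto_ennreal_sqrt_0_iff)
  then have ev: "\<exists>k. L2norm (period_measure h) (\<lambda>x. complex_of_real (indicator K x)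
       - complex_of_real (g k (cis (x * h)))) < ennreal e" if "e > 0" for e
    using order_tendstoD(2)[of _ 0 sequentially "ennreal e"] that
    by (metis (mono_tags, lifting) ennreal_less_zero_iff eventually_sequentially order_refl)
  show ?thesis
    by (rule trig_approximable_limit) (use ev trig_approximable_continuous[OF h g] in \<open>auto\<close>)
qed

text \<open>Inner regularity of the finite measure supplies a compact subset. Intersecting with the
  open period first loses only a null set and avoids the endpoints, where the circle map fails to be
  injective. The measure defect is taken below \<open>e\<^sup>2\<close> because the norm is its
  square root.\<close>

lemma trig_approximable_indicator:
  assumes h: "h > 0" and [measurable]: "B \<in> sets borel"
  shows "trig_approximable h (\<lambda>x. complex_of_real (indicator B x))"
proof (rule trig_approximable_limit)
  interpret finite_measure "period_measure h" by (rule finite_measure_period_measure[OF h])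
  fix e :: real assume "e > 0"
  let ?A = "B \<inter> {-pi/h<..<pi/h}" and ?M = "period_measure h"
  have "emeasure ?M ?A = (SUP K \<in> {K. K \<subseteq> ?A \<and> compact K}. emeasure ?M K)"
    by (rule inner_regular) (auto simp: emeasure_period_measure[OF h])
  moreover have "emeasure ?M ?A < emeasure ?M ?A + ennreal (e\<^sup>2)"
    using \<open>e > 0\<close> by (simp add: emeasure_eq_measure flip: ennreal_plus) (simp add: ennreal_less_iff)
  ultimately have "\<exists>K \<in> {K. K \<subseteq> ?A \<and> compact K}. emeasure ?M ?A < emeasure ?M K + ennreal (e\<^sup>2)"
  proof -
    assume sup: "emeasure ?M ?A = (SUP K \<in> {K. K \<subseteq> ?A \<and> compact K}. emeasure ?M K)"
    have "{K. K \<subseteq> ?A \<and> compact K} \<noteq> {}" using compact_empty by blast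
    from SUP_approx_ennreal[OF _ this sup, of "e\<^sup>2"] \<open>e > 0\<close> show ?thesis
      by (simp add: emeasure_eq_measure)
  qed
  then obtain K where K: "K \<subseteq> ?A" "compact K" "emeasure ?M ?A < emeasure ?M K + ennreal (e\<^sup>2)" by blast
  have [measurable]: "K \<in> sets borel" using K by (simp add: borel_compact)
  have "(\<integral>\<^sup>+x. ennreal ((cmod (complex_of_real (indicator B x) - complex_of_real (indicator K x)))\<^sup>2) \<partial>?M)
      = (\<integral>\<^sup>+x. indicator (?A - K) x \<partial>?M)"
    using AE_period_measure_greaterThanLessThan
    by (intro nn_integral_cong_AE, eventually_elim) (use K in \<open>auto simp: indicator_def\<close>)
  also have "\<dots> = emeasure ?M ?A - emeasure ?M K"
    using K(1) by (simp, subst emeasure_Diff) (auto simp: emeasure_eq_measure)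
  also have "\<dots> < ennreal (e\<^sup>2)"
    using K(3) \<open>e > 0\<close> finite_measure_mono[of K ?A] K(1)
    by (simp add: emeasure_eq_measure ennreal_minus ennreal_less_iff flip: ennreal_plus)
  finally have "L2norm ?M (\<lambda>x. complex_of_real (indicator B x) - complex_of_real (indicator K x)) < ennreal e"
    using \<open>e > 0\<close> by (simp add: L2norm_def ennreal_sqrt_less_iff ennreal_power)
  moreover have "trig_approximable h (\<lambda>x. complex_of_real (indicator K x))"
    using K by (intro trig_approximable_compact h) auto
  ultimately show "\<exists>G. trig_approximable h G \<and>
      L2norm ?M (\<lambda>x. complex_of_real (indicator B x) - G x) < ennreal e" by blast
qed simp

lemma trig_approximable_cmult:
  assumes "trig_approximable h F"
  shows "trig_approximable h (\<lambda>x. c * F x)"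
  unfolding trig_approximable_def
proof (intro conjI allI impI)
  have [measurable]: "F \<in> borel_measurable borel" using assms trig_approximable_measurable by auto
  then show "(\<lambda>x. c * F x) \<in> borel_measurable borel" by simp
  fix e :: real assume "e > 0"
  define d where "d = e / (2 * (cmod c + 1))"
  have c: "cmod c + 1 > 0" by (simp add: add_nonneg_pos)
  have d: "d > 0" using \<open>e > 0\<close> c by (simp add: d_def)
  from assms d obtain P where P: "P \<in> trig_polys h"
    "L2norm (period_measure h) (\<lambda>x. F x - P x) < ennreal d"
    unfolding trig_approximable_def by blast
  have [measurable]: "P \<in> borel_measurable borel" using P measurable_trig_polys by auto
  have "L2norm (period_measure h) (\<lambda>x. c * F x - c * P x) \<le>
      L2norm (period_measure h) (\<lambda>x. complex_of_real (cmod c + 1) * (F x - P x))"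
  proof (intro L2norm_mono_AE AE_I2)
    fix x
    have "cmod (c * F x - c * P x) = cmod c * cmod (F x - P x)"
      by (metis norm_mult right_diff_distrib)
    also have "\<dots> \<le> (cmod c + 1) * cmod (F x - P x)" by (intro mult_right_mono) auto
    also have "\<dots> = cmod (complex_of_real (cmod c + 1) * (F x - P x))"
      using c by (simp only: norm_mult norm_of_real abs_of_pos)
    finally show "cmod (c * F x - c * P x) \<le> cmod (complex_of_real (cmod c + 1) * (F x - P x))" .
  qed
  also have "\<dots> = ennreal (cmod c + 1) * L2norm (period_measure h) (\<lambda>x. F x - P x)"
    using c by (intro L2norm_cmult) auto
  also have "\<dots> \<le> ennreal (cmod c + 1) * ennreal d" using P(2) by (intro mult_left_mono) auto
  also have "\<dots> = ennreal ((cmod c + 1) * d)" using c d by (intro ennreal_mult[symmetric]) auto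
  also have "(cmod c + 1) * d = e / 2" using c by (simp add: d_def field_simps)
  also have "ennreal (e / 2) < ennreal e" using \<open>e > 0\<close> by (simp add: ennreal_lessI)
  finally show "\<exists>P\<in>trig_polys h. L2norm (period_measure h) (\<lambda>x. c * F x - P x) < ennreal e"
    by (rule bexI[OF _ trig_polys_mult[OF trig_polys_const[of c] P(1)]])
qed

lemma trig_approximable_sum:
  "finite I \<Longrightarrow> (\<And>i. i \<in> I \<Longrightarrow> trig_approximable h (F i)) \<Longrightarrow> trig_approximable h (\<lambda>x. \<Sum>i\<in>I. F i x)"
proof (induction I rule: finite_induct)
  case empty
  show ?case using trig_approximable_trig_polys[OF trig_polys_const[of 0]] by simp
next
  case (insert i I)
  then show ?case by (simp add: trig_approximable_add)
qed

lemma trig_approximable_L2: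
  assumes h: "h > 0" and F [measurable]: "F \<in> borel_measurable borel"
    and fin: "L2norm (period_measure h) F < \<top>"
  shows "trig_approximable h F"
proof (rule trig_approximable_limit[OF F])
  let ?M = "period_measure h"
  fix e :: real assume "e > 0"
  obtain s where s: "\<And>i. simple_function ?M (s i)" "\<And>x. (\<lambda>i. s i x) \<longlonglongrightarrow> F x"
      "\<And>i x. cmod (s i x) \<le> 2 * cmod (F x)"
  proof -
    have "F \<in> borel_measurable ?M" by simp
    from borel_measurable_implies_sequence_metric[OF this, of 0] obtain s where
      "\<forall>i. simple_function ?M (s i)" "\<forall>x\<in>space ?M. (\<lambda>i. s i x) \<longlonglongrightarrow> F x"
      "\<forall>i. \<forall>x\<in>space ?M. dist (s i x) 0 \<le> 2 * dist (F x) 0" by blast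
    then show ?thesis by (intro that[of s]) auto
  qed
  have [measurable]: "s i \<in> borel_measurable borel" for i
    using borel_measurable_simple_function[OF s(1)] by (simp add: measurable_def)
  have approx: "trig_approximable h (s i)" for i
  proof -
    have "trig_approximable h (\<lambda>x. \<Sum>y\<in>range (s i). y * complex_of_real (indicator (s i -` {y}) x))"
    proof (intro trig_approximable_sum trig_approximable_cmult trig_approximable_indicator h)
      show "finite (range (s i))" using s(1)[of i] by (simp add: simple_function_def)
      show "s i -` {y} \<in> sets borel" for y
      proof (cases "y \<in> range (s i)")
        case True
        then show ?thesis using s(1)[of i] by (auto simp: simple_function_def)
      next
        case False
        then have "s i -` {y} = {}" by auto
        then show ?thesis by simp
      qed
    qed
    moreover have "(\<lambda>x. \<Sum>y\<in>range (s i). y * complex_of_real (indicator (s i -` {y}) x)) = s i"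
    proof
      fix x
      have "finite (range (s i))" using s(1)[of i] by (simp add: simple_function_def)
      then have "(\<Sum>y\<in>range (s i). y * complex_of_real (indicator (s i -` {y}) x)) =
          (\<Sum>y\<in>{s i x}. y * complex_of_real (indicator (s i -` {y}) x))"
        by (intro sum.mono_neutral_right) (auto simp: indicator_def)
      then show "(\<Sum>y\<in>range (s i). y * complex_of_real (indicator (s i -` {y}) x)) = s i x" by simp
    qed
    ultimately show ?thesis by simp
  qed
  have "(\<lambda>k. \<integral>\<^sup>+x. ennreal ((cmod (F x - s k x))\<^sup>2) \<partial>?M) \<longlonglongrightarrow> (\<integral>\<^sup>+x. 0 \<partial>?M)"
  \<comment> \<open>The simple functions are bounded by \<open>2 * cmod (F x)\<close>, so their
    distance from \<open>F\<close> is at most \<open>3 * cmod (F x)\<close>; the 9 is the square of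
    that 3.\<close>
  proof (rule nn_integral_dominated_convergence[where w = "\<lambda>x. ennreal 9 * ennreal ((cmod (F x))\<^sup>2)"])
    show "(\<integral>\<^sup>+x. ennreal 9 * ennreal ((cmod (F x))\<^sup>2) \<partial>?M) < \<infinity>"
      using fin by (subst nn_integral_cmult) (auto simp: L2norm_less_top_iff ennreal_mult_less_top)
    show "AE x in ?M. ennreal ((cmod (F x - s k x))\<^sup>2) \<le> ennreal 9 * ennreal ((cmod (F x))\<^sup>2)" for k
    proof (rule AE_I2)
      fix x
      have "cmod (F x - s k x) \<le> 3 * cmod (F x)"
        using norm_triangle_ineq4[of "F x" "s k x"] s(3)[of k x] by linarith
      then have "(cmod (F x - s k x))\<^sup>2 \<le> (3 * cmod (F x))\<^sup>2" by (intro power_mono) auto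
      then show "ennreal ((cmod (F x - s k x))\<^sup>2) \<le> ennreal 9 * ennreal ((cmod (F x))\<^sup>2)"
        by (subst ennreal_mult[symmetric]) (auto intro!: ennreal_leI simp: power_mult_distrib)
    qed
    show "AE x in ?M. (\<lambda>k. ennreal ((cmod (F x - s k x))\<^sup>2)) \<longlonglongrightarrow> 0"
    proof (rule AE_I2)
      fix x
      have "(\<lambda>k. ennreal ((cmod (F x - s k x))\<^sup>2)) \<longlonglongrightarrow> ennreal ((cmod (F x - F x))\<^sup>2)"
        by (intro tendsto_intros tendsto_ennrealI s)
      then show "(\<lambda>k. ennreal ((cmod (F x - s k x))\<^sup>2)) \<longlonglongrightarrow> 0" by simp
    qed
  qed auto
  then have "(\<lambda>k. L2norm ?M (\<lambda>x. F x - s k x)) \<longlonglongrightarrow> 0"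
    by (simp add: L2norm_def tendsto_ennreal_sqrt_0_iff)
  then have "\<exists>k. L2norm ?M (\<lambda>x. F x - s k x) < ennreal e"
    using order_tendstoD(2)[of _ 0 sequentially "ennreal e"] \<open>e > 0\<close>
    by (metis (mono_tags, lifting) ennreal_less_zero_iff eventually_sequentially order_refl)
  with approx show "\<exists>G. trig_approximable h G \<and> L2norm ?M (\<lambda>x. F x - G x) < ennreal e" by blast
qed


section \<open>Orthogonality, best approximation and mean-square convergence of Fourier
  series\<close>

lemma integrable_of_L2:
  assumes "finite_measure M" "f \<in> borel_measurable M" "L2norm M f < \<top>"
  shows "integrable M f" "integrable M (\<lambda>x. (cmod (f x))\<^sup>2)"
proof -
  interpret finite_measure M by fact
  show sq: "integrable M (\<lambda>x. (cmod (f x))\<^sup>2)"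
    using assms by (intro integrableI_bounded) (auto simp: L2norm_less_top_iff)
  show "integrable M f"
  proof (rule Bochner_Integration.integrable_bound)
    show "integrable M (\<lambda>x. 1 + (cmod (f x))\<^sup>2)" using sq by simp
    show "AE x in M. cmod (f x) \<le> norm (1 + (cmod (f x))\<^sup>2)"
    proof (rule AE_I2)
      fix x
      have "2 * cmod (f x) \<le> 1 + (cmod (f x))\<^sup>2"
        using sum_squares_bound[of 1 "cmod (f x)"] by simp
      then show "cmod (f x) \<le> norm (1 + (cmod (f x))\<^sup>2)"
        using zero_le_power2[of "cmod (f x)"] norm_ge_zero[of "f x"] unfolding real_norm_def by linarith
    qed
  qed (use assms in auto)
qed

lemma L2norm_eq_integral:
  assumes "integrable M (\<lambda>x. (cmod (f x))\<^sup>2)"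
  shows "L2norm M f = ennreal (sqrt (LINT x|M. (cmod (f x))\<^sup>2))"
  using assms by (simp add: L2norm_def nn_integral_eq_integral ennreal_sqrt_def)

lemma integral_cis_period:
  assumes "h > 0"
  shows "(LINT x|period_measure h. cis (x * real_of_int k * h)) = (if k = 0 then complex_of_real (2 * pi / h) else 0)"
proof (cases "k = 0")
  case True
  interpret finite_measure "period_measure h" by (rule finite_measure_period_measure[OF assms])
  have "measure (period_measure h) UNIV = 2 * pi / h"
    using assms emeasure_period_measure[OF assms] by (simp add: measure_def)
  then show ?thesis using True by (simp add: scaleR_conv_of_real)
next
  case False
  define c where "c = real_of_int k * h"
  have c: "c \<noteq> 0" using False assms by (simp add: c_def)
  let ?G = "\<lambda>x. - \<i> / c * cis (x * c)"
  have int: "has_bochner_integral lborel (\<lambda>x. indicator {-pi/h..pi/h} x *\<^sub>R cis (x * c)) (?G (pi/h) - ?G (-pi/h))"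
  proof (rule has_bochner_integral_FTC_Icc)
    show "-pi/h \<le> pi/h" using assms by (simp add: field_simps)
    fix x
    have "((\<lambda>x. cis (x * c)) has_vector_derivative (c *\<^sub>R (\<i> * cis (x * c)))) (at x)"
      unfolding has_vector_derivative_def
      by (rule has_derivative_eq_rhs[OF has_derivative_cis[of "\<lambda>x. x * c" "\<lambda>t. t * c"]])
        (auto intro!: derivative_eq_intros)
    from has_vector_derivative_mult_right[OF this, of "- \<i> / c"]
    have "(?G has_vector_derivative cis (x * c)) (at x)" using c by (simp add: scaleR_conv_of_real)
    then show "(?G has_vector_derivative cis (x * c)) (at x within {-pi/h..pi/h})"
      by (rule has_vector_derivative_at_within)
  qed (auto intro!: continuous_intros continuous_on_cis)
  have G: "?G (pi/h) - ?G (-pi/h) = 0"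
  proof -
    have "pi / h * c = pi * real_of_int k" "- pi / h * c = - (pi * real_of_int k)"
      using assms by (simp_all add: c_def)
    then show ?thesis by (simp only:) (simp add: complex_eq_iff)
  qed
  have "(LINT x:{-pi/h..pi/h}|lborel. cis (x * c)) = 0"
    unfolding set_lebesgue_integral_def by (rule has_bochner_integral_integral_eq[OF int[unfolded G]])
  moreover have "(LINT x|period_measure h. cis (x * c)) = (LINT x:{-pi/h..pi/h}|lborel. cis (x * c))"
    by (intro integral_period_measure borel_measurable_continuous_onI continuous_intros continuous_on_cis)
  ultimately show ?thesis using False by (simp add: c_def mult.assoc)
qed

text \<open>The partial sums built from the coefficients of \<open>F\<close> are orthogonal
  projections, hence at least as close to \<open>F\<close> as any trigonometric polynomial of the
  same degree; density then forces convergence. It follows that every square integrable symbol is a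
  transform of its own inverse transform, so the choice in \<open>dft\<close> has something to
  choose from.\<close>

theorem has_dft_fourier_coefficients:
  assumes h: "h > 0" and F [measurable]: "F \<in> borel_measurable borel"
    and fin: "L2norm (period_measure h) F < \<top>"
  shows "has_dft h (\<lambda>n. complex_of_real (1 / sqrt (2 * pi)) *
     (LINT \<xi>:{-pi/h..pi/h}|lborel. exp (\<i> * complex_of_real (\<xi> * real_of_int n * h)) * F \<xi>)) F"
    (is "has_dft h ?v F")
proof -
  interpret finite_measure "period_measure h" by (rule finite_measure_period_measure[OF h])
  let ?M = "period_measure h"
  define e where "e n \<xi> = cis (- \<xi> * real_of_int n * h)" for n :: int and \<xi>
  have [measurable]: "e n \<in> borel_measurable borel" for n
    unfolding e_def by (intro borel_measurable_continuous_onI continuous_intros continuous_on_cis)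
  have [measurable]: "(\<lambda>x. cnj (e n x)) \<in> borel_measurable borel" for n
    unfolding e_def by (intro borel_measurable_continuous_onI continuous_intros continuous_on_cis)
  have e_norm: "cmod (e n x) = 1" for n x by (simp add: e_def)
  have ec: "cnj (e n x) = exp (\<i> * complex_of_real (x * real_of_int n * h))" for n x
  proof -
    have "cnj (e n x) = cis (x * real_of_int n * h)" by (simp add: e_def cis_cnj)
    then show ?thesis by (simp only: cis_conv_exp)
  qed
  have orth: "(LINT x|?M. e n x * cnj (e m x)) = (if n = m then complex_of_real (2 * pi / h) else 0)" for n m
  proof -
    have "e n x * cnj (e m x) = cis (x * real_of_int (m - n) * h)" for x
      by (simp add: e_def cis_cnj cis_mult algebra_simps)
    then show ?thesis using integral_cis_period[OF h, of "m - n"] by auto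
  qed
  define c where "c n = (h / (2 * pi)) *\<^sub>R (LINT x|?M. F x * cnj (e n x))" for n
  define S where "S K x = (\<Sum>n=-int K..int K. c n * e n x)" for K x
  have [measurable]: "S K \<in> borel_measurable borel" for K unfolding S_def by measurable
  have F_int: "integrable ?M F" using integrable_of_L2(1)[OF finite_measure_axioms _ fin] by simp
  have e_int: "integrable ?M (\<lambda>x. f x * cnj (e n x))" if "integrable ?M f" for f n
  proof (rule Bochner_Integration.integrable_bound[OF that])
    have [measurable]: "f \<in> borel_measurable ?M" using that by (rule borel_measurable_integrable)
    show "(\<lambda>x. f x * cnj (e n x)) \<in> borel_measurable ?M" by measurable
  qed (auto simp: norm_mult e_norm)
  have bounded_L2: "L2norm ?M P < \<top>"
    if [measurable]: "P \<in> borel_measurable borel" and B: "\<And>x. cmod (P x) \<le> B" for P B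
  proof -
    have "integrable ?M (\<lambda>x. (cmod (P x))\<^sup>2)"
      by (rule integrable_const_bound[where B = "B\<^sup>2"])
        (auto intro!: power_mono B simp flip: power_abs)
    then show ?thesis by (simp add: L2norm_eq_integral)
  qed
  have sum_L2: "L2norm ?M (\<lambda>x. \<Sum>n=-int K..int K. d n * e n x) < \<top>" for d K
  proof (rule bounded_L2)
    show "cmod (\<Sum>n=-int K..int K. d n * e n x) \<le> (\<Sum>n=-int K..int K. cmod (d n))" for x
      by (rule order_trans[OF norm_sum]) (simp add: norm_mult e_norm)
  qed measurable
  have diff_L2: "L2norm ?M (\<lambda>x. F x - (\<Sum>n=-int K..int K. d n * e n x)) < \<top>" for d K
  proof -
    have "L2norm ?M (\<lambda>x. F x + (\<Sum>n=-int K..int K. (- d n) * e n x)) \<le>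
        2 * (L2norm ?M F + L2norm ?M (\<lambda>x. \<Sum>n=-int K..int K. (- d n) * e n x))"
      by (rule L2norm_add) measurable
    also have "\<dots> < \<top>" using fin sum_L2[of "\<lambda>n. - d n" K] by (simp add: ennreal_mult_less_top)
    finally show ?thesis by (simp add: sum_negf)
  qed
  \<comment> \<open>Pythagoras: the remainder \<open>D\<close> is orthogonal to every exponential in
    the range, so adding \<open>Q\<close>, a combination of them, cannot shrink it.\<close>
  have best: "L2norm ?M (\<lambda>x. F x - S K x) \<le> L2norm ?M (\<lambda>x. F x - (\<Sum>n=-int K..int K. p n * e n x))" for p K
  proof -
    define D where "D x = F x - S K x" for x
    define Q where "Q x = (\<Sum>n=-int K..int K. (c n - p n) * e n x)" for x
    have [measurable]: "D \<in> borel_measurable borel" "Q \<in> borel_measurable borel"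
      unfolding D_def Q_def by measurable
    have D_L2: "L2norm ?M D < \<top>" unfolding D_def S_def by (rule diff_L2)
    have DQ: "D x + Q x = F x - (\<Sum>n=-int K..int K. p n * e n x)" for x
      by (simp add: D_def Q_def S_def left_diff_distrib sum_subtractf)
    have DQ_L2: "L2norm ?M (\<lambda>x. D x + Q x) < \<top>" unfolding DQ by (rule diff_L2)
    note D_int = integrable_of_L2[OF finite_measure_axioms _ D_L2]
    note DQ_int = integrable_of_L2[OF finite_measure_axioms _ DQ_L2]
    have ei: "integrable ?M (\<lambda>x. e n x * cnj (e m x))" for n m
      by (rule integrable_const_bound[where B = 1]) (auto simp: norm_mult e_norm)
    have D_orth: "(LINT x|?M. D x * cnj (e m x)) = 0" if m: "m \<in> {-int K..int K}" for m
    proof -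
      have "(LINT x|?M. D x * cnj (e m x)) =
          (LINT x|?M. F x * cnj (e m x) - (\<Sum>n=-int K..int K. c n * (e n x * cnj (e m x))))"
        by (intro Bochner_Integration.integral_cong)
          (auto simp: D_def S_def left_diff_distrib sum_distrib_right mult.assoc)
      also have "\<dots> = (LINT x|?M. F x * cnj (e m x)) - (\<Sum>n=-int K..int K. c n * (LINT x|?M. e n x * cnj (e m x)))"
        using e_int[OF F_int] ei by (simp add: Bochner_Integration.integral_sum)
      also have "(\<Sum>n=-int K..int K. c n * (LINT x|?M. e n x * cnj (e m x))) = c m * complex_of_real (2 * pi / h)"
        using m by (simp add: orth if_distrib[of "\<lambda>x. _ * x"] cong: if_cong)
      also have "\<dots> = (LINT x|?M. F x * cnj (e m x))"
        using h by (simp add: c_def scaleR_conv_of_real)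
      finally show ?thesis by simp
    qed
    have DQc: "(\<lambda>x. D x * cnj (Q x)) = (\<lambda>x. \<Sum>n=-int K..int K. cnj (c n - p n) * (D x * cnj (e n x)))"
      by (rule ext) (simp add: Q_def sum_distrib_left mult_ac)
    have cross_int: "integrable ?M (\<lambda>x. D x * cnj (Q x))"
      unfolding DQc using e_int[OF D_int(1)] by (intro Bochner_Integration.integrable_sum integrable_mult_right) auto
    have cross: "(LINT x|?M. D x * cnj (Q x)) = 0"
      unfolding DQc using e_int[OF D_int(1)]
      by (subst Bochner_Integration.integral_sum) (auto intro!: integrable_mult_right sum.neutral simp: D_orth)
    have "(LINT x|?M. (cmod (D x))\<^sup>2) \<le> (LINT x|?M. (cmod (D x + Q x))\<^sup>2 - 2 * Re (D x * cnj (Q x)))"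
    proof (rule integral_mono)
      show "integrable ?M (\<lambda>x. (cmod (D x + Q x))\<^sup>2 - 2 * Re (D x * cnj (Q x)))"
        using DQ_int(2) integrable_Re[OF cross_int] by (intro Bochner_Integration.integrable_diff integrable_mult_right) auto
      show "(cmod (D x))\<^sup>2 \<le> (cmod (D x + Q x))\<^sup>2 - 2 * Re (D x * cnj (Q x))" for x
        unfolding cmod_power2 by (simp add: power2_eq_square algebra_simps)
    qed (use D_int in simp)
    also have "\<dots> = (LINT x|?M. (cmod (D x + Q x))\<^sup>2) - 2 * (LINT x|?M. Re (D x * cnj (Q x)))"
      using DQ_int(2) integrable_Re[OF cross_int]
      by (subst Bochner_Integration.integral_diff) (auto simp del: times_complex.sel)
    also have "(LINT x|?M. Re (D x * cnj (Q x))) = 0"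
      using integral_Re[OF cross_int] cross by (simp del: times_complex.sel)
    finally have "(LINT x|?M. (cmod (D x))\<^sup>2) \<le> (LINT x|?M. (cmod (D x + Q x))\<^sup>2)" by simp
    then have "L2norm ?M D \<le> L2norm ?M (\<lambda>x. D x + Q x)"
      using D_int DQ_int by (simp add: L2norm_eq_integral ennreal_leI)
    then show ?thesis unfolding DQ unfolding D_def[abs_def] .
  qed
  have lim: "(\<lambda>K. L2norm ?M (\<lambda>x. F x - S K x)) \<longlonglongrightarrow> 0"
  proof (rule order_tendstoI)
    fix a :: ennreal assume "0 < a"
    obtain r where r: "0 < r" "ennreal r \<le> a"
    proof (cases a)
      case (real r)
      with \<open>0 < a\<close> show ?thesis by (intro that[of r]) auto
    qed (auto intro: that[of 1])
    from trig_approximable_L2[OF h F fin] r(1) obtain P where P: "P \<in> trig_polys h"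
      "L2norm ?M (\<lambda>x. F x - P x) < ennreal r" unfolding trig_approximable_def by blast
    obtain p N where p: "\<And>K. K \<ge> N \<Longrightarrow> P = (\<lambda>\<xi>. \<Sum>n=-int K..int K. p n * e n \<xi>)"
      using trig_polys_eq_sum[OF P(1)] unfolding e_def by blast
    have "L2norm ?M (\<lambda>x. F x - S K x) < a" if "K \<ge> N" for K
    proof -
      have "L2norm ?M (\<lambda>x. F x - S K x) \<le> L2norm ?M (\<lambda>x. F x - (\<Sum>n=-int K..int K. p n * e n x))"
        by (rule best)
      also have "\<dots> = L2norm ?M (\<lambda>x. F x - P x)"
        by (subst p[OF that]) (rule refl)
      also have "\<dots> < a" using P(2) r(2) by simp
      finally show ?thesis .
    qed
    then show "\<forall>\<^sub>F K in sequentially. L2norm ?M (\<lambda>x. F x - S K x) < a"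
      by (auto simp: eventually_sequentially)
  qed simp
  have S_eq: "complex_of_real (h / sqrt (2 * pi)) *
      (\<Sum>n=-int K..int K. exp (- \<i> * complex_of_real (x * real_of_int n * h)) * ?v n) = S K x" for K x
    unfolding S_def sum_distrib_left
  proof (rule sum.cong[OF refl])
    fix n
    have "(LINT \<xi>:{-pi/h..pi/h}|lborel. exp (\<i> * complex_of_real (\<xi> * real_of_int n * h)) * F \<xi>) =
        (LINT x|?M. F x * cnj (e n x))"
      by (subst integral_period_measure) (simp_all add: ec mult.commute)
    moreover have "exp (- \<i> * complex_of_real (x * real_of_int n * h)) = e n x"
      by (simp add: e_def cis_conv_exp)
    moreover have "complex_of_real (h / sqrt (2 * pi)) * complex_of_real (1 / sqrt (2 * pi)) = complex_of_real (h / (2 * pi))"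
      by (simp flip: of_real_mult)
    ultimately show "complex_of_real (h / sqrt (2 * pi)) *
        (exp (- \<i> * complex_of_real (x * real_of_int n * h)) * ?v n) = c n * e n x"
      by (simp add: c_def scaleR_conv_of_real mult_ac) (metis mult.assoc)
  qed
  have restrict: "L2norm (restrict_space lborel {-pi/h..pi/h}) (\<lambda>x. F x - S K x) =
      L2norm ?M (\<lambda>x. F x - S K x)" for K
    by (rule L2norm_restrict_closed) measurable
  show ?thesis
    unfolding has_dft_def S_eq restrict using lim by simp
qed

subsection \<open>The damped wave system at one frequency\<close>

text \<open>\<open>gcosh d\<close> and \<open>gsinh d\<close> solve y'' = d y with initial data (1,
  0) and (0, 1). As even functions of the root of \<open>d\<close> they are real for either sign, so
  one formula covers overdamped, critical and oscillating frequencies.\<close>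

definition gcosh :: "real \<Rightarrow> real \<Rightarrow> real" where
  "gcosh d t = (if d \<ge> 0 then cosh (sqrt d * t) else cos (sqrt (-d) * t))"

definition gsinh :: "real \<Rightarrow> real \<Rightarrow> real" where
  "gsinh d t = (if d > 0 then sinh (sqrt d * t) / sqrt d else if d = 0 then t
     else sin (sqrt (-d) * t) / sqrt (-d))"

lemma gcosh_0 [simp]: "gcosh d 0 = 1" and gsinh_0 [simp]: "gsinh d 0 = 0"
  by (auto simp: gcosh_def gsinh_def)

lemma DERIV_gcosh: "(gcosh d has_real_derivative d * gsinh d t) (at t)"
proof -
  consider "d > 0" | "d = 0" | "d < 0" by linarith
  then show ?thesis
  proof cases
    case 1
    then have e: "gcosh d = (\<lambda>t. cosh (sqrt d * t))" by (auto simp: gcosh_def)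
    have "sinh (sqrt d * t) * sqrt d = d * gsinh d t"
      using 1 real_sqrt_mult_self[of d] by (simp add: gsinh_def field_simps)
    then show ?thesis unfolding e by (auto intro!: derivative_eq_intros)
  next
    case 2
    then have e: "gcosh d = (\<lambda>t. 1)" by (auto simp: gcosh_def)
    show ?thesis unfolding e using 2 by simp
  next
    case 3
    then have e: "gcosh d = (\<lambda>t. cos (sqrt (-d) * t))" by (auto simp: gcosh_def)
    define r where "r = sqrt (-d)"
    have r: "d = - (r * r)" "r > 0" using 3 by (simp_all add: r_def)
    have "- sin (r * t) * r = d * (sin (r * t) / r)" using r(2) by (simp add: r(1))
    then have "- sin (sqrt (-d) * t) * sqrt (-d) = d * gsinh d t"
      using 3 by (simp add: gsinh_def r_def)
    then show ?thesis unfolding e by (auto intro!: derivative_eq_intros)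
  qed
qed

lemma DERIV_gsinh: "(gsinh d has_real_derivative gcosh d t) (at t)"
proof -
  consider "d > 0" | "d = 0" | "d < 0" by linarith
  then show ?thesis
  proof cases
    case 1
    then have e: "gsinh d = (\<lambda>t. sinh (sqrt d * t) / sqrt d)" by (auto simp: gsinh_def)
    have "((\<lambda>t. sinh (sqrt d * t)) has_real_derivative cosh (sqrt d * t) * sqrt d) (at t)"
      by (auto intro!: derivative_eq_intros)
    from DERIV_cdivide[OF this, of "sqrt d"] show ?thesis using 1 unfolding e by (simp add: gcosh_def)
  next
    case 2
    then have e: "gsinh d = (\<lambda>t. t)" by (auto simp: gsinh_def)
    show ?thesis unfolding e using 2 by (simp add: gcosh_def)
  next
    case 3
    then have e: "gsinh d = (\<lambda>t. sin (sqrt (-d) * t) / sqrt (-d))" by (auto simp: gsinh_def)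
    have "((\<lambda>t. sin (sqrt (-d) * t)) has_real_derivative cos (sqrt (-d) * t) * sqrt (-d)) (at t)"
      by (auto intro!: derivative_eq_intros)
    from DERIV_cdivide[OF this, of "sqrt (-d)"] show ?thesis using 3 unfolding e by (simp add: gcosh_def)
  qed
qed

lemma measurable_gcosh [measurable (raw)]:
  assumes [measurable]: "f \<in> borel_measurable M" "g \<in> borel_measurable M"
  shows "(\<lambda>x. gcosh (f x) (g x)) \<in> borel_measurable M"
  unfolding gcosh_def cosh_def by measurable

lemma measurable_gsinh [measurable (raw)]:
  assumes [measurable]: "f \<in> borel_measurable M" "g \<in> borel_measurable M"
  shows "(\<lambda>x. gsinh (f x) (g x)) \<in> borel_measurable M"
  unfolding gsinh_def sinh_def by measurable

text \<open>
  The entries of \<open>exp (t A) (a, b)\<close> for \<open>A = ((0, -\<i>q), (-\<i>q, -1))\<close>, whose shift \<open>A + 1/2\<close> squares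
  to \<open>1/4 - q\<^sup>2\<close>.
\<close>

definition wave_dens :: "real \<Rightarrow> complex \<Rightarrow> complex \<Rightarrow> real \<Rightarrow> complex" where
  "wave_dens q a b t = exp (- t / 2) *\<^sub>R
     (gcosh (1/4 - q\<^sup>2) t *\<^sub>R a + gsinh (1/4 - q\<^sup>2) t *\<^sub>R (a / 2 - \<i> * q * b))"

definition wave_vel :: "real \<Rightarrow> complex \<Rightarrow> complex \<Rightarrow> real \<Rightarrow> complex" where
  "wave_vel q a b t = exp (- t / 2) *\<^sub>R
     (gcosh (1/4 - q\<^sup>2) t *\<^sub>R b + gsinh (1/4 - q\<^sup>2) t *\<^sub>R (- b / 2 - \<i> * q * a))"

lemma wave_0 [simp]: "wave_dens q a b 0 = a" "wave_vel q a b 0 = b"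
  by (simp_all add: wave_dens_def wave_vel_def)

text \<open>Both components of the system have this shape, and differentiation acts linearly on the
  coefficient pair \<open>(x, y)\<close>, so their equations reduce to algebra.\<close>

lemma has_vector_derivative_gform:
  "((\<lambda>t. exp (- t / 2) *\<^sub>R (gcosh d t *\<^sub>R x + gsinh d t *\<^sub>R y)) has_vector_derivative
     exp (- t / 2) *\<^sub>R (gcosh d t *\<^sub>R (y - x / 2) + gsinh d t *\<^sub>R (d *\<^sub>R x - y / 2))) (at t)"
  for x y :: complex
proof -
  have 1: "((\<lambda>t. exp (- t / 2)) has_real_derivative - exp (- t / 2) / 2) (at t)" for t :: real
    by (auto intro!: derivative_eq_intros)
  have 2: "((\<lambda>t. gcosh d t *\<^sub>R x + gsinh d t *\<^sub>R y) has_vector_derivative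
      (d * gsinh d t) *\<^sub>R x + gcosh d t *\<^sub>R y) (at t)"
    using DERIV_gcosh[of d t] DERIV_gsinh[of d t]
    by (auto intro!: derivative_eq_intros simp: has_real_derivative_iff_has_vector_derivative)
  show ?thesis
    by (rule has_vector_derivative_eq_rhs[OF has_vector_derivative_scaleR[OF 1 2]])
      (simp add: algebra_simps scaleR_conv_of_real)
qed

lemma wave_dens_deriv:
  "(wave_dens q a b has_vector_derivative - \<i> * q * wave_vel q a b t) (at t)"
  unfolding wave_dens_def[abs_def] wave_vel_def
  by (rule has_vector_derivative_eq_rhs[OF has_vector_derivative_gform])
    (simp add: complex_eq_iff field_simps power2_eq_square)

lemma wave_vel_deriv:
  "(wave_vel q a b has_vector_derivative - \<i> * q * wave_dens q a b t - wave_vel q a b t) (at t)"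
  unfolding wave_vel_def[abs_def] wave_dens_def
  by (rule has_vector_derivative_eq_rhs[OF has_vector_derivative_gform])
    (simp add: complex_eq_iff field_simps power2_eq_square)

lemma measurable_wave [measurable (raw)]:
  assumes [measurable]: "q \<in> borel_measurable M" "a \<in> borel_measurable M"
    "b \<in> borel_measurable M" "t \<in> borel_measurable M"
  shows "(\<lambda>x. wave_dens (q x) (a x) (b x) (t x)) \<in> borel_measurable M"
    and "(\<lambda>x. wave_vel (q x) (a x) (b x) (t x)) \<in> borel_measurable M"
  unfolding wave_dens_def wave_vel_def by measurable

text \<open>The functionals below are quadratic in real and imaginary parts; splitting lets them be
  differentiated as real functions.\<close>

lemma wave_components_deriv:
  fixes q a b
  defines "x \<equiv> \<lambda>t. Re (wave_dens q a b t)" and "y \<equiv> \<lambda>t. Im (wave_dens q a b t)"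
    and "u \<equiv> \<lambda>t. Re (wave_vel q a b t)" and "v \<equiv> \<lambda>t. Im (wave_vel q a b t)"
  shows "(x has_real_derivative q * v t) (at t)" "(y has_real_derivative - q * u t) (at t)"
    "(u has_real_derivative q * y t - u t) (at t)" "(v has_real_derivative - q * x t - v t) (at t)"
  using bounded_linear.has_vector_derivative[OF bounded_linear_Re wave_dens_deriv[of q a b t]]
    bounded_linear.has_vector_derivative[OF bounded_linear_Im wave_dens_deriv[of q a b t]]
    bounded_linear.has_vector_derivative[OF bounded_linear_Re wave_vel_deriv[of q a b t]]
    bounded_linear.has_vector_derivative[OF bounded_linear_Im wave_vel_deriv[of q a b t]]
  by (simp_all add: x_def y_def u_def v_def has_real_derivative_iff_has_vector_derivative)

text \<open>The coupling is skew, so the energy changes only through the damping: its derivative is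
  -2 times the squared modulus of the velocity.\<close>

lemma wave_energy_nonincreasing:
  assumes "t \<ge> 0"
  shows "(cmod (wave_dens q a b t))\<^sup>2 + (cmod (wave_vel q a b t))\<^sup>2 \<le> (cmod a)\<^sup>2 + (cmod b)\<^sup>2"
proof -
  define x where "x = (\<lambda>t. Re (wave_dens q a b t))"
  define y where "y = (\<lambda>t. Im (wave_dens q a b t))"
  define u where "u = (\<lambda>t. Re (wave_vel q a b t))"
  define v where "v = (\<lambda>t. Im (wave_vel q a b t))"
  have D: "(x has_real_derivative q * v t) (at t)" "(y has_real_derivative - q * u t) (at t)"
    "(u has_real_derivative q * y t - u t) (at t)" "(v has_real_derivative - q * x t - v t) (at t)" for t
    using wave_components_deriv[of q a b t] by (simp_all add: x_def y_def u_def v_def)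
  define L where "L t = (x t)\<^sup>2 + (y t)\<^sup>2 + (u t)\<^sup>2 + (v t)\<^sup>2" for t
  have "L t \<le> L 0"
  proof (rule DERIV_nonpos_imp_nonincreasing[OF assms])
    fix t
    have "(L has_real_derivative - 2 * ((u t)\<^sup>2 + (v t)\<^sup>2)) (at t)"
      unfolding L_def[abs_def]
      by (auto intro!: derivative_eq_intros D) (simp add: algebra_simps power2_eq_square)
    then show "\<exists>y. (L has_real_derivative y) (at t) \<and> y \<le> 0"
      by (intro exI conjI) (assumption, simp)
  qed
  then show ?thesis
    by (simp add: L_def x_def y_def u_def v_def cmod_power2)
qed

text \<open>
  For frequencies bounded away from zero the cross term \<open>Im (a b\<^sup>*)\<close> turns the dissipation of
  \<open>b\<close> alone into a dissipation of the full energy, uniformly in \<open>q\<close>.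
\<close>

lemma wave_high_decay_aux:
  assumes q: "\<bar>q\<bar> \<ge> 1/4" and "t \<ge> 0"
  shows "(cmod (wave_dens q a b t))\<^sup>2 + (cmod (wave_vel q a b t))\<^sup>2 \<le>
    4 * exp (- t / 20) * ((cmod a)\<^sup>2 + (cmod b)\<^sup>2)"
proof -
  define x where "x = (\<lambda>t. Re (wave_dens q a b t))"
  define y where "y = (\<lambda>t. Im (wave_dens q a b t))"
  define u where "u = (\<lambda>t. Re (wave_vel q a b t))"
  define v where "v = (\<lambda>t. Im (wave_vel q a b t))"
  have D: "(x has_real_derivative q * v t) (at t)" "(y has_real_derivative - q * u t) (at t)"
    "(u has_real_derivative q * y t - u t) (at t)" "(v has_real_derivative - q * x t - v t) (at t)" for t
    using wave_components_deriv[of q a b t] by (simp_all add: x_def y_def u_def v_def)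
  \<comment> \<open>Chosen so that \<open>k * q = 1/8\<close>: the cross term then dissipates the
    density at a rate free of \<open>q\<close>, while \<open>\<bar>q\<bar> \<ge> 1/4\<close> gives
    \<open>\<bar>k\<bar> \<le> 1/2\<close> and keeps \<open>L\<close> comparable with
    \<open>E\<close>.\<close>
  define k where "k = 1 / (8 * q)"
  have q0: "q \<noteq> 0" using q by auto
  have kq: "k * q = 1/8" using q0 by (simp add: k_def)
  have "\<bar>k\<bar> * \<bar>q\<bar> = 1/8" using kq by (simp flip: abs_mult)
  then have k: "\<bar>k\<bar> \<le> 1/2"
    using q mult_left_mono[of "1/4" "\<bar>q\<bar>" "\<bar>k\<bar>"] by simp
  define E where "E t = (x t)\<^sup>2 + (y t)\<^sup>2 + (u t)\<^sup>2 + (v t)\<^sup>2" for t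
  define X where "X t = x t * v t - y t * u t" for t
  define L where "L t = E t + k * X t" for t
  have X: "\<bar>X t\<bar> \<le> 2 * (u t)\<^sup>2 + 2 * (v t)\<^sup>2 + ((x t)\<^sup>2 + (y t)\<^sup>2) / 8"
    "\<bar>X t\<bar> \<le> E t / 2" for t
  proof -
    have "(x t - 4 * v t)\<^sup>2 \<ge> 0" "(x t + 4 * v t)\<^sup>2 \<ge> 0" "(y t - 4 * u t)\<^sup>2 \<ge> 0" "(y t + 4 * u t)\<^sup>2 \<ge> 0"
      by simp_all
    then show "\<bar>X t\<bar> \<le> 2 * (u t)\<^sup>2 + 2 * (v t)\<^sup>2 + ((x t)\<^sup>2 + (y t)\<^sup>2) / 8"
      unfolding X_def abs_le_iff by (simp add: power2_sum power2_diff power_mult_distrib field_simps)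
    have "(x t - v t)\<^sup>2 \<ge> 0" "(x t + v t)\<^sup>2 \<ge> 0" "(y t - u t)\<^sup>2 \<ge> 0" "(y t + u t)\<^sup>2 \<ge> 0"
      by simp_all
    then show "\<bar>X t\<bar> \<le> E t / 2"
      unfolding X_def E_def abs_le_iff by (simp add: power2_sum power2_diff field_simps)
  qed
  have kX: "\<bar>k * X t\<bar> \<le> \<bar>X t\<bar> / 2" for t
    using mult_right_mono[OF k, of "\<bar>X t\<bar>"] by (simp add: abs_mult)
  have E0: "E t \<ge> 0" for t by (simp add: E_def)
  have LE: "3/4 * E t \<le> L t" "L t \<le> 5/4 * E t" for t
    using kX[of t] X(2)[of t] by (auto simp: L_def)
  have "exp (t / 20) * L t \<le> exp (0 / 20) * L 0"
  proof (rule DERIV_nonpos_imp_nonincreasing[OF \<open>t \<ge> 0\<close>])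
    fix t
    define L' where "L' = - 2 * ((u t)\<^sup>2 + (v t)\<^sup>2) + ((u t)\<^sup>2 + (v t)\<^sup>2 - (x t)\<^sup>2 - (y t)\<^sup>2) / 8 - k * X t"
    have "(L has_real_derivative - 2 * ((u t)\<^sup>2 + (v t)\<^sup>2) +
        (k * q) * ((u t)\<^sup>2 + (v t)\<^sup>2 - (x t)\<^sup>2 - (y t)\<^sup>2) - k * X t) (at t)"
      unfolding L_def[abs_def] E_def[abs_def] X_def
      by (auto intro!: derivative_eq_intros D) (simp add: algebra_simps power2_eq_square)
    then have L': "(L has_real_derivative L') (at t)" by (simp add: L'_def kq)
    have "L' \<le> - E t / 16"
    proof -
      have aux: "- 2 * U + (U - W) / 8 - z \<le> - (W + U) / 16"
        if "- z \<le> U + W / 16" "0 \<le> U" for U W z :: real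
        using that by (simp add: field_simps)
      have "- (k * X t) \<le> ((u t)\<^sup>2 + (v t)\<^sup>2) + ((x t)\<^sup>2 + (y t)\<^sup>2) / 16"
        using kX[of t] X(1)[of t] by linarith
      from aux[OF this] show ?thesis unfolding L'_def E_def by (simp add: algebra_simps)
    qed
    \<comment> \<open>The dissipation of \<open>E / 16\<close> becomes the rate 1/20 for
      \<open>L\<close>, since \<open>L\<close> is at most \<open>5/4 * E\<close>.\<close>
    then have neg: "L t / 20 + L' \<le> 0" using LE(2)[of t] by (simp add: field_simps)
    have "((\<lambda>t. exp (t / 20) * L t) has_real_derivative exp (t / 20) * (L t / 20 + L')) (at t)"
      by (auto intro!: derivative_eq_intros L' simp: algebra_simps)
    moreover have "exp (t / 20) * (L t / 20 + L') \<le> 0" using neg by (simp add: mult_nonneg_nonpos)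
    ultimately show "\<exists>y. ((\<lambda>t. exp (t / 20) * L t) has_real_derivative y) (at t) \<and> y \<le> 0" by blast
  qed
  then have "L t \<le> exp (- t / 20) * L 0" by (simp add: exp_minus field_simps)
  also have "\<dots> \<le> exp (- t / 20) * (5/4 * E 0)" using LE(2)[of 0] by (intro mult_left_mono) auto
  finally have "E t \<le> 5/3 * (exp (- t / 20) * E 0)" using LE(1)[of t] by (simp add: field_simps)
  also have "\<dots> \<le> 4 * (exp (- t / 20) * E 0)" using E0[of 0] by (intro mult_right_mono) auto
  finally have "E t \<le> 4 * exp (- t / 20) * E 0" by (simp add: mult.assoc)
  then show ?thesis by (simp add: E_def x_def y_def u_def v_def cmod_power2 add.assoc)
qed

text \<open>Passing from the energy to its square root halves the rate 1/20, which is the origin of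
  the 40 in all later exponentials.\<close>

lemma wave_high_decay:
  assumes q: "\<bar>q\<bar> \<ge> 1/4" and "t \<ge> 0"
  shows "cmod (wave_dens q a b t) \<le> 2 * exp (- t / 40) * (cmod a + cmod b)"
    and "cmod (wave_vel q a b t) \<le> 2 * exp (- t / 40) * (cmod a + cmod b)"
proof -
  have *: "4 * exp (- t / 20) * ((cmod a)\<^sup>2 + (cmod b)\<^sup>2) \<le> (2 * exp (- t / 40) * (cmod a + cmod b))\<^sup>2"
  proof -
    have "(exp (- t / 40))\<^sup>2 = exp (- t / 20)" by (simp flip: exp_double)
    then have "(2 * exp (- t / 40) * (cmod a + cmod b))\<^sup>2 = 4 * exp (- t / 20) * (cmod a + cmod b)\<^sup>2"
      by (simp add: power_mult_distrib)
    also have "\<dots> \<ge> 4 * exp (- t / 20) * ((cmod a)\<^sup>2 + (cmod b)\<^sup>2)"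
      by (intro mult_left_mono) (auto simp: power2_sum)
    finally show ?thesis .
  qed
  have le: "(cmod (wave_dens q a b t))\<^sup>2 + (cmod (wave_vel q a b t))\<^sup>2 \<le> (2 * exp (- t / 40) * (cmod a + cmod b))\<^sup>2"
    using wave_high_decay_aux[OF assms, of a b] * by (rule order_trans)
  show "cmod (wave_dens q a b t) \<le> 2 * exp (- t / 40) * (cmod a + cmod b)"
    by (rule power2_le_imp_le) (use le zero_le_power2[of "cmod (wave_vel q a b t)"] in linarith, simp)
  show "cmod (wave_vel q a b t) \<le> 2 * exp (- t / 40) * (cmod a + cmod b)"
    by (rule power2_le_imp_le) (use le zero_le_power2[of "cmod (wave_dens q a b t)"] in linarith, simp)
qed

lemma linear_ode_eq_exp:
  fixes f :: "real \<Rightarrow> complex"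
  assumes "\<And>t. (f has_vector_derivative - l *\<^sub>R f t) (at t)"
  shows "f t = exp (- l * t) *\<^sub>R f 0"
proof -
  have e: "((\<lambda>t. exp (l * t)) has_real_derivative l * exp (l * t)) (at t)" for t
    by (auto intro!: derivative_eq_intros)
  have "((\<lambda>t. exp (l * t) *\<^sub>R f t) has_vector_derivative 0) (at t within UNIV)" for t
    by (rule has_vector_derivative_eq_rhs[OF has_vector_derivative_scaleR[OF e assms]])
      (simp add: algebra_simps)
  then obtain c where c: "\<And>t. exp (l * t) *\<^sub>R f t = c"
    using has_vector_derivative_zero_constant[of UNIV "\<lambda>t. exp (l * t) *\<^sub>R f t"] by auto
  have "exp (l * t) *\<^sub>R f t = f 0" using c[of t] c[of 0] by simp
  then have "exp (- l * t) *\<^sub>R exp (l * t) *\<^sub>R f t = exp (- l * t) *\<^sub>R f 0" by simp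
  then show ?thesis by (simp flip: exp_add)
qed

text \<open>
  For small \<open>q\<close> the system is diagonal in the slow variable \<open>a - \<i>gb\<close>, which decays at rate
  \<open>\<mu> = q\<^sup>2 + O(q\<^sup>4)\<close>, and the fast variable \<open>b + \<i>ga\<close>, which decays at rate \<open>1 - \<mu>\<close>.
\<close>

lemma wave_low_modes:
  assumes q: "\<bar>q\<bar> \<le> 1/4"
  obtains \<mu> g where "q\<^sup>2 \<le> \<mu>" "\<mu> \<le> 2 * q\<^sup>2" "\<bar>g\<bar> \<le> 2 * \<bar>q\<bar>" "\<mu> \<le> 1/2" "g - q = \<mu> * g" "g * q = \<mu>"
    "\<And>a b t. wave_dens q a b t - \<i> * g * wave_vel q a b t = exp (- \<mu> * t) *\<^sub>R (a - \<i> * g * b)"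
    "\<And>a b t. wave_vel q a b t + \<i> * g * wave_dens q a b t = exp (- (1 - \<mu>) * t) *\<^sub>R (b + \<i> * g * a)"
proof -
  \<comment> \<open>\<open>\<mu>\<close> is the smaller root of
    \<open>\<mu> * (1 - \<mu>) = q\<^sup>2\<close>. The multiplier \<open>g\<close> is forced by
    asking that \<open>a - \<i> * g * b\<close> decay at rate \<open>\<mu>\<close>, which amounts to
    \<open>g * q = \<mu>\<close> and \<open>g - q = \<mu> * g\<close>.\<close>
  define \<mu> where "\<mu> = 1/2 - sqrt (1/4 - q\<^sup>2)"
  define g where "g = q / (1 - \<mu>)"
  have "q\<^sup>2 \<le> (1/4)\<^sup>2" using q by (metis abs_ge_zero power2_abs power_mono)
  then have q2: "q\<^sup>2 \<le> 1/16" by (simp add: power2_eq_square)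
  have s: "(sqrt (1/4 - q\<^sup>2))\<^sup>2 = 1/4 - q\<^sup>2" "sqrt (1/4 - q\<^sup>2) \<ge> 0" using q2 by auto
  have \<mu>: "\<mu> * (1 - \<mu>) = q\<^sup>2" "\<mu> \<le> 1/2"
    using s by (auto simp: \<mu>_def power2_eq_square algebra_simps)
  have \<mu>0: "\<mu> \<ge> 0"
  proof -
    have "0 \<le> \<mu> * (1 - \<mu>)" using \<mu> by simp
    then show ?thesis using \<mu>(2) by (simp add: zero_le_mult_iff)
  qed
  have ge: "q\<^sup>2 \<le> \<mu>" using \<mu> \<mu>0 mult_left_mono[of "1 - \<mu>" 1 \<mu>] by simp
  have le: "\<mu> \<le> 2 * q\<^sup>2" using \<mu> \<mu>0 mult_left_mono[of "1/2" "1 - \<mu>" \<mu>] by simp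
  have g1: "g * (1 - \<mu>) = q" using \<mu>(2) by (simp add: g_def)
  have gq: "g - q = \<mu> * g" using g1 by (simp add: algebra_simps)
  have g\<mu>: "g * q = \<mu>"
  proof -
    have "g * q = q\<^sup>2 / (1 - \<mu>)" by (simp add: g_def power2_eq_square)
    also have "\<dots> = \<mu>" using \<mu>(2) by (simp flip: \<mu>(1))
    finally show ?thesis .
  qed
  have gle: "\<bar>g\<bar> \<le> 2 * \<bar>q\<bar>"
  proof -
    have "\<bar>g\<bar> * (1/2) \<le> \<bar>g\<bar> * (1 - \<mu>)" using \<mu>(2) by (intro mult_left_mono) auto
    also have "\<dots> = \<bar>q\<bar>" using g1 \<mu>(2) by (simp flip: g1 add: abs_mult)
    finally show ?thesis by simp
  qed
  have gq': "complex_of_real g - complex_of_real q = of_real \<mu> * of_real g"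
    using gq by (metis of_real_diff of_real_mult)
  have g\<mu>': "complex_of_real g * complex_of_real q = of_real \<mu>"
    using g\<mu> by (metis of_real_mult)
  have slow: "wave_dens q a b t - \<i> * g * wave_vel q a b t = exp (- \<mu> * t) *\<^sub>R (a - \<i> * g * b)" for a b t
  proof -
    let ?a = "wave_dens q a b" and ?b = "wave_vel q a b"
    have "((\<lambda>t. ?a t - \<i> * g * ?b t) has_vector_derivative - \<mu> *\<^sub>R (?a t - \<i> * g * ?b t)) (at t)" for t
    proof -
      have "((\<lambda>t. ?a t - \<i> * g * ?b t) has_vector_derivative
          - \<i> * q * ?b t - \<i> * g * (- \<i> * q * ?a t - ?b t)) (at t)"
        by (intro has_vector_derivative_diff has_vector_derivative_mult_right wave_dens_deriv wave_vel_deriv)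
      also have "- \<i> * q * ?b t - \<i> * g * (- \<i> * q * ?a t - ?b t) =
          \<i> * (g - complex_of_real q) * ?b t - (g * complex_of_real q) * ?a t"
        by (simp add: algebra_simps)
      also have "\<dots> = - \<mu> *\<^sub>R (?a t - \<i> * g * ?b t)"
        unfolding gq' g\<mu>' by (simp add: algebra_simps scaleR_conv_of_real)
      finally show ?thesis .
    qed
    from linear_ode_eq_exp[OF this] show ?thesis by simp
  qed
  have fast: "wave_vel q a b t + \<i> * g * wave_dens q a b t = exp (- (1 - \<mu>) * t) *\<^sub>R (b + \<i> * g * a)" for a b t
  proof -
    let ?a = "wave_dens q a b" and ?b = "wave_vel q a b"
    have "((\<lambda>t. ?b t + \<i> * g * ?a t) has_vector_derivative - (1 - \<mu>) *\<^sub>R (?b t + \<i> * g * ?a t)) (at t)" for t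
    proof -
      have "((\<lambda>t. ?b t + \<i> * g * ?a t) has_vector_derivative
          (- \<i> * q * ?a t - ?b t) + \<i> * g * (- \<i> * q * ?b t)) (at t)"
        by (intro has_vector_derivative_add has_vector_derivative_mult_right wave_dens_deriv wave_vel_deriv)
      also have "(- \<i> * q * ?a t - ?b t) + \<i> * g * (- \<i> * q * ?b t) =
          - ?b t + (g * complex_of_real q) * ?b t + \<i> * (g - complex_of_real q) * ?a t - \<i> * g * ?a t"
        by (simp add: algebra_simps)
      also have "\<dots> = - (1 - \<mu>) *\<^sub>R (?b t + \<i> * g * ?a t)"
        unfolding gq' g\<mu>' by (simp add: algebra_simps scaleR_conv_of_real)
      finally show ?thesis .
    qed
    from linear_ode_eq_exp[OF this] show ?thesis by simp
  qed
  show ?thesis by (rule that[OF ge le gle \<mu>(2) gq g\<mu> slow fast])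
qed


text \<open>The density is the slow variable up to a multiple of \<open>g\<close>, and the rate
  \<open>\<mu>\<close> differs from the heat rate \<open>q\<^sup>2\<close> only at fourth order; the
  first-order term in \<open>b\<close> comes from the initial value of the slow variable. The
  velocity plus \<open>\<i> * q\<close> times the density is the fast variable up to a third-order
  correction, hence the \<open>\<bar>q\<bar> ^ 3\<close> in front of its slowly decaying part. Only
  half of the heat exponent is kept, the other half absorbs a factor of time.\<close>

lemma wave_low_bounds:
  assumes q: "\<bar>q\<bar> \<le> 1/4" and t: "t \<ge> 0"
  shows "cmod (wave_dens q a b t - exp (- q\<^sup>2 * t) *\<^sub>R a) \<le>
      16 * exp (- q\<^sup>2 * t / 2) * (q\<^sup>2 * cmod a + \<bar>q\<bar> * cmod b)"
    and "cmod (wave_vel q a b t + \<i> * q * wave_dens q a b t) \<le>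
      2 * exp (- t / 2) * (cmod b + 2 * \<bar>q\<bar> * cmod a) +
      6 * \<bar>q\<bar> ^ 3 * exp (- q\<^sup>2 * t / 2) * (cmod a + 2 * \<bar>q\<bar> * cmod b)"
proof -
  obtain \<mu> g where \<mu>: "q\<^sup>2 \<le> \<mu>" "\<mu> \<le> 2 * q\<^sup>2" "\<mu> \<le> 1/2" and g: "\<bar>g\<bar> \<le> 2 * \<bar>q\<bar>"
    and gq: "g - q = \<mu> * g" "g * q = \<mu>"
    and slow: "wave_dens q a b t - \<i> * g * wave_vel q a b t = exp (- \<mu> * t) *\<^sub>R (a - \<i> * g * b)"
    and fast: "wave_vel q a b t + \<i> * g * wave_dens q a b t = exp (- (1 - \<mu>) * t) *\<^sub>R (b + \<i> * g * a)"
    using wave_low_modes[OF q] by metis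
  define k where "k = \<bar>q\<bar>"
  define x where "x = cmod a"
  define y where "y = cmod b"
  define E where "E = exp (- q\<^sup>2 * t / 2)"
  define A where "A = wave_dens q a b t"
  define B where "B = wave_vel q a b t"
  define P where "P = B + \<i> * g * A"
  define R where "R = A - \<i> * g * B"
  have k: "0 \<le> k" "k \<le> 1/4" "k\<^sup>2 = q\<^sup>2" "\<bar>g\<bar> \<le> 2 * k" using q g by (auto simp: k_def)
  have xy: "0 \<le> x" "0 \<le> y" and E: "0 < E" by (auto simp: x_def y_def E_def)
  have "k\<^sup>2 \<le> (1/4)\<^sup>2" using k by (intro power_mono) auto
  then have k2: "k\<^sup>2 \<le> 1/16" by (simp add: power2_eq_square)
  have \<mu>0: "0 \<le> \<mu>" using \<mu>(1) zero_le_power2[of q] by linarith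
  have g2: "g\<^sup>2 \<le> 4 * k\<^sup>2"
    using power_mono[OF k(4), of 2] by (simp add: power_mult_distrib)
  have e\<mu>: "exp (- \<mu> * t) \<le> E"
  proof -
    have "q\<^sup>2 / 2 \<le> \<mu>" using \<mu>(1) zero_le_power2[of q] by linarith
    from mult_right_mono[OF this t] show ?thesis by (simp add: E_def)
  qed
  have eh: "exp (- t / 2) \<le> E"
    using k2 k(3) t mult_right_mono[of "q\<^sup>2" 1 t] by (simp add: E_def)
  have e1: "exp (- (1 - \<mu>) * t) \<le> exp (- t / 2)"
    using \<mu>(3) t mult_right_mono[of "1/2" "1 - \<mu>" t] by (simp add: algebra_simps)
  have Pb: "cmod P \<le> exp (- t / 2) * (y + 2 * k * x)"
  proof -
    have "cmod P = exp (- (1 - \<mu>) * t) * cmod (b + \<i> * g * a)"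
      unfolding P_def A_def B_def fast by simp
    also have "cmod (b + \<i> * g * a) \<le> y + \<bar>g\<bar> * x"
      unfolding x_def y_def by (rule order_trans[OF norm_triangle_ineq]) (simp add: norm_mult)
    also have "\<dots> \<le> y + 2 * k * x" using k(4) xy by (simp add: mult_right_mono)
    also have "exp (- (1 - \<mu>) * t) * (y + 2 * k * x) \<le> exp (- t / 2) * (y + 2 * k * x)"
      using e1 k xy by (intro mult_right_mono) auto
    finally show ?thesis by simp
  qed
  have PE: "cmod P \<le> E * (y + 2 * k * x)"
    using eh k xy by (intro order_trans[OF Pb] mult_right_mono) auto
  have RE: "cmod R \<le> E * (x + 2 * k * y)"
  proof -
    have "cmod R = exp (- \<mu> * t) * cmod (a - \<i> * g * b)"
      unfolding R_def A_def B_def slow by simp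
    also have "cmod (a - \<i> * g * b) \<le> x + \<bar>g\<bar> * y"
      unfolding x_def y_def by (rule order_trans[OF norm_triangle_ineq4]) (simp add: norm_mult)
    also have "\<dots> \<le> x + 2 * k * y" using k(4) xy by (simp add: mult_right_mono)
    also have "exp (- \<mu> * t) * (x + 2 * k * y) \<le> E * (x + 2 * k * y)"
      using e\<mu> k xy by (intro mult_right_mono) auto
    finally show ?thesis by simp
  qed
  \<comment> \<open>Solving for \<open>A\<close> would divide by \<open>1 - g\<^sup>2\<close>.
    Leaving \<open>g\<^sup>2 *\<^sub>R A\<close> on the right and absorbing it, since it is at most
    a quarter of \<open>A\<close> in norm, takes only triangle inequalities.\<close>
  have A_eq: "A = g\<^sup>2 *\<^sub>R A + R + \<i> * g * P"
    by (simp add: P_def R_def algebra_simps scaleR_conv_of_real power2_eq_square)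
  have gP: "cmod (\<i> * g * P) \<le> 2 * k * cmod P"
    using k(4) by (simp add: norm_mult mult_right_mono)
  have gA: "cmod (g\<^sup>2 *\<^sub>R A) \<le> 4 * k\<^sup>2 * cmod A"
    using g2 by (simp add: mult_right_mono)
  have Ab: "cmod A \<le> 4/3 * (cmod R + 2 * k * cmod P)"
  proof -
    have "cmod A \<le> cmod (g\<^sup>2 *\<^sub>R A + R) + cmod (\<i> * g * P)"
      by (subst A_eq) (rule norm_triangle_ineq)
    also have "\<dots> \<le> 4 * k\<^sup>2 * cmod A + cmod R + 2 * k * cmod P"
      using norm_triangle_ineq[of "g\<^sup>2 *\<^sub>R A" R] gA gP by linarith
    also have "4 * k\<^sup>2 * cmod A \<le> 1/4 * cmod A" using k2 by (intro mult_right_mono) auto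
    finally show ?thesis by simp
  qed
  \<comment> \<open>\<open>\<mu> - q\<^sup>2 = \<mu> * \<mu>\<close> is of fourth order in
    \<open>q\<close>. Linearising the exponential produces a factor \<open>t\<close>, and one
    \<open>E\<close> out of \<open>exp (- q\<^sup>2 * t) = E * E\<close> absorbs
    \<open>q\<^sup>2 * t\<close>.\<close>
  have diff: "\<bar>exp (- \<mu> * t) - exp (- q\<^sup>2 * t)\<bar> \<le> 4 * k\<^sup>2 * E"
  proof -
    define z where "z = (\<mu> - q\<^sup>2) * t"
    have z0: "0 \<le> z" using \<mu>(1) t by (simp add: z_def)
    have mm: "\<mu> - q\<^sup>2 \<le> 4 * k\<^sup>2 * k\<^sup>2"
    proof -
      have "\<mu> - q\<^sup>2 = \<mu> * \<mu>"
      proof -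
        have "(g - q) * q = \<mu> * (g * q)" using gq(1) by simp
        then show ?thesis using gq(2) by (simp add: left_diff_distrib power2_eq_square)
      qed
      also have "\<dots> \<le> (2 * k\<^sup>2) * (2 * k\<^sup>2)" using \<mu>(2) \<mu>0 k(3) by (intro mult_mono) auto
      also have "\<dots> = 4 * k\<^sup>2 * k\<^sup>2" by (simp add: power2_eq_square)
      finally show ?thesis .
    qed
    have EE: "exp (- q\<^sup>2 * t) = E * E" by (simp add: E_def flip: exp_add)
    have "exp (- \<mu> * t) = exp (- q\<^sup>2 * t) * exp (- z)"
      by (simp add: z_def algebra_simps flip: exp_add)
    then have "\<bar>exp (- \<mu> * t) - exp (- q\<^sup>2 * t)\<bar> = exp (- q\<^sup>2 * t) * (1 - exp (- z))"
      using z0 by (simp add: abs_if algebra_simps)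
    also have "\<dots> \<le> exp (- q\<^sup>2 * t) * z"
      using exp_ge_add_one_self[of "- z"] by (intro mult_left_mono) auto
    also have "\<dots> \<le> exp (- q\<^sup>2 * t) * (4 * k\<^sup>2 * k\<^sup>2 * t)"
      unfolding z_def using mm t by (intro mult_left_mono mult_right_mono) auto
    also have "\<dots> = 4 * k\<^sup>2 * E * (E * (q\<^sup>2 * t))" unfolding EE k(3) by (simp only: mult_ac)
    also have "\<dots> \<le> 4 * k\<^sup>2 * E * 1"
    proof -
      define u where "u = q\<^sup>2 * t / 2"
      have "u \<ge> 0" using t by (simp add: u_def)
      \<comment> \<open>By
        \<open>1 + u + u\<^sup>2 / 2 - 2 * u = ((u - 1)\<^sup>2 + 1) / 2\<close>.\<close>
      have "2 * u \<le> exp u"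
        using exp_lower_Taylor_quadratic[OF \<open>u \<ge> 0\<close>] zero_le_power2[of "u - 1"]
        by (simp add: power2_diff)
      then have "exp (- u) * (2 * u) \<le> exp (- u) * exp u" by (intro mult_left_mono) auto
      then have "E * (q\<^sup>2 * t) \<le> 1" by (simp add: E_def u_def flip: exp_add)
      then show ?thesis using E by (intro mult_left_mono) auto
    qed
    finally show ?thesis by simp
  qed
  \<comment> \<open>Terms with two further powers of \<open>k\<close> are folded into the leading
    ones. The coefficient of \<open>k\<^sup>2 * x\<close> then adds up to 16/3 + 4/3 + 8, which is
    below 16.\<close>
  have k3: "k * k\<^sup>2 * y \<le> k * y / 16" "k\<^sup>2 * k\<^sup>2 * x \<le> k\<^sup>2 * x / 16"
    using mult_left_mono[OF k2, of "k * y"] mult_left_mono[OF k2, of "k\<^sup>2 * x"] k(1) xy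
    by (simp_all add: mult_ac)
  have "cmod (A - exp (- q\<^sup>2 * t) *\<^sub>R a) \<le> 16 * E * (k\<^sup>2 * x + k * y)"
  proof -
    have R_eq: "R = exp (- \<mu> * t) *\<^sub>R (a - \<i> * g * b)"
      unfolding R_def A_def B_def by (rule slow)
    have "A - exp (- q\<^sup>2 * t) *\<^sub>R a = (g\<^sup>2 *\<^sub>R A + R + \<i> * g * P) - exp (- q\<^sup>2 * t) *\<^sub>R a"
      by (rule arg_cong[OF A_eq, of "\<lambda>z. z - exp (- q\<^sup>2 * t) *\<^sub>R a"])
    also have "\<dots> = g\<^sup>2 *\<^sub>R A + (exp (- \<mu> * t) - exp (- q\<^sup>2 * t)) *\<^sub>R a - exp (- \<mu> * t) *\<^sub>R (\<i> * g * b) + \<i> * g * P"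
      by (simp add: R_eq algebra_simps)
    finally have "cmod (A - exp (- q\<^sup>2 * t) *\<^sub>R a) \<le>
        cmod (g\<^sup>2 *\<^sub>R A) + cmod ((exp (- \<mu> * t) - exp (- q\<^sup>2 * t)) *\<^sub>R a) + cmod (exp (- \<mu> * t) *\<^sub>R (\<i> * g * b)) + cmod (\<i> * g * P)"
      by (metis (no_types, opaque_lifting) add_mono_thms_linordered_semiring(3) norm_triangle_le norm_triangle_le_diff order_refl)
    also have "cmod ((exp (- \<mu> * t) - exp (- q\<^sup>2 * t)) *\<^sub>R a) \<le> 4 * k\<^sup>2 * E * x"
      using diff xy by (simp add: x_def mult_right_mono)
    also have "cmod (exp (- \<mu> * t) *\<^sub>R (\<i> * g * b)) \<le> E * (2 * k * y)"
      using e\<mu> k(4) xy k(1) E by (auto simp: norm_mult y_def intro!: mult_mono)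
    also have "cmod (g\<^sup>2 *\<^sub>R A) \<le> 4 * k\<^sup>2 * (4/3 * (E * (x + 2 * k * y) + 2 * k * (E * (y + 2 * k * x))))"
      using Ab RE PE k by (intro order_trans[OF gA] mult_left_mono order_trans[OF Ab] add_mono) auto
    also have "cmod (\<i> * g * P) \<le> 2 * k * (E * (y + 2 * k * x))"
      using PE k by (intro order_trans[OF gP] mult_left_mono) auto
    finally have "cmod (A - exp (- q\<^sup>2 * t) *\<^sub>R a) \<le>
        E * (16/3 * (k\<^sup>2 * x) + 64/3 * (k * k\<^sup>2 * y) + 64/3 * (k\<^sup>2 * k\<^sup>2 * x) + 8 * (k\<^sup>2 * x) + 4 * (k * y))"
      by (simp add: algebra_simps power2_eq_square)
    also have "\<dots> \<le> E * (16 * (k\<^sup>2 * x + k * y))"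
    proof (intro mult_left_mono)
      have "0 \<le> k\<^sup>2 * x" "0 \<le> k * y" using xy k(1) by simp_all
      with k3 show "16/3 * (k\<^sup>2 * x) + 64/3 * (k * k\<^sup>2 * y) + 64/3 * (k\<^sup>2 * k\<^sup>2 * x) + 8 * (k\<^sup>2 * x) + 4 * (k * y)
          \<le> 16 * (k\<^sup>2 * x + k * y)"
        unfolding distrib_left by linarith
    qed (use E in simp)
    also have "\<dots> = 16 * E * (k\<^sup>2 * x + k * y)" by (simp only: mult_ac)
    finally show ?thesis .
  qed
  then show "cmod (wave_dens q a b t - exp (- q\<^sup>2 * t) *\<^sub>R a) \<le>
      16 * exp (- q\<^sup>2 * t / 2) * (q\<^sup>2 * cmod a + \<bar>q\<bar> * cmod b)"
    by (simp add: A_def E_def x_def y_def k(3) k_def)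
  have "cmod (B + \<i> * q * A) \<le> 2 * exp (- t / 2) * (y + 2 * k * x) + 6 * k ^ 3 * E * (x + 2 * k * y)"
  proof -
    \<comment> \<open>Replacing \<open>g\<close> by \<open>q\<close> in the fast variable costs
      \<open>(g - q) * A = \<mu> * g * A\<close>, and \<open>\<mu> * g\<close> is cubic in
      \<open>q\<close>.\<close>
    have "complex_of_real g - complex_of_real q = of_real (\<mu> * g)"
      using gq(1) by (metis of_real_diff)
    then have "B + \<i> * q * A = P - \<i> * (\<mu> * g) * A"
      by (simp add: P_def algebra_simps) (metis (no_types, lifting) add_diff_cancel_right' diff_add_cancel distrib_left mult.left_commute)
    then have "cmod (B + \<i> * q * A) \<le> cmod P + \<mu> * \<bar>g\<bar> * cmod A"
      using norm_triangle_ineq4[of P "\<i> * (\<mu> * g) * A"] \<mu>0 by (simp add: norm_mult)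
    also have "\<mu> * \<bar>g\<bar> \<le> (2 * k\<^sup>2) * (2 * k)" using \<mu>(2) \<mu>0 k by (intro mult_mono) auto
    also have "(2 * k\<^sup>2) * (2 * k) = 4 * k ^ 3" by (simp add: power3_eq_cube power2_eq_square)
    also have "4 * k ^ 3 * cmod A \<le> 4 * k ^ 3 * (4/3 * (cmod R + 2 * k * cmod P))"
      using Ab k(1) by (intro mult_left_mono) auto
    finally have "cmod (B + \<i> * q * A) \<le> (1 + 32/3 * (k\<^sup>2 * k\<^sup>2)) * cmod P + 16/3 * k ^ 3 * cmod R"
      by (simp add: algebra_simps power3_eq_cube power2_eq_square mult_right_mono)
    also have "\<dots> \<le> 2 * cmod P + 6 * k ^ 3 * cmod R"
    proof (intro add_mono mult_right_mono)
      have "k\<^sup>2 * k\<^sup>2 \<le> 1/16 * (1/16)" using k2 by (intro mult_mono) auto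
      then show "1 + 32/3 * (k\<^sup>2 * k\<^sup>2) \<le> 2" by simp
    qed (use k in auto)
    also have "\<dots> \<le> 2 * (exp (- t / 2) * (y + 2 * k * x)) + 6 * k ^ 3 * (E * (x + 2 * k * y))"
      using Pb RE k by (intro add_mono mult_left_mono) auto
    finally show ?thesis by (simp add: mult_ac)
  qed
  then show "cmod (wave_vel q a b t + \<i> * q * wave_dens q a b t) \<le>
      2 * exp (- t / 2) * (cmod b + 2 * \<bar>q\<bar> * cmod a) +
      6 * \<bar>q\<bar> ^ 3 * exp (- q\<^sup>2 * t / 2) * (cmod a + 2 * \<bar>q\<bar> * cmod b)"
    by (simp add: A_def B_def E_def x_def y_def k_def)
qed


text \<open>
  Back in the original variables: \<open>m\<close> is the symbol of the difference operator divided by \<open>\<i>\<close>, and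
  time is rescaled by \<open>\<epsilon>\<^sup>2\<close>.
\<close>

definition relax_dens :: "real \<Rightarrow> real \<Rightarrow> complex \<Rightarrow> complex \<Rightarrow> real \<Rightarrow> complex" where
  "relax_dens \<epsilon> m r w t = wave_dens (\<epsilon> * m) r (\<epsilon> * w) (t / \<epsilon>\<^sup>2)"

definition relax_vel :: "real \<Rightarrow> real \<Rightarrow> complex \<Rightarrow> complex \<Rightarrow> real \<Rightarrow> complex" where
  "relax_vel \<epsilon> m r w t = wave_vel (\<epsilon> * m) r (\<epsilon> * w) (t / \<epsilon>\<^sup>2) / \<epsilon>"

lemma relax_0: "\<epsilon> > 0 \<Longrightarrow> relax_dens \<epsilon> m r w 0 = r" "\<epsilon> > 0 \<Longrightarrow> relax_vel \<epsilon> m r w 0 = w"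
  by (simp_all add: relax_dens_def relax_vel_def)

lemma relax_deriv:
  assumes "\<epsilon> > 0"
  shows "(relax_dens \<epsilon> m r w has_vector_derivative - \<i> * m * relax_vel \<epsilon> m r w t) (at t)"
    and "(relax_vel \<epsilon> m r w has_vector_derivative
      - (\<i> * m * relax_dens \<epsilon> m r w t + relax_vel \<epsilon> m r w t) / \<epsilon>\<^sup>2) (at t)"
proof -
  have s: "((\<lambda>t. t / \<epsilon>\<^sup>2) has_real_derivative 1 / \<epsilon>\<^sup>2) (at t)" by (intro DERIV_cdivide DERIV_ident)
  have eq: "complex_of_real \<epsilon> \<noteq> 0" using assms by simp
  show "(relax_dens \<epsilon> m r w has_vector_derivative - \<i> * m * relax_vel \<epsilon> m r w t) (at t)"
    unfolding relax_dens_def[abs_def] relax_vel_def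
    using vector_diff_chain_at[OF s[unfolded has_real_derivative_iff_has_vector_derivative] wave_dens_deriv[of "\<epsilon> * m" r "\<epsilon> * w" "t / \<epsilon>\<^sup>2"]] eq
    by (simp add: o_def scaleR_conv_of_real power2_eq_square mult_ac)
  have "((\<lambda>t. wave_vel (\<epsilon> * m) r (\<epsilon> * w) (t / \<epsilon>\<^sup>2)) has_vector_derivative
     (1 / \<epsilon>\<^sup>2) *\<^sub>R (- \<i> * (\<epsilon> * m) * wave_dens (\<epsilon> * m) r (\<epsilon> * w) (t / \<epsilon>\<^sup>2) - wave_vel (\<epsilon> * m) r (\<epsilon> * w) (t / \<epsilon>\<^sup>2))) (at t)"
    using vector_diff_chain_at[OF s[unfolded has_real_derivative_iff_has_vector_derivative] wave_vel_deriv[of "\<epsilon> * m" r "\<epsilon> * w" "t / \<epsilon>\<^sup>2"]]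
    by (simp add: o_def)
  from has_vector_derivative_divide[OF this, of \<epsilon>]
  show "(relax_vel \<epsilon> m r w has_vector_derivative
      - (\<i> * m * relax_dens \<epsilon> m r w t + relax_vel \<epsilon> m r w t) / \<epsilon>\<^sup>2) (at t)"
    unfolding relax_vel_def[abs_def] relax_dens_def
    by (rule has_vector_derivative_eq_rhs) (use eq in \<open>simp add: field_simps scaleR_conv_of_real\<close>)
qed

lemma measurable_relax [measurable (raw)]:
  assumes [measurable]: "m \<in> borel_measurable M" "r \<in> borel_measurable M"
    "w \<in> borel_measurable M" "t \<in> borel_measurable M"
  shows "(\<lambda>x. relax_dens \<epsilon> (m x) (r x) (w x) (t x)) \<in> borel_measurable M"
    and "(\<lambda>x. relax_vel \<epsilon> (m x) (r x) (w x) (t x)) \<in> borel_measurable M"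
  unfolding relax_dens_def relax_vel_def by measurable

lemma relax_bounded:
  assumes \<epsilon>: "\<epsilon> > 0" and t: "t \<ge> 0"
  shows "cmod (relax_dens \<epsilon> m r w t) \<le> cmod r + \<epsilon> * cmod w"
    and "\<epsilon> * cmod (relax_vel \<epsilon> m r w t) \<le> cmod r + \<epsilon> * cmod w"
proof -
  let ?a = "wave_dens (\<epsilon> * m) r (\<epsilon> * w) (t / \<epsilon>\<^sup>2)" and ?b = "wave_vel (\<epsilon> * m) r (\<epsilon> * w) (t / \<epsilon>\<^sup>2)"
  have le: "(cmod ?a)\<^sup>2 + (cmod ?b)\<^sup>2 \<le> (cmod r + \<epsilon> * cmod w)\<^sup>2"
    using wave_energy_nonincreasing[of "t / \<epsilon>\<^sup>2" "\<epsilon> * m" r "\<epsilon> * w"] t \<epsilon>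
    by (rule_tac order_trans) (auto simp: norm_mult power2_sum)
  have pos: "0 \<le> cmod r + \<epsilon> * cmod w" using \<epsilon> by simp
  have "cmod ?a \<le> cmod r + \<epsilon> * cmod w"
    by (rule power2_le_imp_le[OF _ pos]) (use le zero_le_power2[of "cmod ?b"] in linarith)
  then show "cmod (relax_dens \<epsilon> m r w t) \<le> cmod r + \<epsilon> * cmod w" by (simp add: relax_dens_def)
  have "cmod ?b \<le> cmod r + \<epsilon> * cmod w"
    by (rule power2_le_imp_le[OF _ pos]) (use le zero_le_power2[of "cmod ?a"] in linarith)
  then show "\<epsilon> * cmod (relax_vel \<epsilon> m r w t) \<le> cmod r + \<epsilon> * cmod w"
    using \<epsilon> by (simp add: relax_vel_def norm_divide)
qed

text \<open>Below the threshold the slow variable follows the heat flow. Above it nothing is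
  compared: the relaxation part decays in the layer, and the heat part is paid for by
  \<open>1 \<le> 16 * (\<epsilon> * m)\<^sup>2\<close>. The case distinction survives in the bound
  because, at a fixed time, only \<open>\<epsilon> * \<bar>m\<bar> > 1/4\<close> lets the layer term
  be traded for \<open>\<epsilon>\<^sup>2\<close>.\<close>

lemma relax_minus_heat_bound:
  assumes \<epsilon>: "\<epsilon> > 0" and t: "t \<ge> 0"
  shows "cmod (relax_dens \<epsilon> m r w t - exp (- m\<^sup>2 * t) *\<^sub>R r0) \<le>
    (if \<epsilon> * \<bar>m\<bar> > 1/4 then 2 * exp (- t / (40 * \<epsilon>\<^sup>2)) * (cmod r + \<epsilon> * cmod w) else 0) +
    exp (- m\<^sup>2 * t / 2) * (cmod (r0 - r) + 16 * \<epsilon>\<^sup>2 * (m\<^sup>2 * cmod r + \<bar>m\<bar> * cmod w))"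
proof -
  define E where "E = exp (- m\<^sup>2 * t / 2)"
  have E: "0 < E" by (simp add: E_def)
  have qt: "(\<epsilon> * m)\<^sup>2 * (t / \<epsilon>\<^sup>2) = m\<^sup>2 * t" using \<epsilon> by (simp add: power_mult_distrib)
  have eE: "exp (- m\<^sup>2 * t) \<le> E" using t by (simp add: E_def)
  have heat: "cmod (exp (- m\<^sup>2 * t) *\<^sub>R (r - r0)) \<le> E * cmod (r0 - r)"
    using eE by (simp add: norm_minus_commute mult_right_mono)
  show ?thesis
  proof (cases "\<epsilon> * \<bar>m\<bar> > 1/4")
    case False
    then have q: "\<bar>\<epsilon> * m\<bar> \<le> 1/4" using \<epsilon> by (simp add: abs_mult)
    have "- (\<epsilon> * m)\<^sup>2 * (t / \<epsilon>\<^sup>2) = - m\<^sup>2 * t" "- (\<epsilon> * m)\<^sup>2 * (t / \<epsilon>\<^sup>2) / 2 = - m\<^sup>2 * t / 2"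
      using qt by simp_all
    with wave_low_bounds(1)[OF q, of "t / \<epsilon>\<^sup>2" r "\<epsilon> * w"] t
    have "cmod (relax_dens \<epsilon> m r w t - exp (- m\<^sup>2 * t) *\<^sub>R r) \<le>
        16 * E * ((\<epsilon> * m)\<^sup>2 * cmod r + \<bar>\<epsilon> * m\<bar> * cmod (\<epsilon> * w))"
      by (simp only: relax_dens_def E_def) simp
    also have "\<dots> = E * (16 * \<epsilon>\<^sup>2 * (m\<^sup>2 * cmod r + \<bar>m\<bar> * cmod w))"
      using \<epsilon> by (simp add: norm_mult abs_mult power2_eq_square algebra_simps)
    finally have "cmod (relax_dens \<epsilon> m r w t - exp (- m\<^sup>2 * t) *\<^sub>R r0) \<le>
        E * (16 * \<epsilon>\<^sup>2 * (m\<^sup>2 * cmod r + \<bar>m\<bar> * cmod w)) + E * cmod (r0 - r)"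
      using heat norm_triangle_ineq[of "relax_dens \<epsilon> m r w t - exp (- m\<^sup>2 * t) *\<^sub>R r" "exp (- m\<^sup>2 * t) *\<^sub>R (r - r0)"]
      by (simp add: scaleR_right_diff_distrib)
    with False show ?thesis by (simp add: E_def distrib_left)
  next
    case True
    then have q: "\<bar>\<epsilon> * m\<bar> \<ge> 1/4" using \<epsilon> by (simp add: abs_mult)
    have high: "cmod (relax_dens \<epsilon> m r w t) \<le> 2 * exp (- t / (40 * \<epsilon>\<^sup>2)) * (cmod r + \<epsilon> * cmod w)"
      using wave_high_decay(1)[OF q, of "t / \<epsilon>\<^sup>2" r "\<epsilon> * w"] t \<epsilon>
      by (simp add: relax_dens_def norm_mult mult.commute)
    have "1 \<le> 16 * (\<epsilon> * m)\<^sup>2"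
      using power_mono[OF q, of 2] by (simp add: power2_eq_square)
    then have "cmod r \<le> 16 * (\<epsilon> * m)\<^sup>2 * cmod r"
      using mult_right_mono[of 1 "16 * (\<epsilon> * m)\<^sup>2" "cmod r"] by simp
    then have "exp (- m\<^sup>2 * t) * cmod r \<le> E * (16 * (\<epsilon> * m)\<^sup>2 * cmod r)"
      using eE E by (intro mult_mono) auto
    also have "\<dots> \<le> E * (16 * \<epsilon>\<^sup>2 * (m\<^sup>2 * cmod r + \<bar>m\<bar> * cmod w))"
      using E by (intro mult_left_mono) (auto simp: power_mult_distrib algebra_simps)
    finally have "cmod (relax_dens \<epsilon> m r w t - exp (- m\<^sup>2 * t) *\<^sub>R r0) \<le>
        2 * exp (- t / (40 * \<epsilon>\<^sup>2)) * (cmod r + \<epsilon> * cmod w) +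
        (E * cmod (r0 - r) + E * (16 * \<epsilon>\<^sup>2 * (m\<^sup>2 * cmod r + \<bar>m\<bar> * cmod w)))"
      using high heat norm_triangle_ineq4[of "relax_dens \<epsilon> m r w t" "exp (- m\<^sup>2 * t) *\<^sub>R r0"]
        norm_triangle_ineq4[of "exp (- m\<^sup>2 * t) *\<^sub>R r" "exp (- m\<^sup>2 * t) *\<^sub>R (r - r0)"]
      by (simp add: scaleR_right_diff_distrib)
    with True show ?thesis by (simp add: E_def distrib_left)
  qed
qed

text \<open>The first term is of order one near \<open>t = 0\<close>, because the velocity data are
  arbitrary. It reaches the order \<open>\<epsilon>\<^sup>2\<close> by integration over the layer,
  at low and high frequencies alike, so both regimes share one formula.\<close>

lemma relax_damped_mode_bound:
  assumes \<epsilon>: "\<epsilon> > 0" and t: "t \<ge> 0"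
  shows "cmod (\<i> * m * relax_dens \<epsilon> m r w t + relax_vel \<epsilon> m r w t) \<le>
    10 * exp (- t / (40 * \<epsilon>\<^sup>2)) * (cmod w + \<bar>m\<bar> * cmod r + \<epsilon> * \<bar>m\<bar> * cmod w) +
    6 * \<epsilon>\<^sup>2 * exp (- m\<^sup>2 * t / 2) * (\<bar>m\<bar> ^ 3 * cmod r + m\<^sup>2 * cmod w)"
proof -
  define n where "n = \<bar>m\<bar>"
  define x where "x = cmod r"
  define y where "y = cmod w"
  define E where "E = exp (- m\<^sup>2 * t / 2)"
  define D where "D = exp (- t / (40 * \<epsilon>\<^sup>2))"
  define A where "A = wave_dens (\<epsilon> * m) r (\<epsilon> * w) (t / \<epsilon>\<^sup>2)"
  define B where "B = wave_vel (\<epsilon> * m) r (\<epsilon> * w) (t / \<epsilon>\<^sup>2)"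
  have pos: "0 \<le> n" "0 \<le> x" "0 \<le> y" "0 < E" "0 < D" "n\<^sup>2 = m\<^sup>2"
    by (auto simp: n_def x_def y_def E_def D_def)
  have eq: "\<i> * m * relax_dens \<epsilon> m r w t + relax_vel \<epsilon> m r w t = (B + \<i> * (\<epsilon> * m) * A) / \<epsilon>"
    using \<epsilon> by (simp add: relax_dens_def relax_vel_def A_def B_def add_divide_distrib)
  have rhs: "0 \<le> 6 * \<epsilon>\<^sup>2 * E * (n ^ 3 * x + n\<^sup>2 * y)" using pos by simp
  have "cmod (B + \<i> * (\<epsilon> * m) * A) \<le> \<epsilon> * (10 * D * (y + n * x + \<epsilon> * n * y) + 6 * \<epsilon>\<^sup>2 * E * (n ^ 3 * x + n\<^sup>2 * y))"
  proof (cases "\<bar>\<epsilon> * m\<bar> \<le> 1/4")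
    case True
    have en: "\<epsilon> * n \<le> 1/4" using True \<epsilon> by (simp add: n_def abs_mult)
    have "- (\<epsilon> * m)\<^sup>2 * (t / \<epsilon>\<^sup>2) / 2 = - m\<^sup>2 * t / 2" using \<epsilon> by (simp add: power_mult_distrib)
    moreover have "cmod (\<epsilon> * w) = \<epsilon> * y" "\<bar>\<epsilon> * m\<bar> = \<epsilon> * n" using \<epsilon> by (simp_all add: y_def n_def norm_mult abs_mult)
    ultimately have "cmod (B + \<i> * (\<epsilon> * m) * A) \<le>
      2 * exp (- (t / \<epsilon>\<^sup>2) / 2) * (\<epsilon> * y + 2 * (\<epsilon> * n) * x) +
      6 * (\<epsilon> * n) ^ 3 * E * (x + 2 * (\<epsilon> * n) * (\<epsilon> * y))"
      using wave_low_bounds(2)[OF True, of "t / \<epsilon>\<^sup>2" r "\<epsilon> * w"] t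
      by (simp only: A_def B_def E_def x_def of_real_mult) simp
    also have "2 * exp (- (t / \<epsilon>\<^sup>2) / 2) * (\<epsilon> * y + 2 * (\<epsilon> * n) * x) \<le> \<epsilon> * (10 * D * (y + n * x + \<epsilon> * n * y))"
    proof -
      have "exp (- (t / \<epsilon>\<^sup>2) / 2) \<le> D" using t \<epsilon> by (simp add: D_def field_simps)
      then have "2 * exp (- (t / \<epsilon>\<^sup>2) / 2) * (\<epsilon> * y + 2 * (\<epsilon> * n) * x) \<le> 2 * D * (\<epsilon> * y + 2 * (\<epsilon> * n) * x)"
        using pos \<epsilon> by (intro mult_right_mono) auto
      also have "\<dots> = \<epsilon> * D * (2 * y + 4 * (n * x))" by (simp add: algebra_simps)
      also have "\<dots> \<le> \<epsilon> * D * (10 * (y + n * x + \<epsilon> * n * y))"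
        using pos \<epsilon> by (intro mult_left_mono) auto
      finally show ?thesis by (simp add: mult_ac)
    qed
    also have "6 * (\<epsilon> * n) ^ 3 * E * (x + 2 * (\<epsilon> * n) * (\<epsilon> * y)) \<le> \<epsilon> * (6 * \<epsilon>\<^sup>2 * E * (n ^ 3 * x + n\<^sup>2 * y))"
    proof -
      have "(\<epsilon> * n) * (\<epsilon> * n) \<le> 1/4 * (1/4)" using en pos \<epsilon> by (intro mult_mono) auto
      then have "2 * ((\<epsilon> * n) * (\<epsilon> * n)) * (n\<^sup>2 * y) \<le> 1 * (n\<^sup>2 * y)"
        using pos by (intro mult_right_mono) auto
      then have "\<epsilon> * (6 * \<epsilon>\<^sup>2 * E) * (n ^ 3 * x + 2 * ((\<epsilon> * n) * (\<epsilon> * n)) * (n\<^sup>2 * y)) \<le> \<epsilon> * (6 * \<epsilon>\<^sup>2 * E) * (n ^ 3 * x + n\<^sup>2 * y)"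
        using pos \<epsilon> by (intro mult_left_mono) auto
      then show ?thesis by (simp add: power3_eq_cube power2_eq_square algebra_simps)
    qed
    finally show ?thesis by (simp add: distrib_left)
  next
    case False
    then have q: "\<bar>\<epsilon> * m\<bar> \<ge> 1/4" by simp
    \<comment> \<open>Above the threshold this makes the bound for \<open>B\<close> at most four
      times the one for \<open>\<epsilon> * n * cmod A\<close>; the two together give the factor 5 *
      2 = 10.\<close>
    have en: "1 \<le> 4 * (\<epsilon> * n)" using q \<epsilon> by (simp add: n_def abs_mult)
    have DD: "exp (- (t / \<epsilon>\<^sup>2) / 40) = D" by (simp add: D_def)
    have AB: "cmod A \<le> 2 * D * (x + \<epsilon> * y)" "cmod B \<le> 2 * D * (x + \<epsilon> * y)"
      using wave_high_decay[OF q, of "t / \<epsilon>\<^sup>2" r "\<epsilon> * w"] t \<epsilon>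
      unfolding DD A_def[symmetric] B_def[symmetric] by (simp_all add: x_def y_def norm_mult)
    have "cmod (B + \<i> * (\<epsilon> * m) * A) \<le> cmod B + \<epsilon> * n * cmod A"
      by (rule order_trans[OF norm_triangle_ineq]) (use \<epsilon> in \<open>simp add: norm_mult n_def abs_mult\<close>)
    also have "\<dots> \<le> 2 * D * (x + \<epsilon> * y) + \<epsilon> * n * (2 * D * (x + \<epsilon> * y))"
      using AB \<epsilon> pos by (intro add_mono mult_left_mono) auto
    finally have le: "cmod (B + \<i> * (\<epsilon> * m) * A) \<le> 2 * D * (x + \<epsilon> * y) + \<epsilon> * n * (2 * D * (x + \<epsilon> * y))" .
    have "0 \<le> 2 * D * (x + \<epsilon> * y)" using pos \<epsilon> by simp
    from mult_right_mono[OF en this]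
    have "2 * D * (x + \<epsilon> * y) \<le> 4 * (\<epsilon> * n * (2 * D * (x + \<epsilon> * y)))" by (simp only: mult_1_left mult.assoc)
    with le have "cmod (B + \<i> * (\<epsilon> * m) * A) \<le> 5 * (\<epsilon> * n * (2 * D * (x + \<epsilon> * y)))" by linarith
    then have "cmod (B + \<i> * (\<epsilon> * m) * A) \<le> \<epsilon> * (10 * D * (n * x + \<epsilon> * n * y))"
      by (simp add: algebra_simps)
    also have "\<dots> \<le> \<epsilon> * (10 * D * (y + n * x + \<epsilon> * n * y) + 6 * \<epsilon>\<^sup>2 * E * (n ^ 3 * x + n\<^sup>2 * y))"
    proof (rule mult_left_mono)
      have "10 * D * (n * x + \<epsilon> * n * y) \<le> 10 * D * (y + n * x + \<epsilon> * n * y)"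
        using pos by (intro mult_left_mono) auto
      with rhs show "10 * D * (n * x + \<epsilon> * n * y) \<le> 10 * D * (y + n * x + \<epsilon> * n * y) + 6 * \<epsilon>\<^sup>2 * E * (n ^ 3 * x + n\<^sup>2 * y)"
        by linarith
    qed (use \<epsilon> in simp)
    finally show ?thesis .
  qed
  then have "cmod ((B + \<i> * (\<epsilon> * m) * A) / \<epsilon>) \<le> 10 * D * (y + n * x + \<epsilon> * n * y) + 6 * \<epsilon>\<^sup>2 * E * (n ^ 3 * x + n\<^sup>2 * y)"
    using \<epsilon> by (simp add: norm_divide pos_divide_le_eq mult.commute)
  then show ?thesis unfolding eq by (simp add: D_def E_def x_def y_def n_def)
qed

subsection \<open>Solutions on the grid and their Fourier representation\<close>

text \<open>Difference quotients are the form in which \<open>C1_l2\<close> states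
  differentiability; the filter within a set covers the one-sided derivative at 0.\<close>

lemma has_vector_derivative_quotient:
  fixes f :: "real \<Rightarrow> 'a::real_normed_vector"
  shows "(f has_vector_derivative D) (at t within S) \<longleftrightarrow>
    ((\<lambda>y. (f y - f t) /\<^sub>R (y - t) - D) \<longlongrightarrow> 0) (at t within S)"
proof -
  have "norm ((1 / norm (y - t)) *\<^sub>R (f y - (f t + (y - t) *\<^sub>R D))) = norm ((f y - f t) /\<^sub>R (y - t) - D)"
    if "y \<noteq> t" for y
  proof -
    have "(f y - f t) /\<^sub>R (y - t) - D = (1 / (y - t)) *\<^sub>R (f y - (f t + (y - t) *\<^sub>R D))"
      using that unfolding diff_diff_eq[symmetric] scaleR_right_diff_distrib[of "1 / (y - t)" "f y - f t"] scaleR_scaleR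
      by (simp add: divide_inverse)
    then show ?thesis by simp
  qed
  then have "\<forall>\<^sub>F y in at t within S. norm ((1 / norm (y - t)) *\<^sub>R (f y - (f t + (y - t) *\<^sub>R D))) = norm ((f y - f t) /\<^sub>R (y - t) - D)"
    by (simp add: eventually_at_filter)
  then have "((\<lambda>y. norm ((1 / norm (y - t)) *\<^sub>R (f y - (f t + (y - t) *\<^sub>R D)))) \<longlongrightarrow> 0) (at t within S) \<longleftrightarrow>
     ((\<lambda>y. norm ((f y - f t) /\<^sub>R (y - t) - D)) \<longlongrightarrow> 0) (at t within S)"
    by (rule tendsto_cong)
  then show ?thesis
    unfolding has_vector_derivative_def has_derivative_within tendsto_norm_zero_iff
    by (simp add: bounded_linear_scaleR_left)
qed

text \<open>The mean value inequality on the half-line makes \<open>g\<close> dominate the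
  difference quotients as well, so dominated convergence applies along every sequence of
  times.\<close>

lemma has_vector_derivative_integral:
  fixes f :: "real \<Rightarrow> 'a \<Rightarrow> complex"
  assumes der: "\<And>t x. 0 \<le> t \<Longrightarrow> ((\<lambda>t. f t x) has_vector_derivative f' t x) (at t within {0..})"
    and int: "\<And>t. 0 \<le> t \<Longrightarrow> integrable M (f t)"
    and [measurable]: "\<And>t. 0 \<le> t \<Longrightarrow> f' t \<in> borel_measurable M"
    and g: "integrable M g" "\<And>t x. 0 \<le> t \<Longrightarrow> cmod (f' t x) \<le> g x"
    and t: "0 \<le> t"
  shows "((\<lambda>t. LINT x|M. f t x) has_vector_derivative (LINT x|M. f' t x)) (at t within {0..})"
  unfolding has_vector_derivative_quotient tendsto_at_iff_sequentially
proof (intro allI impI)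
  fix Y :: "nat \<Rightarrow> real" assume Y: "\<forall>i. Y i \<in> {0..} - {t}" "Y \<longlonglongrightarrow> t"
  have f'_int: "integrable M (f' t)"
    by (rule Bochner_Integration.integrable_bound[OF g(1)]) (use t g in \<open>auto intro: order_trans[OF _ abs_ge_self]\<close>)
  have lim: "(\<lambda>i. LINT x|M. (f (Y i) x - f t x) /\<^sub>R (Y i - t)) \<longlonglongrightarrow> (LINT x|M. f' t x)"
  proof (rule integral_dominated_convergence[OF _ _ g(1)])
    show "f' t \<in> borel_measurable M" using f'_int by simp
    show "(\<lambda>x. (f (Y i) x - f t x) /\<^sub>R (Y i - t)) \<in> borel_measurable M" for i
      using int[OF t] int[of "Y i"] Y by (auto intro!: borel_measurable_scaleR borel_measurable_diff)
    show "AE x in M. (\<lambda>i. (f (Y i) x - f t x) /\<^sub>R (Y i - t)) \<longlonglongrightarrow> f' t x"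
    proof (rule AE_I2)
      fix x
      from der[OF t, of x] Y have "((\<lambda>y. (f y x - f t x) /\<^sub>R (y - t) - f' t x) \<circ> Y) \<longlonglongrightarrow> 0"
        unfolding has_vector_derivative_quotient tendsto_at_iff_sequentially by blast
      then show "(\<lambda>i. (f (Y i) x - f t x) /\<^sub>R (Y i - t)) \<longlonglongrightarrow> f' t x"
        by (simp add: o_def LIM_zero_iff)
    qed
    show "AE x in M. cmod ((f (Y i) x - f t x) /\<^sub>R (Y i - t)) \<le> g x" for i
    proof (rule AE_I2)
      fix x
      have "cmod (f (Y i) x - f t x) \<le> g x * norm (Y i - t)"
      proof (rule differentiable_bound[of "{0..}" "\<lambda>t. f t x" "\<lambda>s h. h *\<^sub>R f' s x"])
        show "((\<lambda>t. f t x) has_derivative (\<lambda>h. h *\<^sub>R f' s x)) (at s within {0..})" if "s \<in> {0..}" for s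
          using der[of s x] that by (simp add: has_vector_derivative_def)
        show "onorm (\<lambda>h. h *\<^sub>R f' s x) \<le> g x" if "s \<in> {0..}" for s
          using g(2)[of s x] that by (simp add: onorm_scaleR_left bounded_linear_ident onorm_id)
      qed (use Y t in auto)
      moreover have "Y i \<noteq> t" using Y by blast
      moreover have "cmod ((f (Y i) x - f t x) /\<^sub>R (Y i - t)) = cmod (f (Y i) x - f t x) / \<bar>Y i - t\<bar>"
        by (simp only: norm_scaleR abs_inverse divide_inverse mult.commute)
      ultimately show "cmod ((f (Y i) x - f t x) /\<^sub>R (Y i - t)) \<le> g x"
        by (simp only: real_norm_def) (simp only: pos_divide_le_eq zero_less_abs_iff right_minus_eq not_False_eq_True)
    qed
  qed
  have eq: "(LINT x|M. (f (Y i) x - f t x) /\<^sub>R (Y i - t)) = ((LINT x|M. f (Y i) x) - (LINT x|M. f t x)) /\<^sub>R (Y i - t)" for i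
    using int[OF t] int[of "Y i"] Y by simp
  show "((\<lambda>y. ((LINT x|M. f y x) - (LINT x|M. f t x)) /\<^sub>R (y - t) - (LINT x|M. f' t x)) \<circ> Y) \<longlonglongrightarrow> 0"
    using lim unfolding eq o_def by (rule LIM_zero)
qed

text \<open>
  Iterating the bound on the derivative gives \<open>B (L t)\<^sup>k / k!\<close> for every \<open>k\<close>. Working with the
  supremum norm avoids differentiating \<open>\<ell>\<^sup>2\<close> norms.
\<close>

lemma bounded_linear_system_unique:
  fixes e e' :: "real \<Rightarrow> 'i \<Rightarrow> complex"
  assumes der: "\<And>t i. 0 \<le> t \<Longrightarrow> ((\<lambda>t. e t i) has_vector_derivative e' t i) (at t within {0..})"
    and L: "0 \<le> L" "\<And>t i B. 0 \<le> t \<Longrightarrow> (\<And>j. cmod (e t j) \<le> B) \<Longrightarrow> cmod (e' t i) \<le> L * B"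
    and bnd: "\<And>T. \<exists>B. \<forall>t\<in>{0..T}. \<forall>i. cmod (e t i) \<le> B"
    and init: "\<And>i. e 0 i = 0" and T: "0 \<le> T"
  shows "e T i = 0"
proof -
  obtain B where "\<forall>t\<in>{0..T}. \<forall>i. cmod (e t i) \<le> B" using bnd[of T] by blast
  then have B: "\<And>t i. 0 \<le> t \<Longrightarrow> t \<le> T \<Longrightarrow> cmod (e t i) \<le> B" by simp
  have iter: "cmod (e t i) \<le> B * (L * t) ^ k / fact k" if "0 \<le> t" "t \<le> T" for k t i
    using that
  proof (induction k arbitrary: t i)
    case 0
    then show ?case using B by simp
  next
    case (Suc k)
    define \<phi> where "\<phi> s = B * L ^ Suc k / fact (Suc k) * s ^ Suc k" for s
    define \<phi>' where "\<phi>' s = L * (B * (L * s) ^ k / fact k)" for s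
    show ?case
    proof (cases "t = 0")
      case True
      then show ?thesis using init by simp
    next
      case False
      have "cmod (e t i - e 0 i) \<le> \<phi> t - \<phi> 0"
      proof (rule differentiable_bound_general[where f = "\<lambda>t. e t i" and f' = "\<lambda>t. e' t i" and \<phi>' = \<phi>'])
        show "0 < t" using False Suc.prems by simp
        have "continuous_on {0..} (\<lambda>t. e t i)"
          by (rule continuous_on_vector_derivative) (use der in auto)
        then show "continuous_on {0..t} (\<lambda>t. e t i)" by (rule continuous_on_subset) auto
        show "continuous_on {0..t} \<phi>" unfolding \<phi>_def by (intro continuous_intros)
        fix s assume s: "0 < s" "s < t"
        have "at s within {0..} = at s" using s by (intro at_within_interior) simp
        then show "((\<lambda>t. e t i) has_vector_derivative e' s i) (at s)" using der[of s i] s by simp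
        have "(\<phi> has_real_derivative B * L ^ Suc k / fact (Suc k) * (real (Suc k) * s ^ k)) (at s)"
          unfolding \<phi>_def[abs_def] by (intro DERIV_cmult) (use DERIV_pow[of "Suc k" s] in simp)
        moreover have "B * L ^ Suc k / fact (Suc k) * (real (Suc k) * s ^ k) = \<phi>' s"
          by (simp add: \<phi>'_def power_mult_distrib field_simps del: of_nat_Suc)
        ultimately show "(\<phi> has_vector_derivative \<phi>' s) (at s)"
          by (simp add: has_real_derivative_iff_has_vector_derivative)
        show "cmod (e' s i) \<le> \<phi>' s"
          unfolding \<phi>'_def using s Suc.prems by (intro L(2) Suc.IH) auto
      qed
      then show ?thesis by (simp add: init \<phi>_def power_mult_distrib mult_ac)
    qed
  qed
  have "(\<lambda>k. B * (inverse (fact k) * (L * T) ^ k)) \<longlonglongrightarrow> B * 0"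
    by (intro tendsto_mult_left summable_LIMSEQ_zero summable_exp)
  then have "(\<lambda>k. B * (L * T) ^ k / fact k) \<longlonglongrightarrow> 0" by (simp add: field_simps)
  then have "cmod (e T i) \<le> 0"
    by (rule tendsto_lowerbound) (use iter T in auto)
  then show ?thesis by simp
qed

section \<open>Differentiable curves of square summable sequences: componentwise derivatives and
  local bounds\<close>

lemma l2_seq_diff:
  assumes "v \<in> l2_seq" "w \<in> l2_seq"
  shows "(\<lambda>n. v n - w n) \<in> l2_seq"
proof -
  have "(\<lambda>n. 2 * (cmod (v n))\<^sup>2 + 2 * (cmod (w n))\<^sup>2) summable_on UNIV"
    using assms by (intro summable_on_add summable_on_cmult_right) (auto simp: l2_seq_def)
  moreover have "(cmod (v n - w n))\<^sup>2 \<le> 2 * (cmod (v n))\<^sup>2 + 2 * (cmod (w n))\<^sup>2" for n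
  proof -
    have "(cmod (v n - w n))\<^sup>2 \<le> (cmod (v n) + cmod (w n))\<^sup>2"
      by (intro power_mono norm_triangle_ineq4) auto
    also have "\<dots> \<le> 2 * (cmod (v n))\<^sup>2 + 2 * (cmod (w n))\<^sup>2"
      using sum_squares_bound[of "cmod (v n)" "cmod (w n)"] by (simp add: power2_sum)
    finally show ?thesis .
  qed
  ultimately show ?thesis unfolding l2_seq_def mem_Collect_eq
    by (rule summable_on_comparison_test) auto
qed

lemma l2_seq_divide:
  assumes "v \<in> l2_seq"
  shows "(\<lambda>n. v n / c) \<in> l2_seq"
proof -
  have "(cmod (v n / c))\<^sup>2 = inverse ((cmod c)\<^sup>2) * (cmod (v n))\<^sup>2" for n
    by (simp add: norm_divide power_divide field_simps)
  then show ?thesis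
    using summable_on_cmult_right[of "\<lambda>n. (cmod (v n))\<^sup>2" UNIV "inverse ((cmod c)\<^sup>2)"] assms
    by (simp only: l2_seq_def mem_Collect_eq)
qed

lemma cmod_le_l2norm:
  assumes h: "h > 0" and "v \<in> l2_seq"
  shows "sqrt h * cmod (v n) \<le> l2norm h v"
proof -
  have "(\<Sum>n\<in>{n}. (cmod (v n))\<^sup>2) \<le> (\<Sum>\<^sub>\<infinity>n. (cmod (v n))\<^sup>2)"
    using assms by (intro finite_sum_le_infsum) (auto simp: l2_seq_def)
  then have "h * (cmod (v n))\<^sup>2 \<le> h * (\<Sum>\<^sub>\<infinity>n. (cmod (v n))\<^sup>2)" using h by (intro mult_left_mono) auto
  then have "sqrt (h * (cmod (v n))\<^sup>2) \<le> l2norm h v" by (simp add: l2norm_def)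
  then show ?thesis by (simp add: real_sqrt_mult)
qed

text \<open>The mean-square norm of the difference quotient controls all components at once; this
  uniformity in \<open>n\<close> is what the bound on compact time intervals needs.\<close>

lemma C1_l2_quotient_bound:
  assumes h: "h > 0" and C: "C1_l2 h u u'" and t: "0 \<le> t" and d: "d > 0"
  shows "\<forall>\<^sub>F \<tau> in at t within {0..}. \<forall>n. cmod ((u \<tau> n - u t n) / complex_of_real (\<tau> - t) - u' t n) < d"
proof -
  let ?q = "\<lambda>\<tau> n. (u \<tau> n - u t n) / complex_of_real (\<tau> - t) - u' t n"
  have lim: "((\<lambda>\<tau>. l2norm h (?q \<tau>)) \<longlongrightarrow> 0) (at t within {0..})"
    using C t by (simp add: C1_l2_def)
  have "0 < sqrt h * d" using h d by simp
  from order_tendstoD(2)[OF lim this]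
  have ev: "\<forall>\<^sub>F \<tau> in at t within {0..}. l2norm h (?q \<tau>) < sqrt h * d" .
  moreover have "\<forall>\<^sub>F \<tau> in at t within {0..}. \<tau> \<in> {0..}" by (simp add: eventually_at_filter)
  ultimately show ?thesis
  proof eventually_elim
    case (elim \<tau>)
    \<comment> \<open>Membership has to be secured before the norm says anything:
      \<open>l2norm\<close> of a sequence that is not square summable is 0, from the default value
      of the infinite sum.\<close>
    have "?q \<tau> \<in> l2_seq"
      using C t elim by (intro l2_seq_diff l2_seq_divide) (auto simp: C1_l2_def)
    from cmod_le_l2norm[OF h this] elim(1) have "sqrt h * cmod (?q \<tau> n) < sqrt h * d" for n
      by (rule order.strict_trans1)
    then show ?case using h by simp
  qed
qed

lemma C1_l2_has_vector_derivative:
  assumes h: "h > 0" and C: "C1_l2 h u u'" and t: "0 \<le> t"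
  shows "((\<lambda>t. u t n) has_vector_derivative u' t n) (at t within {0..})"
  unfolding has_vector_derivative_quotient tendsto_iff dist_norm
proof (intro allI impI)
  fix d :: real assume "d > 0"
  from C1_l2_quotient_bound[OF h C t this]
  show "\<forall>\<^sub>F \<tau> in at t within {0..}. norm ((u \<tau> n - u t n) /\<^sub>R (\<tau> - t) - u' t n - 0) < d"
    by eventually_elim (simp add: scaleR_conv_of_real divide_inverse mult.commute)
qed

text \<open>Near each time the difference quotient bounds all components uniformly, and finitely
  many such neighbourhoods cover the compact interval. This is the a priori bound from which the
  uniqueness iteration starts.\<close>

lemma C1_l2_bounded:
  assumes h: "h > 0" and C: "C1_l2 h u u'"
  shows "\<exists>B. \<forall>t\<in>{0..T}. \<forall>n. cmod (u t n) \<le> B"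
proof -
  have "\<exists>d B. d > 0 \<and> (\<forall>\<tau>\<in>{0..} \<inter> ball t d. \<forall>n. cmod (u \<tau> n) \<le> B)" if t: "0 \<le> t" for t
  proof -
    have u: "u t \<in> l2_seq" "u' t \<in> l2_seq" using C t by (auto simp: C1_l2_def)
    have bound: "cmod (v n) \<le> l2norm h v / sqrt h" if "v \<in> l2_seq" for v n
      using cmod_le_l2norm[OF h that, of n] h by (simp add: field_simps)
    define B where "B = l2norm h (u t) / sqrt h + (1 + l2norm h (u' t) / sqrt h)"
    obtain d where d: "d > 0" "\<And>\<tau> n. 0 \<le> \<tau> \<Longrightarrow> \<tau> \<noteq> t \<Longrightarrow> dist \<tau> t < d \<Longrightarrow>
        cmod ((u \<tau> n - u t n) / complex_of_real (\<tau> - t) - u' t n) < 1"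
      using C1_l2_quotient_bound[OF h C t zero_less_one] unfolding eventually_at by auto
    have "cmod (u \<tau> n) \<le> B" if \<tau>: "0 \<le> \<tau>" "dist \<tau> t < min d 1" for \<tau> n
    proof (cases "\<tau> = t")
      case True
      have "0 \<le> cmod (u' t n)" by simp
      then have "0 \<le> l2norm h (u' t) / sqrt h" using bound[OF u(2), of n] by linarith
      then show ?thesis using bound[OF u(1), of n] True by (simp add: B_def)
    next
      case False
      let ?q = "(u \<tau> n - u t n) / complex_of_real (\<tau> - t)"
      have "cmod ?q \<le> 1 + cmod (u' t n)"
        using d(2)[OF \<tau>(1) False, of n] \<tau>(2) norm_triangle_ineq2[of ?q "u' t n"] by simp
      moreover have "u \<tau> n - u t n = complex_of_real (\<tau> - t) * ?q" using False by simp
      then have "cmod (u \<tau> n - u t n) = \<bar>\<tau> - t\<bar> * cmod ?q" by (metis norm_mult norm_of_real)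
      moreover have "\<bar>\<tau> - t\<bar> * cmod ?q \<le> 1 * cmod ?q"
        using \<tau>(2) by (intro mult_right_mono) (auto simp: dist_real_def)
      ultimately have "cmod (u \<tau> n) \<le> cmod (u t n) + (1 + cmod (u' t n))"
        using norm_triangle_ineq2[of "u \<tau> n" "u t n"] by linarith
      then show ?thesis using bound[OF u(1), of n] bound[OF u(2), of n] by (simp add: B_def)
    qed
    then show ?thesis using d(1) by (intro exI[of _ "min d 1"] exI[of _ B]) (auto simp: dist_commute)
  qed
  then have "\<forall>t\<in>{0..}. \<exists>d B. d > 0 \<and> (\<forall>\<tau>\<in>{0..} \<inter> ball t d. \<forall>n. cmod (u \<tau> n) \<le> B)" by simp
  from bchoice[OF this] obtain d where
    "\<forall>t\<in>{0..}. \<exists>B. d t > 0 \<and> (\<forall>\<tau>\<in>{0..} \<inter> ball t (d t). \<forall>n. cmod (u \<tau> n) \<le> B)" ..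
  from bchoice[OF this] obtain B where
    "\<forall>t\<in>{0..}. d t > 0 \<and> (\<forall>\<tau>\<in>{0..} \<inter> ball t (d t). \<forall>n. cmod (u \<tau> n) \<le> B t)" ..
  then have dB: "\<And>t. 0 \<le> t \<Longrightarrow> d t > 0" "\<And>t \<tau> n. 0 \<le> t \<Longrightarrow> 0 \<le> \<tau> \<Longrightarrow> \<tau> \<in> ball t (d t) \<Longrightarrow> cmod (u \<tau> n) \<le> B t"
    by auto
  obtain D where D: "D \<subseteq> {0..T}" "finite D" "{0..T} \<subseteq> (\<Union>t\<in>D. ball t (d t))"
  proof (rule compactE_image[of "{0..T}" "{0..T}" "\<lambda>t. ball t (d t)"])
    show "{0..T} \<subseteq> (\<Union>t\<in>{0..T}. ball t (d t))"
    proof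
      fix t assume "t \<in> {0..T}"
      then show "t \<in> (\<Union>t\<in>{0..T}. ball t (d t))" using dB(1)[of t] by (intro UN_I[of t]) auto
    qed
  qed (auto intro: that)
  have "cmod (u t n) \<le> (\<Sum>s\<in>D. \<bar>B s\<bar>)" if t: "t \<in> {0..T}" for t n
  proof -
    obtain s where s: "s \<in> D" "t \<in> ball s (d s)" using D t by blast
    have "0 \<le> s" "0 \<le> t" using s(1) D(1) t by auto
    from dB(2)[OF this s(2)] have "cmod (u t n) \<le> \<bar>B s\<bar>" by (rule order_trans) simp
    also have "\<dots> \<le> (\<Sum>s\<in>D. \<bar>B s\<bar>)" using D(2) s(1) by (intro member_le_sum) auto
    finally show ?thesis .
  qed
  then show ?thesis by blast
qed

section \<open>Inverse discrete transforms and the symbol of the central difference\<close>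

definition idft :: "real \<Rightarrow> (real \<Rightarrow> complex) \<Rightarrow> zseq" where
  "idft h G = (\<lambda>n. complex_of_real (1 / sqrt (2 * pi)) *
     (LINT \<xi>:{-pi/h..pi/h}|lborel. exp (\<i> * complex_of_real (\<xi> * real_of_int n * h)) * G \<xi>))"

lemma truncation_eq_idft: "truncation h f = idft h (fourier_L2 f)"
  by (simp add: truncation_def idft_def)

lemma idft_period_measure:
  assumes [measurable]: "G \<in> borel_measurable borel"
  shows "idft h G n = complex_of_real (1 / sqrt (2 * pi)) *
     (LINT \<xi>|period_measure h. cis (\<xi> * real_of_int n * h) * G \<xi>)"
proof -
  have "(LINT \<xi>|period_measure h. cis (\<xi> * real_of_int n * h) * G \<xi>) =
      (LINT \<xi>:{-pi/h..pi/h}|lborel. cis (\<xi> * real_of_int n * h) * G \<xi>)"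
    by (intro integral_period_measure borel_measurable_times assms)
      (intro borel_measurable_continuous_onI continuous_intros continuous_on_cis)
  then show ?thesis unfolding idft_def cis_conv_exp by simp
qed

lemma measurable_cis_mult [measurable]: "(\<lambda>\<xi>. cis (\<xi> * a * b)) \<in> borel_measurable borel"
  by (intro borel_measurable_continuous_onI continuous_intros continuous_on_cis)

lemma integrable_cis_mult:
  assumes "integrable (period_measure h) G"
  shows "integrable (period_measure h) (\<lambda>\<xi>. cis (\<xi> * a * b) * G \<xi>)"
proof (rule Bochner_Integration.integrable_bound[OF assms])
  have [measurable]: "G \<in> borel_measurable (period_measure h)" using assms by simp
  show "(\<lambda>\<xi>. cis (\<xi> * a * b) * G \<xi>) \<in> borel_measurable (period_measure h)" by measurable
qed (simp add: norm_mult)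

lemma idft_add:
  assumes "integrable (period_measure h) F" "integrable (period_measure h) G"
    and [measurable]: "F \<in> borel_measurable borel" "G \<in> borel_measurable borel"
  shows "idft h (\<lambda>\<xi>. F \<xi> + G \<xi>) n = idft h F n + idft h G n"
  using integrable_cis_mult[OF assms(1)] integrable_cis_mult[OF assms(2)]
  by (simp add: idft_period_measure distrib_left)

lemma idft_cmult:
  assumes [measurable]: "F \<in> borel_measurable borel"
  shows "idft h (\<lambda>\<xi>. c * F \<xi>) n = c * idft h F n"
proof -
  have "(LINT \<xi>|period_measure h. cis (\<xi> * real_of_int n * h) * (c * F \<xi>)) =
    c * (LINT \<xi>|period_measure h. cis (\<xi> * real_of_int n * h) * F \<xi>)"
    by (subst integral_mult_right_zero[symmetric]) (simp add: mult.left_commute)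
  then show ?thesis by (simp add: idft_period_measure)
qed

lemma idft_diff:
  assumes "integrable (period_measure h) F" "integrable (period_measure h) G"
    and [measurable]: "F \<in> borel_measurable borel" "G \<in> borel_measurable borel"
  shows "idft h (\<lambda>\<xi>. F \<xi> - G \<xi>) n = idft h F n - idft h G n"
  using integrable_cis_mult[OF assms(1)] integrable_cis_mult[OF assms(2)]
  by (simp add: idft_period_measure right_diff_distrib)

lemma cmod_idft_le:
  assumes "integrable (period_measure h) G" and [measurable]: "G \<in> borel_measurable borel"
  shows "cmod (idft h G n) \<le> (LINT \<xi>|period_measure h. cmod (G \<xi>))"
proof -
  have "cmod (idft h G n) \<le> 1 / sqrt (2 * pi) * (LINT \<xi>|period_measure h. cmod (G \<xi>))"
    unfolding idft_period_measure[OF assms(2)] norm_mult norm_of_real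
    using integral_norm_bound[of "period_measure h" "\<lambda>\<xi>. cis (\<xi> * real_of_int n * h) * G \<xi>"]
    by (intro mult_mono) (auto simp: norm_mult)
  also have "\<dots> \<le> 1 * (LINT \<xi>|period_measure h. cmod (G \<xi>))"
  proof (intro mult_right_mono)
    have "1 \<le> sqrt (2 * pi)" using pi_gt3 by (simp add: real_le_rsqrt)
    then show "1 / sqrt (2 * pi) \<le> 1" by simp
  qed simp
  finally show ?thesis by simp
qed

definition diff_symbol :: "real \<Rightarrow> real \<Rightarrow> real" where
  "diff_symbol h \<xi> = sin (\<xi> * h) / h"

lemma measurable_diff_symbol [measurable]: "diff_symbol h \<in> borel_measurable borel"
  unfolding diff_symbol_def by measurable

lemma abs_diff_symbol_le:
  assumes "h > 0"
  shows "\<bar>diff_symbol h \<xi>\<bar> \<le> \<bar>\<xi>\<bar>" "\<bar>diff_symbol h \<xi>\<bar> \<le> 1 / h"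
proof -
  have "\<bar>sin (\<xi> * h)\<bar> \<le> \<bar>\<xi> * h\<bar>" by (rule abs_sin_x_le_abs_x)
  then show "\<bar>diff_symbol h \<xi>\<bar> \<le> \<bar>\<xi>\<bar>"
    using assms by (simp add: diff_symbol_def abs_mult field_simps)
  show "\<bar>diff_symbol h \<xi>\<bar> \<le> 1 / h"
    using assms by (simp add: diff_symbol_def divide_right_mono)
qed

lemma central_diff_idft:
  assumes h: "h > 0" and "integrable (period_measure h) G" and [measurable]: "G \<in> borel_measurable borel"
  shows "central_diff h (idft h G) n = idft h (\<lambda>\<xi>. \<i> * diff_symbol h \<xi> * G \<xi>) n"
proof -
  have *: "cis (\<xi> * real_of_int (n + 1) * h) * G \<xi> - cis (\<xi> * real_of_int (n - 1) * h) * G \<xi> =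
      complex_of_real (2 * h) * (cis (\<xi> * real_of_int n * h) * (\<i> * diff_symbol h \<xi> * G \<xi>))" for \<xi>
  proof -
    have c: "cis (\<xi> * real_of_int (n + 1) * h) = cis (\<xi> * real_of_int n * h) * cis (\<xi> * h)"
      "cis (\<xi> * real_of_int (n - 1) * h) = cis (\<xi> * real_of_int n * h) * cis (- (\<xi> * h))"
      by (simp_all add: cis_mult algebra_simps)
    have d: "cis (\<xi> * h) - cis (- (\<xi> * h)) = complex_of_real (2 * h) * (\<i> * diff_symbol h \<xi>)"
      using h by (simp add: complex_eq_iff diff_symbol_def)
    have "cis (\<xi> * real_of_int (n + 1) * h) * G \<xi> - cis (\<xi> * real_of_int (n - 1) * h) * G \<xi> =
        cis (\<xi> * real_of_int n * h) * (cis (\<xi> * h) - cis (- (\<xi> * h))) * G \<xi>"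
      unfolding c by (simp only: left_diff_distrib right_diff_distrib)
    then show ?thesis unfolding d by (simp only: mult_ac)
  qed
  have "(LINT \<xi>|period_measure h. cis (\<xi> * real_of_int (n + 1) * h) * G \<xi>) -
      (LINT \<xi>|period_measure h. cis (\<xi> * real_of_int (n - 1) * h) * G \<xi>) =
      complex_of_real (2 * h) * (LINT \<xi>|period_measure h. cis (\<xi> * real_of_int n * h) * (\<i> * diff_symbol h \<xi> * G \<xi>))"
    unfolding integral_mult_right_zero[symmetric] *[symmetric]
    using integrable_cis_mult[OF assms(2)] by (intro Bochner_Integration.integral_diff[symmetric]) auto
  then show ?thesis
    using h by (simp add: central_diff_def idft_period_measure flip: diff_divide_distrib)
qed

lemma idft_has_vector_derivative:
  assumes "\<And>t \<xi>. 0 \<le> t \<Longrightarrow> ((\<lambda>t. G t \<xi>) has_vector_derivative G' t \<xi>) (at t within {0..})"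
    and int: "\<And>t. 0 \<le> t \<Longrightarrow> integrable (period_measure h) (G t)"
    and meas [measurable]: "\<And>t. G t \<in> borel_measurable borel" "\<And>t. G' t \<in> borel_measurable borel"
    and g: "integrable (period_measure h) g" "\<And>t \<xi>. 0 \<le> t \<Longrightarrow> cmod (G' t \<xi>) \<le> g \<xi>"
    and t: "0 \<le> t"
  shows "((\<lambda>t. idft h (G t) n) has_vector_derivative idft h (G' t) n) (at t within {0..})"
  unfolding idft_period_measure[OF meas(1)] idft_period_measure[OF meas(2)]
proof (intro has_vector_derivative_mult_right has_vector_derivative_integral[OF _ _ _ g(1) _ t])
  show "cmod (cis (\<xi> * real_of_int n * h) * G' t \<xi>) \<le> g \<xi>" if "0 \<le> t" for t \<xi>
    using g(2)[OF that] by (simp add: norm_mult)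
  show "(\<lambda>\<xi>. cis (\<xi> * real_of_int n * h) * G' t \<xi>) \<in> borel_measurable (period_measure h)" if "0 \<le> t" for t
    by measurable
qed (use assms(1) int in \<open>auto intro!: integrable_cis_mult has_vector_derivative_mult_right\<close>)

lemma central_diff_diff:
  "central_diff h (\<lambda>n. v n - w n) n = central_diff h v n - central_diff h w n"
  by (simp add: central_diff_def diff_divide_distrib)

lemma cmod_central_diff_le:
  assumes "h > 0" "\<And>n. cmod (v n) \<le> B"
  shows "cmod (central_diff h v n) \<le> B / h"
proof -
  have "cmod (v (n + 1) - v (n - 1)) \<le> 2 * B"
    using assms(2)[of "n + 1"] assms(2)[of "n - 1"] norm_triangle_ineq4[of "v (n + 1)" "v (n - 1)"] by linarith
  moreover have "cmod (complex_of_real (2 * h)) = 2 * h" using assms(1) by (simp only: norm_of_real)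
  ultimately show ?thesis
    using assms(1) by (simp add: central_diff_def norm_divide divide_le_cancel field_simps)
qed

section \<open>Explicit solutions from the transforms of the initial data\<close>

locale fourier_data =
  fixes h \<epsilon> :: real and r w r0 :: "real \<Rightarrow> complex"
  assumes h: "h > 0" and \<epsilon>: "\<epsilon> > 0"
    and meas [measurable]: "r \<in> borel_measurable borel" "w \<in> borel_measurable borel" "r0 \<in> borel_measurable borel"
    and L2: "L2norm (period_measure h) r < \<top>" "L2norm (period_measure h) w < \<top>" "L2norm (period_measure h) r0 < \<top>"
begin

definition "dens t \<xi> = relax_dens \<epsilon> (diff_symbol h \<xi>) (r \<xi>) (w \<xi>) t"

definition "vel t \<xi> = relax_vel \<epsilon> (diff_symbol h \<xi>) (r \<xi>) (w \<xi>) t"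

definition "heat t \<xi> = exp (- (diff_symbol h \<xi>)\<^sup>2 * t) *\<^sub>R r0 \<xi>"

text \<open>A common envelope for the qualitative steps: integrability, differentiation under the
  integral and uniqueness, with constants that may depend on \<open>h\<close> and
  \<open>\<epsilon>\<close>. The uniform bounds go through \<open>majorant\<close> instead.\<close>

definition "amp \<xi> = cmod (r \<xi>) + \<epsilon> * cmod (w \<xi>) + cmod (r0 \<xi>)"

lemma measurable_dens [measurable]: "dens t \<in> borel_measurable borel" "vel t \<in> borel_measurable borel"
    "heat t \<in> borel_measurable borel" "amp \<in> borel_measurable borel"
  unfolding dens_def[abs_def] vel_def[abs_def] heat_def[abs_def] amp_def[abs_def] by measurable

lemma L2norm_amp: "L2norm (period_measure h) (\<lambda>\<xi>. complex_of_real (amp \<xi>)) < \<top>"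
proof -
  have f: "L2norm (period_measure h) (\<lambda>\<xi>. complex_of_real (cmod (f \<xi>))) = L2norm (period_measure h) f" for f
    by (simp add: L2norm_def)
  have "L2norm (period_measure h) (\<lambda>\<xi>. complex_of_real \<epsilon> * complex_of_real (cmod (w \<xi>))) =
     ennreal \<epsilon> * L2norm (period_measure h) w"
    using \<epsilon> f[of w] by (subst L2norm_cmult) auto
  then have w: "L2norm (period_measure h) (\<lambda>\<xi>. complex_of_real \<epsilon> * complex_of_real (cmod (w \<xi>))) < \<top>"
    using L2 by (simp add: ennreal_mult_less_top)
  have "L2norm (period_measure h) (\<lambda>\<xi>. complex_of_real (cmod (r \<xi>)) + complex_of_real \<epsilon> * complex_of_real (cmod (w \<xi>))) \<le>
      2 * (L2norm (period_measure h) r + L2norm (period_measure h) (\<lambda>\<xi>. complex_of_real \<epsilon> * complex_of_real (cmod (w \<xi>))))"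
    unfolding f[of r, symmetric] by (rule L2norm_add) measurable
  also have "\<dots> < \<top>" using w L2 by (simp add: ennreal_mult_less_top)
  finally have rw: "L2norm (period_measure h) (\<lambda>\<xi>. complex_of_real (cmod (r \<xi>)) + complex_of_real \<epsilon> * complex_of_real (cmod (w \<xi>))) < \<top>" .
  have "L2norm (period_measure h) (\<lambda>\<xi>. (complex_of_real (cmod (r \<xi>)) + complex_of_real \<epsilon> * complex_of_real (cmod (w \<xi>))) + complex_of_real (cmod (r0 \<xi>))) \<le>
      2 * (L2norm (period_measure h) (\<lambda>\<xi>. complex_of_real (cmod (r \<xi>)) + complex_of_real \<epsilon> * complex_of_real (cmod (w \<xi>))) + L2norm (period_measure h) r0)"
    unfolding f[of r0, symmetric] by (rule L2norm_add) measurable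
  also have "\<dots> < \<top>" using rw L2 by (simp add: ennreal_mult_less_top)
  finally show ?thesis by (simp add: amp_def)
qed

lemma L2_of_amp_bound:
  assumes [measurable]: "f \<in> borel_measurable borel" and "0 \<le> c" "\<And>\<xi>. cmod (f \<xi>) \<le> c * amp \<xi>"
  shows "L2norm (period_measure h) f < \<top>" "integrable (period_measure h) f"
proof -
  have "L2norm (period_measure h) f \<le> L2norm (period_measure h) (\<lambda>\<xi>. complex_of_real c * complex_of_real (amp \<xi>))"
    by (intro L2norm_mono_AE AE_I2) (use assms(2,3) in \<open>auto simp flip: of_real_mult intro: order_trans[OF _ abs_ge_self]\<close>)
  also have "\<dots> = ennreal c * L2norm (period_measure h) (\<lambda>\<xi>. complex_of_real (amp \<xi>))"
    using assms(2) by (intro L2norm_cmult) auto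
  also have "\<dots> < \<top>" using L2norm_amp by (simp add: ennreal_mult_less_top)
  finally show fin: "L2norm (period_measure h) f < \<top>" .
  show "integrable (period_measure h) f"
    by (rule integrable_of_L2(1)[OF finite_measure_period_measure[OF h] _ fin]) simp
qed

lemma amp_nonneg: "0 \<le> amp \<xi>" using \<epsilon> by (simp add: amp_def)

lemma integrable_amp: "integrable (period_measure h) amp"
proof -
  have "integrable (period_measure h) (\<lambda>\<xi>. complex_of_real (amp \<xi>))"
    by (rule integrable_of_L2(1)[OF finite_measure_period_measure[OF h] _ L2norm_amp]) simp
  from integrable_norm[OF this] show ?thesis by (simp only: norm_of_real abs_of_nonneg[OF amp_nonneg])
qed

lemma amp_bounds:
  assumes "0 \<le> t"
  shows "cmod (dens t \<xi>) \<le> 1 * amp \<xi>" "cmod (vel t \<xi>) \<le> 1 / \<epsilon> * amp \<xi>" "cmod (heat t \<xi>) \<le> 1 * amp \<xi>"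
proof -
  have le: "cmod (r \<xi>) + \<epsilon> * cmod (w \<xi>) \<le> amp \<xi>" by (simp add: amp_def)
  show "cmod (dens t \<xi>) \<le> 1 * amp \<xi>"
    using relax_bounded(1)[OF \<epsilon> assms, of "diff_symbol h \<xi>" "r \<xi>" "w \<xi>"] le by (simp add: dens_def)
  show "cmod (vel t \<xi>) \<le> 1 / \<epsilon> * amp \<xi>"
    using relax_bounded(2)[OF \<epsilon> assms, of "diff_symbol h \<xi>" "r \<xi>" "w \<xi>"] le \<epsilon>
    by (simp add: vel_def pos_le_divide_eq mult.commute)
  have "cmod (heat t \<xi>) \<le> 1 * cmod (r0 \<xi>)"
    unfolding heat_def norm_scaleR using assms by (intro mult_right_mono) auto
  also have "\<dots> \<le> 1 * amp \<xi>" using \<epsilon> by (simp add: amp_def)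
  finally show "cmod (heat t \<xi>) \<le> 1 * amp \<xi>" .
qed

lemma symbol_mult_bound:
  assumes "cmod z \<le> c * amp \<xi>" "0 \<le> c"
  shows "cmod (\<i> * diff_symbol h \<xi> * z) \<le> c / h * amp \<xi>"
proof -
  have "cmod (\<i> * diff_symbol h \<xi> * z) = \<bar>diff_symbol h \<xi>\<bar> * cmod z" by (simp add: norm_mult)
  also have "\<dots> \<le> 1 / h * (c * amp \<xi>)"
    using abs_diff_symbol_le(2)[OF h, of \<xi>] assms h by (intro mult_mono) auto
  finally show ?thesis by simp
qed

lemma integrable_dens:
  assumes "0 \<le> t"
  shows "integrable (period_measure h) (dens t)" "integrable (period_measure h) (vel t)" "integrable (period_measure h) (heat t)"
  using L2_of_amp_bound(2)[OF _ _ amp_bounds(1)[OF assms]] L2_of_amp_bound(2)[OF _ _ amp_bounds(2)[OF assms]]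
    L2_of_amp_bound(2)[OF _ _ amp_bounds(3)[OF assms]] \<epsilon> by auto


lemma cmod_idft_amp:
  assumes [measurable]: "f \<in> borel_measurable borel" and "0 \<le> c" "\<And>\<xi>. cmod (f \<xi>) \<le> c * amp \<xi>"
  shows "cmod (idft h f n) \<le> c * (LINT \<xi>|period_measure h. amp \<xi>)"
proof -
  have "cmod (idft h f n) \<le> (LINT \<xi>|period_measure h. cmod (f \<xi>))"
    by (intro cmod_idft_le L2_of_amp_bound(2)[OF assms]) measurable
  also have "\<dots> \<le> (LINT \<xi>|period_measure h. c * amp \<xi>)"
    using L2_of_amp_bound(2)[OF assms] integrable_amp assms(3) by (intro integral_mono) auto
  finally show ?thesis by simp
qed

text \<open>On a fixed grid the central difference is bounded by \<open>1 / h\<close>, so the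
  deviation of any solution from the explicit formula solves a bounded linear system with zero
  initial data. The size of that bound is irrelevant to uniqueness.\<close>

lemma relaxation_solution_eq_idft:
  assumes sol: "relaxation_solution h \<epsilon> (idft h r) (idft h w) \<rho> u" and t: "0 \<le> t"
  shows "\<rho> t n = idft h (dens t) n" "u t n = idft h (vel t) n"
proof -
  from sol obtain \<rho>' u' where C: "C1_l2 h \<rho> \<rho>'" "C1_l2 h u u'"
    and eqs: "\<And>t n. 0 \<le> t \<Longrightarrow> \<rho>' t n + central_diff h (u t) n = 0"
      "\<And>t n. 0 \<le> t \<Longrightarrow> complex_of_real (\<epsilon>\<^sup>2) * u' t n + central_diff h (\<rho> t) n + u t n = 0"
    and init: "\<rho> 0 = idft h r" "u 0 = idft h w"
    unfolding relaxation_solution_def by blast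
  define dens' where "dens' t \<xi> = - \<i> * diff_symbol h \<xi> * vel t \<xi>" for t \<xi>
  define vel' where "vel' t \<xi> = - (\<i> * diff_symbol h \<xi> * dens t \<xi> + vel t \<xi>) / \<epsilon>\<^sup>2" for t \<xi>
  have [measurable]: "dens' t \<in> borel_measurable borel" "vel' t \<in> borel_measurable borel" for t
    unfolding dens'_def[abs_def] vel'_def[abs_def] by measurable
  have dens'_le: "cmod (dens' t \<xi>) \<le> 1 / \<epsilon> / h * amp \<xi>" if "0 \<le> t" for t \<xi>
    using symbol_mult_bound[OF amp_bounds(2)[OF that, of \<xi>]] \<epsilon> by (simp add: dens'_def norm_mult)
  have vel'_le: "cmod (vel' t \<xi>) \<le> (1 / h + 1 / \<epsilon>) / \<epsilon>\<^sup>2 * amp \<xi>" if "0 \<le> t" for t \<xi>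
  proof -
    have "cmod (\<i> * diff_symbol h \<xi> * dens t \<xi> + vel t \<xi>) \<le> 1 / h * amp \<xi> + 1 / \<epsilon> * amp \<xi>"
      using symbol_mult_bound[OF amp_bounds(1)[OF that, of \<xi>]] amp_bounds(2)[OF that, of \<xi>]
      by (intro norm_triangle_le add_mono) auto
    then have "cmod (\<i> * diff_symbol h \<xi> * dens t \<xi> + vel t \<xi>) / \<epsilon>\<^sup>2 \<le> (1 / h * amp \<xi> + 1 / \<epsilon> * amp \<xi>) / \<epsilon>\<^sup>2"
      by (rule divide_right_mono) simp
    moreover have "cmod (vel' t \<xi>) = cmod (\<i> * diff_symbol h \<xi> * dens t \<xi> + vel t \<xi>) / \<epsilon>\<^sup>2"
      unfolding vel'_def norm_divide norm_minus_cancel by (simp add: norm_power)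
    ultimately show ?thesis by (simp add: distrib_right add_divide_distrib)
  qed
  have dens_der: "((\<lambda>t. idft h (dens t) n) has_vector_derivative - central_diff h (idft h (vel t)) n) (at t within {0..})"
    if t: "0 \<le> t" for t n
  proof -
    have "((\<lambda>t. idft h (dens t) n) has_vector_derivative idft h (dens' t) n) (at t within {0..})"
    proof (rule idft_has_vector_derivative[where g = "\<lambda>\<xi>. 1 / \<epsilon> / h * amp \<xi>"])
      show "((\<lambda>t. dens t \<xi>) has_vector_derivative dens' t \<xi>) (at t within {0..})" for t \<xi>
        unfolding dens_def dens'_def vel_def by (rule has_vector_derivative_at_within[OF relax_deriv(1)[OF \<epsilon>]])
    qed (use integrable_dens integrable_amp dens'_le t in auto)
    moreover have "idft h (dens' t) n = - central_diff h (idft h (vel t)) n"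
    proof -
      have "dens' t = (\<lambda>\<xi>. (- 1) * (\<i> * diff_symbol h \<xi> * vel t \<xi>))" by (rule ext) (simp add: dens'_def)
      then have "idft h (dens' t) n = - 1 * idft h (\<lambda>\<xi>. \<i> * diff_symbol h \<xi> * vel t \<xi>) n"
        by (simp only:) (rule idft_cmult, measurable)
      then show ?thesis using central_diff_idft[OF h integrable_dens(2)[OF t]] by simp
    qed
    ultimately show ?thesis by simp
  qed
  have vel_der: "((\<lambda>t. idft h (vel t) n) has_vector_derivative
      - (central_diff h (idft h (dens t)) n + idft h (vel t) n) / \<epsilon>\<^sup>2) (at t within {0..})"
    if t: "0 \<le> t" for t n
  proof -
    have "((\<lambda>t. idft h (vel t) n) has_vector_derivative idft h (vel' t) n) (at t within {0..})"
    proof (rule idft_has_vector_derivative[where g = "\<lambda>\<xi>. (1 / h + 1 / \<epsilon>) / \<epsilon>\<^sup>2 * amp \<xi>"])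
      show "((\<lambda>t. vel t \<xi>) has_vector_derivative vel' t \<xi>) (at t within {0..})" for t \<xi>
        unfolding dens_def vel'_def vel_def by (rule has_vector_derivative_at_within[OF relax_deriv(2)[OF \<epsilon>]])
    qed (use integrable_dens integrable_amp vel'_le t in auto)
    moreover have "idft h (vel' t) n = - (central_diff h (idft h (dens t)) n + idft h (vel t) n) / \<epsilon>\<^sup>2"
    proof -
      have i: "integrable (period_measure h) (\<lambda>\<xi>. \<i> * diff_symbol h \<xi> * dens t \<xi>)"
        by (rule L2_of_amp_bound(2)[where c = "1 / h"]) (use h symbol_mult_bound[OF amp_bounds(1)[OF t]] in auto)
      have "vel' t = (\<lambda>\<xi>. (- 1 / \<epsilon>\<^sup>2) * (\<i> * diff_symbol h \<xi> * dens t \<xi> + vel t \<xi>))"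
        by (rule ext) (simp add: vel'_def del: minus_add_distrib)
      then have "idft h (vel' t) n = - 1 / \<epsilon>\<^sup>2 * idft h (\<lambda>\<xi>. \<i> * diff_symbol h \<xi> * dens t \<xi> + vel t \<xi>) n"
        by (simp only:) (rule idft_cmult, measurable)
      then show ?thesis
        using central_diff_idft[OF h integrable_dens(1)[OF t]] idft_add[OF i integrable_dens(2)[OF t]] by (simp del: minus_add_distrib)
    qed
    ultimately show ?thesis by simp
  qed
  \<comment> \<open>The Boolean selects density or velocity, turning the pair of sequences into the
    single indexed family that \<open>bounded_linear_system_unique\<close> expects.\<close>
  define e :: "real \<Rightarrow> bool \<times> int \<Rightarrow> complex" where
    "e t i = (if fst i then \<rho> t (snd i) - idft h (dens t) (snd i) else u t (snd i) - idft h (vel t) (snd i))" for t i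
  define e' :: "real \<Rightarrow> bool \<times> int \<Rightarrow> complex" where
    "e' t i = (if fst i then - central_diff h (\<lambda>n. e t (False, n)) (snd i)
      else - (central_diff h (\<lambda>n. e t (True, n)) (snd i) + e t (False, snd i)) / \<epsilon>\<^sup>2)" for t i
  have "e t i = 0" for i
  proof (rule bounded_linear_system_unique[where e' = e' and L = "1 / h + (1 / h + 1) / \<epsilon>\<^sup>2"])
    fix t :: real and i :: "bool \<times> int" assume t: "0 \<le> t"
    show "((\<lambda>t. e t i) has_vector_derivative e' t i) (at t within {0..})"
    proof (cases "fst i")
      case True
      have "\<rho>' t (snd i) = - central_diff h (u t) (snd i)" using eqs(1)[OF t, of "snd i"] by (simp add: eq_neg_iff_add_eq_0)
      with has_vector_derivative_diff[OF C1_l2_has_vector_derivative[OF h C(1) t, of "snd i"] dens_der[OF t, of "snd i"]] True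
      show ?thesis by (simp add: e_def e'_def central_diff_diff)
    next
      case False
      have "u' t (snd i) = - (central_diff h (\<rho> t) (snd i) + u t (snd i)) / \<epsilon>\<^sup>2"
        using eqs(2)[OF t, of "snd i"] \<epsilon> by (simp add: field_simps add_eq_0_iff)
      with has_vector_derivative_diff[OF C1_l2_has_vector_derivative[OF h C(2) t, of "snd i"] vel_der[OF t, of "snd i"]] False
      show ?thesis by (simp add: e_def e'_def central_diff_diff diff_divide_distrib add_divide_distrib algebra_simps)
    qed
  next
    fix t B and i :: "bool \<times> int" assume t: "0 \<le> t" and B: "\<And>j. cmod (e t j) \<le> B"
    have B0: "0 \<le> B" using B[of undefined] norm_ge_zero order_trans by blast
    have cd: "cmod (central_diff h (\<lambda>n. e t (b, n)) k) \<le> B / h" for b k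
      by (rule cmod_central_diff_le[OF h B])
    have "cmod (e' t i) \<le> B / h + (B / h + B) / \<epsilon>\<^sup>2"
    proof (cases "fst i")
      case True
      have "0 \<le> (B / h + B) / \<epsilon>\<^sup>2" using B0 h by simp
      with True cd[of False "snd i"] show ?thesis by (simp add: e'_def)
    next
      case False
      have "cmod (central_diff h (\<lambda>n. e t (True, n)) (snd i) + e t (False, snd i)) \<le> B / h + B"
        using cd B by (intro norm_triangle_le add_mono)
      then have "cmod (e' t i) \<le> (B / h + B) / \<epsilon>\<^sup>2"
        using False by (simp add: e'_def norm_divide norm_power divide_right_mono norm_minus_commute del: minus_add_distrib)
      moreover have "0 \<le> B / h" using B0 h by simp
      ultimately show ?thesis by linarith
    qed
    then show "cmod (e' t i) \<le> (1 / h + (1 / h + 1) / \<epsilon>\<^sup>2) * B" by (simp add: algebra_simps add_divide_distrib)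
  next
    fix T :: real
    obtain B1 where B1: "\<forall>t\<in>{0..T}. \<forall>n. cmod (\<rho> t n) \<le> B1" using C1_l2_bounded[OF h C(1)] by blast
    obtain B2 where B2: "\<forall>t\<in>{0..T}. \<forall>n. cmod (u t n) \<le> B2" using C1_l2_bounded[OF h C(2)] by blast
    define I where "I = (LINT \<xi>|period_measure h. amp \<xi>)"
    have I0: "0 \<le> I" unfolding I_def by (rule Bochner_Integration.integral_nonneg) (simp add: amp_nonneg)
    show "\<exists>B. \<forall>t\<in>{0..T}. \<forall>i. cmod (e t i) \<le> B"
    proof (intro exI[of _ "\<bar>B1\<bar> + \<bar>B2\<bar> + I + 1 / \<epsilon> * I"] ballI allI)
      fix t i assume t: "t \<in> {0..T}"
      then have t0: "0 \<le> t" by simp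
      have "cmod (idft h (dens t) k) \<le> 1 * I" for k
        unfolding I_def by (rule cmod_idft_amp[OF _ _ amp_bounds(1)[OF t0]]) auto
      moreover have "cmod (idft h (vel t) k) \<le> 1 / \<epsilon> * I" for k
        unfolding I_def by (rule cmod_idft_amp[OF _ _ amp_bounds(2)[OF t0]]) (use \<epsilon> in auto)
      moreover have "cmod (\<rho> t k) \<le> B1" "cmod (u t k) \<le> B2" for k using B1 B2 t by auto
      moreover have "0 \<le> 1 / \<epsilon> * I" using I0 \<epsilon> by simp
      ultimately have "cmod (\<rho> t k) + cmod (idft h (dens t) k) \<le> \<bar>B1\<bar> + \<bar>B2\<bar> + I + 1 / \<epsilon> * I"
        "cmod (u t k) + cmod (idft h (vel t) k) \<le> \<bar>B1\<bar> + \<bar>B2\<bar> + I + 1 / \<epsilon> * I" for k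
        using I0 by (smt (verit, ccfv_threshold))+
      then show "cmod (e t i) \<le> \<bar>B1\<bar> + \<bar>B2\<bar> + I + 1 / \<epsilon> * I"
        unfolding e_def by (auto intro: order_trans[OF norm_triangle_ineq4])
    qed
  next
    fix i
    have "dens 0 = r" "vel 0 = w" using relax_0[OF \<epsilon>] by (auto simp: dens_def vel_def)
    then show "e 0 i = 0" by (simp add: e_def init)
  qed (use h t in auto)
  from this[of "(True, n)"] this[of "(False, n)"]
  show "\<rho> t n = idft h (dens t) n" "u t n = idft h (vel t) n" by (simp_all add: e_def)
qed

lemma heat_solution_eq_idft:
  assumes sol: "heat_solution h (idft h r0) \<rho>" and t: "0 \<le> t"
  shows "\<rho> t n = idft h (heat t) n"
proof -
  from sol obtain \<rho>' where C: "C1_l2 h \<rho> \<rho>'"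
    and eqs: "\<And>t n. 0 \<le> t \<Longrightarrow> \<rho>' t n - central_diff h (central_diff h (\<rho> t)) n = 0"
    and init: "\<rho> 0 = idft h r0"
    unfolding heat_solution_def by blast
  define heat1 where "heat1 t \<xi> = \<i> * diff_symbol h \<xi> * heat t \<xi>" for t \<xi>
  define heat' where "heat' t \<xi> = \<i> * diff_symbol h \<xi> * heat1 t \<xi>" for t \<xi>
  have [measurable]: "heat1 t \<in> borel_measurable borel" "heat' t \<in> borel_measurable borel" for t
    unfolding heat1_def[abs_def] heat'_def[abs_def] by measurable
  have heat1_le: "cmod (heat1 t \<xi>) \<le> 1 / h * amp \<xi>" if "0 \<le> t" for t \<xi>
    unfolding heat1_def by (rule symbol_mult_bound[OF amp_bounds(3)[OF that]]) simp
  have heat'_le: "cmod (heat' t \<xi>) \<le> 1 / h / h * amp \<xi>" if "0 \<le> t" for t \<xi>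
    unfolding heat'_def by (rule symbol_mult_bound[OF heat1_le[OF that]]) (use h in simp)
  have cdcd: "central_diff h (central_diff h (idft h (heat t))) n = idft h (heat' t) n" if "0 \<le> t" for t n
  proof -
    have "central_diff h (idft h (heat t)) = idft h (heat1 t)"
      using central_diff_idft[OF h integrable_dens(3)[OF that]] by (simp add: heat1_def[abs_def] fun_eq_iff)
    moreover have "central_diff h (idft h (heat1 t)) n = idft h (heat' t) n"
      unfolding heat'_def[abs_def]
      by (rule central_diff_idft[OF h L2_of_amp_bound(2)[OF _ _ heat1_le[OF that]]]) (use h in auto)
    ultimately show ?thesis by simp
  qed
  have heat_der: "((\<lambda>t. idft h (heat t) n) has_vector_derivative central_diff h (central_diff h (idft h (heat t))) n) (at t within {0..})"
    if t: "0 \<le> t" for t n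
    unfolding cdcd[OF t]
  proof (rule idft_has_vector_derivative[where g = "\<lambda>\<xi>. 1 / h / h * amp \<xi>"])
    fix t \<xi>
    have "((\<lambda>t. exp (- (diff_symbol h \<xi>)\<^sup>2 * t)) has_vector_derivative (- (diff_symbol h \<xi>)\<^sup>2) * exp (- (diff_symbol h \<xi>)\<^sup>2 * t)) (at t)"
      unfolding has_real_derivative_iff_has_vector_derivative[symmetric] by (auto intro!: derivative_eq_intros)
    then have "((\<lambda>t. heat t \<xi>) has_vector_derivative ((- (diff_symbol h \<xi>)\<^sup>2) * exp (- (diff_symbol h \<xi>)\<^sup>2 * t)) *\<^sub>R r0 \<xi>) (at t)"
      unfolding heat_def by (auto intro!: derivative_eq_intros)
    moreover have "((- (diff_symbol h \<xi>)\<^sup>2) * exp (- (diff_symbol h \<xi>)\<^sup>2 * t)) *\<^sub>R r0 \<xi> = heat' t \<xi>"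
      by (simp add: heat'_def heat1_def heat_def scaleR_conv_of_real power2_eq_square mult_ac)
    ultimately show "((\<lambda>t. heat t \<xi>) has_vector_derivative heat' t \<xi>) (at t within {0..})"
      by (simp add: has_vector_derivative_at_within)
  qed (use integrable_dens integrable_amp heat'_le t in auto)
  define e where "e t n = \<rho> t n - idft h (heat t) n" for t n
  have "e t n = 0"
  proof (rule bounded_linear_system_unique[where e' = "\<lambda>t. central_diff h (central_diff h (e t))" and L = "1 / h / h"])
    fix t :: real and n assume t: "0 \<le> t"
    have "\<rho>' t n = central_diff h (central_diff h (\<rho> t)) n" using eqs[OF t, of n] by simp
    moreover have "central_diff h (central_diff h (e t)) n =
        central_diff h (central_diff h (\<rho> t)) n - central_diff h (central_diff h (idft h (heat t))) n"
      unfolding e_def[abs_def] by (simp add: central_diff_diff[abs_def])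
    ultimately show "((\<lambda>t. e t n) has_vector_derivative central_diff h (central_diff h (e t)) n) (at t within {0..})"
      using has_vector_derivative_diff[OF C1_l2_has_vector_derivative[OF h C t, of n] heat_der[OF t, of n]]
      by (simp add: e_def)
  next
    fix t B n assume "\<And>j. cmod (e t j) \<le> B"
    then show "cmod (central_diff h (central_diff h (e t)) n) \<le> 1 / h / h * B"
      using cmod_central_diff_le[OF h, of "central_diff h (e t)" "B / h" n] cmod_central_diff_le[OF h, of "e t" B] by simp
  next
    fix T :: real
    obtain B1 where B1: "\<forall>t\<in>{0..T}. \<forall>n. cmod (\<rho> t n) \<le> B1" using C1_l2_bounded[OF h C] by blast
    show "\<exists>B. \<forall>t\<in>{0..T}. \<forall>i. cmod (e t i) \<le> B"
    proof (intro exI[of _ "B1 + 1 * (LINT \<xi>|period_measure h. amp \<xi>)"] ballI allI)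
      fix t i assume t: "t \<in> {0..T}"
      have "cmod (idft h (heat t) i) \<le> 1 * (LINT \<xi>|period_measure h. amp \<xi>)"
        by (rule cmod_idft_amp[OF _ _ amp_bounds(3)]) (use t in auto)
      moreover have "cmod (\<rho> t i) \<le> B1" using B1 t by auto
      ultimately show "cmod (e t i) \<le> B1 + 1 * (LINT \<xi>|period_measure h. amp \<xi>)"
        unfolding e_def by (intro order_trans[OF norm_triangle_ineq4] add_mono)
    qed
  next
    fix i
    have "heat 0 = r0" by (auto simp: heat_def)
    then show "e 0 i = 0" by (simp add: e_def init)
  qed (use h t in auto)
  then show ?thesis by (simp add: e_def)
qed

end

subsection \<open>Norms of inverse transforms\<close>

text \<open>The chosen transform and \<open>F\<close> are mean-square limits of the same partial
  sums, hence agree almost everywhere on the period, and the norm can be computed with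
  \<open>F\<close>.\<close>

lemma hdot_norm_idft:
  assumes h: "h > 0" and [measurable]: "F \<in> borel_measurable borel"
    and fin: "L2norm (period_measure h) F < \<top>"
  shows "hdot_norm h \<kappa> (idft h F) =
    L2norm (period_measure h) (\<lambda>\<xi>. F \<xi> * complex_of_real (\<bar>diff_symbol h \<xi>\<bar> powr \<kappa>))"
proof -
  define D where "D = dft h (idft h F)"
  have F: "has_dft h (idft h F) F"
    unfolding idft_def by (rule has_dft_fourier_coefficients) fact+
  then have D: "has_dft h (idft h F) D" unfolding D_def dft_def by (rule someI[of "has_dft h (idft h F)"])
  then have [measurable]: "D \<in> borel_measurable borel" by (simp add: has_dft_def)
  let ?S = "\<lambda>(N::nat) \<xi>. complex_of_real (h / sqrt (2 * pi)) *
          (\<Sum>n = - int N..int N. exp (- \<i> * complex_of_real (\<xi> * real_of_int n * h)) * idft h F n)"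
  have [measurable]: "?S N \<in> borel_measurable borel" for N
    by (intro borel_measurable_continuous_onI continuous_intros)
  have restrict: "L2norm (restrict_space lborel {-pi/h..pi/h}) (\<lambda>\<xi>. G \<xi> - ?S N \<xi>) =
      L2norm (period_measure h) (\<lambda>\<xi>. G \<xi> - ?S N \<xi>)" if [measurable]: "G \<in> borel_measurable borel" for G N
    by (rule L2norm_restrict_closed) measurable
  have AE: "AE \<xi> in period_measure h. D \<xi> = F \<xi>"
  proof (rule L2norm_limit_unique_AE[where f = ?S and U = sequentially])
    show "(\<lambda>N. L2norm (period_measure h) (\<lambda>\<xi>. D \<xi> - ?S N \<xi>)) \<longlonglongrightarrow> 0"
      using D unfolding has_dft_def by (subst (asm) restrict) auto
    show "(\<lambda>N. L2norm (period_measure h) (\<lambda>\<xi>. F \<xi> - ?S N \<xi>)) \<longlonglongrightarrow> 0"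
      using F unfolding has_dft_def by (subst (asm) restrict) auto
  qed simp_all
  have "hdot_norm h \<kappa> (idft h F) = L2norm (restrict_space lborel {-pi/h<..<pi/h})
      (\<lambda>\<xi>. D \<xi> * complex_of_real (\<bar>diff_symbol h \<xi>\<bar> powr \<kappa>))"
    by (simp add: hdot_norm_def D_def diff_symbol_def)
  also have "\<dots> = L2norm (period_measure h) (\<lambda>\<xi>. D \<xi> * complex_of_real (\<bar>diff_symbol h \<xi>\<bar> powr \<kappa>))"
    by (rule L2norm_restrict_open) measurable
  also have "\<dots> = L2norm (period_measure h) (\<lambda>\<xi>. F \<xi> * complex_of_real (\<bar>diff_symbol h \<xi>\<bar> powr \<kappa>))"
    by (rule L2norm_cong_AE) (use AE in \<open>eventually_elim, simp\<close>)
  finally show ?thesis .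
qed

lemma linfnorm_idft_le:
  assumes "integrable (period_measure h) F" "F \<in> borel_measurable borel"
  shows "linfnorm (idft h F) \<le> (\<integral>\<^sup>+\<xi>. ennreal (cmod (F \<xi>)) \<partial>period_measure h)"
proof -
  have "ennreal (cmod (idft h F n)) \<le> ennreal (LINT \<xi>|period_measure h. cmod (F \<xi>))" for n
    by (intro ennreal_leI cmod_idft_le assms)
  also have "ennreal (LINT \<xi>|period_measure h. cmod (F \<xi>)) = (\<integral>\<^sup>+\<xi>. ennreal (cmod (F \<xi>)) \<partial>period_measure h)"
    using assms by (simp add: nn_integral_eq_integral)
  finally show ?thesis unfolding linfnorm_def by (intro SUP_least)
qed

lemma nn_integral_period_measure_le:
  assumes "f \<in> borel_measurable borel"
  shows "(\<integral>\<^sup>+x. f x \<partial>period_measure h) \<le> (\<integral>\<^sup>+x. f x \<partial>lborel)"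
  unfolding nn_integral_period_measure[OF assms]
  by (intro nn_integral_mono) (auto simp: indicator_def)

lemma L2norm_period_measure_le:
  assumes [measurable]: "f \<in> borel_measurable borel"
  shows "L2norm (period_measure h) f \<le> L2norm lborel f"
  unfolding L2norm_def by (intro ennreal_sqrt_mono nn_integral_period_measure_le) measurable

section \<open>Sobolev weights (powers of the Japanese bracket) and integrals in time\<close>

definition jweight :: "real \<Rightarrow> real \<Rightarrow> real" where
  "jweight p \<xi> = (1 + \<xi>\<^sup>2) powr (p / 2)"

lemma measurable_jweight [measurable]: "jweight p \<in> borel_measurable borel"
  unfolding jweight_def[abs_def] by measurable

lemma jweight_pos: "0 < jweight p \<xi>"
proof -
  have "1 + \<xi>\<^sup>2 > 0" by (simp add: add_pos_nonneg)
  then show ?thesis by (simp add: jweight_def)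
qed

lemma jweight_mono: "p \<le> q \<Longrightarrow> jweight p \<xi> \<le> jweight q \<xi>"
  unfolding jweight_def by (intro powr_mono) auto

lemma jweight_add: "jweight (p + q) \<xi> = jweight p \<xi> * jweight q \<xi>"
  by (simp add: jweight_def powr_add add_divide_distrib)

lemma jweight_0: "jweight 0 \<xi> = 1"
proof -
  have "1 + \<xi>\<^sup>2 > 0" by (simp add: add_pos_nonneg)
  then show ?thesis by (simp add: jweight_def)
qed

lemma abs_powr_le_jweight:
  assumes "\<bar>x\<bar> \<le> \<bar>\<xi>\<bar>" "0 \<le> p"
  shows "\<bar>x\<bar> powr p \<le> jweight p \<xi>"
proof (cases "x = 0")
  case True
  then show ?thesis using jweight_pos[of p \<xi>] by simp
next
  case False
  have sq: "x\<^sup>2 = \<bar>x\<bar> powr 2" using False by (simp add: powr_numeral)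
  have "\<bar>x\<bar> powr p = (x\<^sup>2) powr (p / 2)" unfolding sq powr_powr by simp
  also have "\<dots> \<le> (1 + \<xi>\<^sup>2) powr (p / 2)"
  proof (rule powr_mono2)
    have "x\<^sup>2 \<le> \<xi>\<^sup>2" using assms(1) by (simp add: abs_le_square_iff)
    then show "x\<^sup>2 \<le> 1 + \<xi>\<^sup>2" by simp
  qed (use assms in auto)
  finally show ?thesis by (simp add: jweight_def)
qed

text \<open>Applied with \<open>p = s' - 2\<close>, this is the origin of the condition
  \<open>s' > 5/2\<close>: the embedding of Sobolev spaces into bounded functions rests on the
  square integrability of the inverse weight.\<close>

lemma L2norm_jweight:
  assumes p: "p > 1/2"
  shows "L2norm lborel (\<lambda>\<xi>. complex_of_real (jweight (- p) \<xi>)) < \<top>"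
proof -
  let ?g = "\<lambda>x::real. ennreal (x powr (- 2 * p)) * indicator {1..} x"
  have "((\<lambda>x. x powr (- 2 * p)) has_integral - (1 powr (- 2 * p + 1)) / (- 2 * p + 1)) {1..}"
    using p by (intro has_integral_powr_to_inf) auto
  from nn_integral_has_integral_lebesgue'[OF _ this]
  have g: "(\<integral>\<^sup>+x. ?g x \<partial>lborel) < \<top>" by simp
  have "(\<integral>\<^sup>+x. ?g x \<partial>lborel) = (\<integral>\<^sup>+x. ?g (- x) \<partial>lborel)"
    using nn_integral_real_affine[of ?g "-1" 0] by simp
  with g have g': "(\<integral>\<^sup>+x. ?g (- x) \<partial>lborel) < \<top>" by simp
  have le: "ennreal ((cmod (complex_of_real (jweight (- p) x)))\<^sup>2) \<le> indicator {-1..1} x + (?g x + ?g (- x))" for x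
  proof -
    have pos: "1 + x\<^sup>2 > 0" by (simp add: add_pos_nonneg)
    have sq: "(cmod (complex_of_real (jweight (- p) x)))\<^sup>2 = jweight (- 2 * p) x"
      using jweight_add[of "- p" "- p" x] jweight_pos[of "- p" x] by (simp add: power2_eq_square)
    consider "\<bar>x\<bar> \<le> 1" | "x > 1" | "x < -1" by linarith
    then show ?thesis
    proof cases
      case 1
      have "jweight (- 2 * p) x \<le> 1"
        using jweight_mono[of "- 2 * p" 0 x] p by (simp add: jweight_0)
      moreover have "x \<in> {-1..1}" using 1 by auto
      ultimately show ?thesis unfolding sq by (simp add: add_increasing2)
    next
      case 2
      have "jweight (- 2 * p) x \<le> (x\<^sup>2) powr (- p)"
        unfolding jweight_def using 2 p by (simp add: powr_mono2')
      also have "\<dots> = x powr (- 2 * p)" using 2 by (simp flip: powr_numeral add: powr_powr)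
      finally show ?thesis unfolding sq using 2 by (simp add: add_increasing ennreal_leI)
    next
      case 3
      have "jweight (- 2 * p) x \<le> ((- x)\<^sup>2) powr (- p)"
        unfolding jweight_def using 3 p by (simp add: powr_mono2')
      also have "\<dots> = (- x) powr (- 2 * p)" using 3 by (simp flip: powr_numeral add: powr_powr del: power2_minus)
      finally show ?thesis unfolding sq using 3 by (simp add: add_increasing ennreal_leI)
    qed
  qed
  have "(\<integral>\<^sup>+x. ennreal ((cmod (complex_of_real (jweight (- p) x)))\<^sup>2) \<partial>lborel)
      \<le> (\<integral>\<^sup>+x. indicator {-1..1} x + (?g x + ?g (- x)) \<partial>(lborel::real measure))"
    by (intro nn_integral_mono le)
  also have "\<dots> = (\<integral>\<^sup>+x. indicator {-1..1::real} x \<partial>lborel) + ((\<integral>\<^sup>+x. ?g x \<partial>lborel) + (\<integral>\<^sup>+x. ?g (- x) \<partial>lborel))"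
  proof -
    have m: "(\<lambda>x. indicator {-1..1::real} x :: ennreal) \<in> borel_measurable lborel"
      "?g \<in> borel_measurable lborel" "(\<lambda>x. ?g (- x)) \<in> borel_measurable lborel" by measurable
    show ?thesis
      unfolding nn_integral_add[OF m(1) borel_measurable_add[OF m(2,3)]] nn_integral_add[OF m(2,3)] ..
  qed
  also have "\<dots> < \<top>" using g g' by simp
  finally show ?thesis by (simp add: L2norm_less_top_iff)
qed

lemma nn_integral_le_L2norm:
  assumes [measurable]: "f \<in> borel_measurable M" "g \<in> borel_measurable M"
  shows "(\<integral>\<^sup>+x. ennreal (cmod (f x) * cmod (g x)) \<partial>M) \<le> L2norm M f * L2norm M g"
proof (subst power2_mono_ennreal)
  have "(\<integral>\<^sup>+x. ennreal (cmod (f x)) * ennreal (cmod (g x)) \<partial>M)\<^sup>2 \<le>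
      (\<integral>\<^sup>+x. (ennreal (cmod (f x)))\<^sup>2 \<partial>M) * (\<integral>\<^sup>+x. (ennreal (cmod (g x)))\<^sup>2 \<partial>M)"
    by (rule Cauchy_Schwarz_nn_integral) measurable
  then show "(\<integral>\<^sup>+x. ennreal (cmod (f x) * cmod (g x)) \<partial>M)\<^sup>2 \<le> (L2norm M f * L2norm M g)\<^sup>2"
    by (simp add: power_mult_distrib L2norm_power2 ennreal_power ennreal_mult)
qed

text \<open>The layer term integrates to at most \<open>40 * \<epsilon>\<^sup>2\<close> and so gains
  the full order without a small prefactor, whereas the algebraic singularity brings no smallness
  and must carry its own \<open>\<epsilon>\<^sup>2\<close>.\<close>

lemma nn_integral_time_weight:
  assumes "0 < T" "0 < \<epsilon>" "0 < \<theta>" "0 \<le> A" "0 \<le> B"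
  shows "(\<integral>\<^sup>+t. ennreal (A * exp (- t / (40 * \<epsilon>\<^sup>2)) + B * \<epsilon>\<^sup>2 * t powr (\<theta> - 1)) \<partial>restrict_space lborel {0<..<T})
    \<le> ennreal ((40 * A + B * (T powr \<theta> / \<theta>)) * \<epsilon>\<^sup>2)"
proof -
  let ?f = "\<lambda>t. A * exp (- t / (40 * \<epsilon>\<^sup>2)) + B * \<epsilon>\<^sup>2 * t powr (\<theta> - 1)"
  let ?F = "\<lambda>t. - (40 * \<epsilon>\<^sup>2) * exp (- t / (40 * \<epsilon>\<^sup>2))"
  have "((\<lambda>t. exp (- t / (40 * \<epsilon>\<^sup>2))) has_integral ?F T - ?F 0) {0..T}"
  proof (rule fundamental_theorem_of_calculus)
    fix t
    have "(?F has_real_derivative - (40 * \<epsilon>\<^sup>2) * (exp (- t / (40 * \<epsilon>\<^sup>2)) * (- 1 / (40 * \<epsilon>\<^sup>2)))) (at t)"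
      by (intro DERIV_cmult DERIV_fun_exp DERIV_cdivide DERIV_minus DERIV_ident)
    moreover have "- (40 * \<epsilon>\<^sup>2) * (exp (- t / (40 * \<epsilon>\<^sup>2)) * (- 1 / (40 * \<epsilon>\<^sup>2))) = exp (- t / (40 * \<epsilon>\<^sup>2))"
      using assms(2) by simp
    ultimately have "(?F has_vector_derivative exp (- t / (40 * \<epsilon>\<^sup>2))) (at t)"
      by (simp only: has_real_derivative_iff_has_vector_derivative)
    then show "(?F has_vector_derivative exp (- t / (40 * \<epsilon>\<^sup>2))) (at t within {0..T})"
      by (rule has_vector_derivative_at_within)
  qed (use assms in simp)
  moreover have "((\<lambda>t. t powr (\<theta> - 1)) has_integral T powr (\<theta> - 1 + 1) / (\<theta> - 1 + 1)) {0..T}"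
    using assms by (intro has_integral_powr_from_0) auto
  ultimately have "(?f has_integral A * (?F T - ?F 0) + B * \<epsilon>\<^sup>2 * (T powr (\<theta> - 1 + 1) / (\<theta> - 1 + 1))) {0..T}"
    by (intro has_integral_add has_integral_mult_right)
  from nn_integral_has_integral_lebesgue'[OF _ this] assms
  have int: "(\<integral>\<^sup>+t. ennreal (?f t) * indicator {0..T} t \<partial>lborel) =
      ennreal (A * (?F T - ?F 0) + B * \<epsilon>\<^sup>2 * (T powr \<theta> / \<theta>))" by simp
  have "(\<integral>\<^sup>+t. ennreal (?f t) \<partial>restrict_space lborel {0<..<T}) = (\<integral>\<^sup>+t. ennreal (?f t) * indicator {0<..<T} t \<partial>lborel)"
    by (simp add: nn_integral_restrict_space)
  also have "\<dots> \<le> (\<integral>\<^sup>+t. ennreal (?f t) * indicator {0..T} t \<partial>lborel)"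
    by (intro nn_integral_mono) (auto simp: indicator_def)
  also note int
  also have "ennreal (A * (?F T - ?F 0) + B * \<epsilon>\<^sup>2 * (T powr \<theta> / \<theta>)) \<le> ennreal ((40 * A + B * (T powr \<theta> / \<theta>)) * \<epsilon>\<^sup>2)"
  proof (rule ennreal_leI)
    have "?F T - ?F 0 \<le> 40 * \<epsilon>\<^sup>2" by simp
    then have "A * (?F T - ?F 0) \<le> A * (40 * \<epsilon>\<^sup>2)" using assms(4) by (rule mult_left_mono)
    then show "A * (?F T - ?F 0) + B * \<epsilon>\<^sup>2 * (T powr \<theta> / \<theta>) \<le> (40 * A + B * (T powr \<theta> / \<theta>)) * \<epsilon>\<^sup>2"
      by (simp add: algebra_simps)
  qed
  finally show ?thesis .
qed

lemma powr_mult_exp_le: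
  fixes x a :: real
  assumes "0 \<le> x" "0 \<le> a" "a \<le> 1"
  shows "x powr a * exp (- x / 2) \<le> 1"
proof -
  have "x powr a \<le> exp (x / 2)"
  proof (cases "x \<le> 1")
    case True
    have "x powr a \<le> 1 powr a" using True assms by (intro powr_mono2) auto
    also have "\<dots> \<le> exp (x / 2)" using assms by simp
    finally show ?thesis .
  next
    case False
    then have "x powr a \<le> x powr 1" using assms by (intro powr_mono) auto
    also have "\<dots> = x" using False by simp
    also have "x \<le> exp (x / 2)"
      using exp_lower_Taylor_quadratic[of "x / 2"] zero_le_power2[of "x / 2 - 1"] assms(1)
      by (simp add: power2_diff)
    finally show ?thesis .
  qed
  then have "x powr a * exp (- x / 2) \<le> exp (x / 2) * exp (- x / 2)" by (intro mult_right_mono) auto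
  then show ?thesis by (simp flip: exp_add)
qed

text \<open>
  The bound is integrable in time down to \<open>t = 0\<close> at the price of the factor
  \<open>m powr (2 - 2 * \<theta>)\<close> instead of \<open>m\<^sup>2\<close>. This is where \<open>s < s'\<close> is needed.
\<close>

lemma parabolic_smoothing:
  fixes m t \<theta> :: real
  assumes "0 < t" "0 \<le> \<theta>" "\<theta> \<le> 1"
  shows "exp (- m\<^sup>2 * t / 2) * \<bar>m\<bar> powr (2 - 2 * \<theta>) \<le> t powr (\<theta> - 1)"
proof (cases "m = 0")
  case False
  have sq: "m\<^sup>2 = \<bar>m\<bar> powr 2" using False by (simp add: powr_numeral)
  have "\<bar>m\<bar> powr (2 - 2 * \<theta>) = (m\<^sup>2) powr (1 - \<theta>)" unfolding sq powr_powr by (simp add: right_diff_distrib)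
  also have "\<dots> = (m\<^sup>2 * t) powr (1 - \<theta>) * t powr (\<theta> - 1)"
    using assms by (simp add: powr_mult flip: powr_add)
  finally have "exp (- m\<^sup>2 * t / 2) * \<bar>m\<bar> powr (2 - 2 * \<theta>) =
      ((m\<^sup>2 * t) powr (1 - \<theta>) * exp (- (m\<^sup>2 * t) / 2)) * t powr (\<theta> - 1)" by simp
  also have "\<dots> \<le> 1 * t powr (\<theta> - 1)"
    using assms by (intro mult_right_mono powr_mult_exp_le) auto
  finally show ?thesis by simp
qed simp

subsection \<open>Error estimates\<close>

context fourier_data
begin

definition "err t \<xi> = dens t \<xi> - heat t \<xi>"

definition "mode t \<xi> = \<i> * diff_symbol h \<xi> * dens t \<xi> + vel t \<xi>"

text \<open>A pointwise version of the data size. The mismatch of the initial densities is divided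
  by \<open>\<epsilon>\<^sup>2\<close>, so that it contributes at most the summand 1 of
  \<open>data_size\<close> and every error bound becomes a factor depending on time and
  \<open>\<epsilon>\<close> times this one function.\<close>

definition "majorant s' \<xi> = jweight (s' - 2) \<xi> * cmod (r0 \<xi> - r \<xi>) / \<epsilon>\<^sup>2 + jweight s' \<xi> * cmod (r \<xi>) +
   \<epsilon> * jweight s' \<xi> * cmod (w \<xi>) + jweight (s' - 1) \<xi> * cmod (w \<xi>)"

lemma measurable_err [measurable]: "err t \<in> borel_measurable borel" "mode t \<in> borel_measurable borel"
    "majorant s' \<in> borel_measurable borel"
  unfolding err_def[abs_def] mode_def[abs_def] majorant_def[abs_def] by measurable

lemma measurable_err_joint:
  "(\<lambda>p. err (fst p) (snd p)) \<in> borel_measurable (lborel \<Otimes>\<^sub>M lborel)"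
  "(\<lambda>p. mode (fst p) (snd p)) \<in> borel_measurable (lborel \<Otimes>\<^sub>M lborel)"
  unfolding err_def mode_def dens_def vel_def heat_def by measurable

lemma err_bound: "0 \<le> t \<Longrightarrow> cmod (err t \<xi>) \<le> 2 * amp \<xi>"
  using amp_bounds(1,3)[of t \<xi>] norm_triangle_ineq4[of "dens t \<xi>" "heat t \<xi>"] by (simp add: err_def)

lemma mode_bound: "0 \<le> t \<Longrightarrow> cmod (mode t \<xi>) \<le> (1 / h + 1 / \<epsilon>) * amp \<xi>"
  unfolding mode_def distrib_right
  using symbol_mult_bound[OF amp_bounds(1)[of t \<xi>]] amp_bounds(2)[of t \<xi>]
  by (intro norm_triangle_le add_mono) auto

lemma jweight_symbol:
  "\<bar>diff_symbol h \<xi>\<bar> * jweight p \<xi> \<le> jweight (p + 1) \<xi>"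
proof -
  have "\<bar>diff_symbol h \<xi>\<bar> \<le> jweight 1 \<xi>"
    using abs_powr_le_jweight[OF abs_diff_symbol_le(1)[OF h], of 1 \<xi>] by simp
  then have "\<bar>diff_symbol h \<xi>\<bar> * jweight p \<xi> \<le> jweight 1 \<xi> * jweight p \<xi>"
    using jweight_pos[of p \<xi>] by (intro mult_right_mono) auto
  then show ?thesis by (simp add: jweight_add mult.commute)
qed

lemma majorant_terms:
  shows "jweight (s' - 2) \<xi> * cmod (r0 \<xi> - r \<xi>) + \<epsilon>\<^sup>2 * (jweight s' \<xi> * cmod (r \<xi>) +
      \<epsilon> * jweight s' \<xi> * cmod (w \<xi>) + jweight (s' - 1) \<xi> * cmod (w \<xi>)) = \<epsilon>\<^sup>2 * majorant s' \<xi>"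
  using \<epsilon> by (simp add: majorant_def distrib_left)

lemma majorant_nonneg: "0 \<le> majorant s' \<xi>"
  unfolding majorant_def using \<epsilon> jweight_pos less_imp_le by (intro add_nonneg_nonneg mult_nonneg_nonneg divide_nonneg_nonneg) auto

text \<open>The weight \<open>\<mu>\<close> stays abstract in order to serve two norms: a power of
  the symbol for the homogeneous norm and \<open>jweight (s' - 2)\<close> for the sup norm. Two
  factors of the symbol then raise the order from \<open>s' - 2\<close> to \<open>s'\<close>,
  exactly what the data provide.\<close>

lemma err_sup_estimate:
  assumes t: "0 \<le> t" and \<mu>: "0 \<le> \<mu>" "\<mu> \<le> jweight (s' - 2) \<xi>"
  shows "\<mu> * cmod (err t \<xi>) \<le> 48 * \<epsilon>\<^sup>2 * majorant s' \<xi>"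
proof -
  define m where "m = diff_symbol h \<xi>"
  define n where "n = \<bar>m\<bar>"
  define x where "x = cmod (r \<xi>)"
  define y where "y = cmod (w \<xi>)"
  define \<alpha> where "\<alpha> = cmod (r0 \<xi> - r \<xi>)"
  define D where "D = exp (- t / (40 * \<epsilon>\<^sup>2))"
  define E where "E = exp (- m\<^sup>2 * t / 2)"
  have pos: "0 \<le> n" "0 \<le> x" "0 \<le> y" "0 \<le> \<alpha>" "n\<^sup>2 = m\<^sup>2" by (auto simp: n_def x_def y_def \<alpha>_def)
  have DE: "0 \<le> D" "D \<le> 1" "0 \<le> E" "E \<le> 1" using t by (auto simp: D_def E_def)
  have "cmod (err t \<xi>) \<le> (if \<epsilon> * n > 1/4 then 2 * D * (x + \<epsilon> * y) else 0) + E * (\<alpha> + 16 * \<epsilon>\<^sup>2 * (n\<^sup>2 * x + n * y))"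
    using relax_minus_heat_bound[OF \<epsilon> t, of m "r \<xi>" "w \<xi>" "r0 \<xi>"]
    unfolding err_def dens_def heat_def m_def n_def x_def y_def \<alpha>_def D_def E_def by (simp only: power2_abs)
  \<comment> \<open>At a fixed time the layer term has no smallness of its own; it is present only
    where \<open>1 \<le> 16 * (\<epsilon>\<^sup>2 * n\<^sup>2)\<close>, and there two derivatives
    pay for \<open>\<epsilon>\<^sup>2\<close>.\<close>
  also have "(if \<epsilon> * n > 1/4 then 2 * D * (x + \<epsilon> * y) else 0) \<le> 32 * \<epsilon>\<^sup>2 * n\<^sup>2 * (x + \<epsilon> * y)"
  proof (cases "\<epsilon> * n > 1/4")
    case True
    then have "(1/4)\<^sup>2 \<le> (\<epsilon> * n)\<^sup>2" by (intro power_mono) auto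
    then have "1 \<le> 16 * (\<epsilon>\<^sup>2 * n\<^sup>2)" by (simp add: power_mult_distrib power_divide)
    then have "2 * D \<le> 32 * \<epsilon>\<^sup>2 * n\<^sup>2" using DE by (simp add: mult.assoc)
    then have "2 * D * (x + \<epsilon> * y) \<le> 32 * \<epsilon>\<^sup>2 * n\<^sup>2 * (x + \<epsilon> * y)"
      using pos \<epsilon> by (intro mult_right_mono) auto
    then show ?thesis using True by simp
  qed (use pos \<epsilon> in simp)
  also have "E * (\<alpha> + 16 * \<epsilon>\<^sup>2 * (n\<^sup>2 * x + n * y)) \<le> 1 * (\<alpha> + 16 * \<epsilon>\<^sup>2 * (n\<^sup>2 * x + n * y))"
    using DE pos by (intro mult_right_mono) auto
  finally have "\<mu> * cmod (err t \<xi>) \<le> \<mu> * (32 * \<epsilon>\<^sup>2 * n\<^sup>2 * (x + \<epsilon> * y) + 1 * (\<alpha> + 16 * \<epsilon>\<^sup>2 * (n\<^sup>2 * x + n * y)))"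
    using \<mu>(1) by (intro mult_left_mono) auto
  also have "\<dots> = \<mu> * \<alpha> + \<epsilon>\<^sup>2 * (48 * ((n * (n * \<mu>)) * x) + 32 * ((n * (n * \<mu>)) * (\<epsilon> * y)) + 16 * ((n * \<mu>) * y))"
    by (simp add: algebra_simps power2_eq_square)
  also have "\<dots> \<le> jweight (s' - 2) \<xi> * \<alpha> + \<epsilon>\<^sup>2 * (48 * (jweight s' \<xi> * x) + 32 * (jweight s' \<xi> * (\<epsilon> * y)) + 16 * (jweight (s' - 1) \<xi> * y))"
  proof -
    have 1: "n * \<mu> \<le> jweight (s' - 1) \<xi>"
      using mult_left_mono[OF \<mu>(2) pos(1)] jweight_symbol[of \<xi> "s' - 2"] by (simp add: n_def m_def)
    have 2: "n * (n * \<mu>) \<le> jweight s' \<xi>"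
      using mult_left_mono[OF 1 pos(1)] jweight_symbol[of \<xi> "s' - 1"] by (simp add: n_def m_def)
    show ?thesis
      using 1 2 \<mu> pos \<epsilon> by (intro add_mono mult_left_mono mult_right_mono) auto
  qed
  also have "\<dots> \<le> 48 * (jweight (s' - 2) \<xi> * \<alpha> + \<epsilon>\<^sup>2 * (jweight s' \<xi> * x + \<epsilon> * jweight s' \<xi> * y + jweight (s' - 1) \<xi> * y))"
  proof -
    have "0 \<le> jweight (s' - 2) \<xi> * \<alpha>" "0 \<le> \<epsilon>\<^sup>2 * (jweight s' \<xi> * (\<epsilon> * y))" "0 \<le> \<epsilon>\<^sup>2 * (jweight (s' - 1) \<xi> * y)"
      using pos \<epsilon> jweight_pos[THEN less_imp_le] by simp_all
    then show ?thesis by (simp add: distrib_left mult_ac)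
  qed
  also have "\<dots> = 48 * \<epsilon>\<^sup>2 * majorant s' \<xi>"
    using majorant_terms[of s' \<xi>] by (simp add: \<alpha>_def x_def y_def)
  finally show ?thesis .
qed

text \<open>On the heat part the factor
  \<open>\<bar>diff_symbol h \<xi>\<bar> powr (2 - 2 * \<theta>)\<close> is converted into
  \<open>t powr (\<theta> - 1)\<close>, so only \<open>\<mu>\<close> is charged, against order
  \<open>s' - 2\<close>. The layer part is not smoothed and takes the whole weight against order
  \<open>s'\<close>. Hence the two separate hypotheses on the weight.\<close>

lemma err_smoothing_estimate:
  assumes t: "0 < t" and \<theta>: "0 \<le> \<theta>" "\<theta> \<le> 1" and \<mu>: "0 \<le> \<mu>" "\<mu> \<le> jweight (s' - 2) \<xi>"
    and \<mu>s: "\<mu> * \<bar>diff_symbol h \<xi>\<bar> powr (2 - 2 * \<theta>) \<le> jweight s' \<xi>"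
  shows "\<mu> * \<bar>diff_symbol h \<xi>\<bar> powr (2 - 2 * \<theta>) * cmod (err t \<xi>) \<le>
    (2 * exp (- t / (40 * \<epsilon>\<^sup>2)) + 16 * \<epsilon>\<^sup>2 * t powr (\<theta> - 1)) * majorant s' \<xi>"
proof -
  define m where "m = diff_symbol h \<xi>"
  define n where "n = \<bar>m\<bar>"
  define x where "x = cmod (r \<xi>)"
  define y where "y = cmod (w \<xi>)"
  define \<alpha> where "\<alpha> = cmod (r0 \<xi> - r \<xi>)"
  define D where "D = exp (- t / (40 * \<epsilon>\<^sup>2))"
  define E where "E = exp (- m\<^sup>2 * t / 2)"
  define q where "q = n powr (2 - 2 * \<theta>)"
  have pos: "0 \<le> n" "0 \<le> x" "0 \<le> y" "0 \<le> \<alpha>" "n\<^sup>2 = m\<^sup>2" "0 \<le> q" by (auto simp: n_def x_def y_def \<alpha>_def q_def)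
  have DE: "0 \<le> D" "0 \<le> E" by (auto simp: D_def E_def)
  have Eq: "E * q \<le> t powr (\<theta> - 1)" unfolding E_def q_def n_def by (rule parabolic_smoothing[OF t \<theta>])
  have "cmod (err t \<xi>) \<le> (if \<epsilon> * n > 1/4 then 2 * D * (x + \<epsilon> * y) else 0) + E * (\<alpha> + 16 * \<epsilon>\<^sup>2 * (n\<^sup>2 * x + n * y))"
    using relax_minus_heat_bound[OF \<epsilon> less_imp_le[OF t], of m "r \<xi>" "w \<xi>" "r0 \<xi>"]
    unfolding err_def dens_def heat_def m_def n_def x_def y_def \<alpha>_def D_def E_def by (simp only: power2_abs)
  also have "(if \<epsilon> * n > 1/4 then 2 * D * (x + \<epsilon> * y) else 0) \<le> 2 * D * (x + \<epsilon> * y)"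
    using pos \<epsilon> DE by simp
  finally have "\<mu> * q * cmod (err t \<xi>) \<le> \<mu> * q * (2 * D * (x + \<epsilon> * y) + E * (\<alpha> + 16 * \<epsilon>\<^sup>2 * (n\<^sup>2 * x + n * y)))"
    using \<mu>(1) pos by (intro mult_left_mono) auto
  also have "\<dots> = 2 * D * ((\<mu> * q) * (x + \<epsilon> * y)) + (E * q) * (\<mu> * \<alpha> + 16 * \<epsilon>\<^sup>2 * ((n * (n * \<mu>)) * x + (n * \<mu>) * y))"
    by (simp add: algebra_simps power2_eq_square)
  also have "\<dots> \<le> 2 * D * majorant s' \<xi> + t powr (\<theta> - 1) * (16 * \<epsilon>\<^sup>2 * majorant s' \<xi>)"
  proof (intro add_mono mult_left_mono mult_mono Eq)
    have "(\<mu> * q) * (x + \<epsilon> * y) \<le> jweight s' \<xi> * (x + \<epsilon> * y)"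
      using \<mu>s pos \<epsilon> by (intro mult_right_mono) (auto simp: q_def n_def m_def)
    also have "\<dots> \<le> majorant s' \<xi>"
      using \<epsilon> jweight_pos[THEN less_imp_le] by (simp add: majorant_def x_def y_def distrib_left)
    finally show "(\<mu> * q) * (x + \<epsilon> * y) \<le> majorant s' \<xi>" .
    have 1: "n * \<mu> \<le> jweight (s' - 1) \<xi>"
      using mult_left_mono[OF \<mu>(2) pos(1)] jweight_symbol[of \<xi> "s' - 2"] by (simp add: n_def m_def)
    have 2: "n * (n * \<mu>) \<le> jweight s' \<xi>"
      using mult_left_mono[OF 1 pos(1)] jweight_symbol[of \<xi> "s' - 1"] by (simp add: n_def m_def)
    have "\<mu> * \<alpha> + 16 * \<epsilon>\<^sup>2 * ((n * (n * \<mu>)) * x + (n * \<mu>) * y) \<le>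
        jweight (s' - 2) \<xi> * \<alpha> + 16 * \<epsilon>\<^sup>2 * (jweight s' \<xi> * x + jweight (s' - 1) \<xi> * y)"
      using 1 2 \<mu> pos \<epsilon> by (intro add_mono mult_left_mono mult_right_mono) auto
    also have "\<dots> \<le> 16 * (jweight (s' - 2) \<xi> * \<alpha> + \<epsilon>\<^sup>2 * (jweight s' \<xi> * x + \<epsilon> * jweight s' \<xi> * y + jweight (s' - 1) \<xi> * y))"
    proof -
      have "0 \<le> jweight (s' - 2) \<xi> * \<alpha>" "0 \<le> \<epsilon>\<^sup>2 * (\<epsilon> * jweight s' \<xi> * y)"
        using pos \<epsilon> jweight_pos[THEN less_imp_le] by simp_all
      then show ?thesis unfolding distrib_left by linarith
    qed
    also have "\<dots> = 16 * \<epsilon>\<^sup>2 * majorant s' \<xi>"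
      using majorant_terms[of s' \<xi>] by (simp add: \<alpha>_def x_def y_def)
    finally show "\<mu> * \<alpha> + 16 * \<epsilon>\<^sup>2 * ((n * (n * \<mu>)) * x + (n * \<mu>) * y) \<le> 16 * \<epsilon>\<^sup>2 * majorant s' \<xi>" .
    show "0 \<le> \<mu> * \<alpha> + 16 * \<epsilon>\<^sup>2 * ((n * (n * \<mu>)) * x + (n * \<mu>) * y)" using \<mu> pos by simp
  qed (use DE in auto)
  finally show ?thesis by (simp add: q_def n_def m_def D_def algebra_simps)
qed

text \<open>The heat part of the mode contains the square of the symbol. It is written as
  \<open>q * p\<close> with exponents \<open>2 - 2 * \<theta>\<close> and
  \<open>2 * \<theta>\<close>: the first factor becomes \<open>t powr (\<theta> - 1)\<close>, the
  second is charged to the data, which is why \<open>\<nu>\<close> must leave room for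
  \<open>2 * \<theta>\<close> derivatives.\<close>

lemma mode_smoothing_estimate:
  assumes t: "0 < t" and \<theta>: "0 < \<theta>" "\<theta> \<le> 1" and \<nu>: "0 \<le> \<nu>" "\<nu> \<le> jweight (s' - 1) \<xi>"
    and \<nu>s: "\<nu> * \<bar>diff_symbol h \<xi>\<bar> powr (2 * \<theta>) \<le> jweight (s' - 1) \<xi>"
  shows "\<nu> * cmod (mode t \<xi>) \<le>
    (10 * exp (- t / (40 * \<epsilon>\<^sup>2)) + 6 * \<epsilon>\<^sup>2 * t powr (\<theta> - 1)) * majorant s' \<xi>"
proof -
  define m where "m = diff_symbol h \<xi>"
  define n where "n = \<bar>m\<bar>"
  define x where "x = cmod (r \<xi>)"
  define y where "y = cmod (w \<xi>)"
  define D where "D = exp (- t / (40 * \<epsilon>\<^sup>2))"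
  define E where "E = exp (- m\<^sup>2 * t / 2)"
  define q where "q = n powr (2 - 2 * \<theta>)"
  define p where "p = n powr (2 * \<theta>)"
  have pos: "0 \<le> n" "0 \<le> x" "0 \<le> y" "n\<^sup>2 = m\<^sup>2" "0 \<le> q" "0 \<le> p" by (auto simp: n_def x_def y_def q_def p_def)
  have DE: "0 \<le> D" "0 \<le> E" by (auto simp: D_def E_def)
  have Eq: "E * q \<le> t powr (\<theta> - 1)"
    unfolding E_def q_def n_def using \<theta> by (intro parabolic_smoothing t) auto
  \<comment> \<open>At \<open>n = 0\<close> both sides vanish, because \<open>powr\<close> takes the
    value 0 at base 0.\<close>
  have qp: "n\<^sup>2 = q * p"
    using \<theta> pos(1) by (cases "n = 0") (auto simp: q_def p_def powr_numeral simp flip: powr_add)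
  have "cmod (mode t \<xi>) \<le> 10 * D * (y + n * x + \<epsilon> * n * y) + 6 * \<epsilon>\<^sup>2 * E * (n ^ 3 * x + n\<^sup>2 * y)"
    using relax_damped_mode_bound[OF \<epsilon> less_imp_le[OF t], of m "r \<xi>" "w \<xi>"]
    by (simp add: mode_def dens_def vel_def m_def n_def x_def y_def D_def E_def)
  then have "\<nu> * cmod (mode t \<xi>) \<le> \<nu> * (10 * D * (y + n * x + \<epsilon> * n * y) + 6 * \<epsilon>\<^sup>2 * E * (n ^ 3 * x + n\<^sup>2 * y))"
    using \<nu>(1) by (rule mult_left_mono)
  also have "n ^ 3 * x + n\<^sup>2 * y = q * ((n * p) * x + p * y)"
    unfolding power3_eq_cube mult.assoc[of n n] power2_eq_square[of n, symmetric] qp by (simp add: algebra_simps)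
  also have "\<nu> * (10 * D * (y + n * x + \<epsilon> * n * y) + 6 * \<epsilon>\<^sup>2 * E * (q * ((n * p) * x + p * y))) =
      10 * D * (\<nu> * y + (n * \<nu>) * x + \<epsilon> * (n * \<nu>) * y) + 6 * \<epsilon>\<^sup>2 * ((E * q) * ((n * (\<nu> * p)) * x + (\<nu> * p) * y))"
    by (simp add: algebra_simps)
  also have "\<dots> \<le> 10 * D * majorant s' \<xi> + 6 * \<epsilon>\<^sup>2 * (t powr (\<theta> - 1) * majorant s' \<xi>)"
  proof (intro add_mono mult_left_mono mult_mono Eq)
    have \<nu>p: "\<nu> * p \<le> jweight (s' - 1) \<xi>" using \<nu>s by (simp add: p_def n_def m_def)
    have 1: "n * \<nu> \<le> jweight s' \<xi>"
      using mult_left_mono[OF \<nu>(2) pos(1)] jweight_symbol[of \<xi> "s' - 1"] by (simp add: n_def m_def)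
    have 2: "n * (\<nu> * p) \<le> jweight s' \<xi>"
      using mult_left_mono[OF \<nu>p pos(1)] jweight_symbol[of \<xi> "s' - 1"] by (simp add: n_def m_def)
    have maj: "jweight (s' - 1) \<xi> * y + jweight s' \<xi> * x + \<epsilon> * jweight s' \<xi> * y \<le> majorant s' \<xi>"
      using \<epsilon> jweight_pos[THEN less_imp_le] by (simp add: majorant_def x_def y_def)
    have "\<nu> * y + (n * \<nu>) * x + \<epsilon> * (n * \<nu>) * y \<le> jweight (s' - 1) \<xi> * y + jweight s' \<xi> * x + \<epsilon> * jweight s' \<xi> * y"
      using 1 \<nu> pos \<epsilon> by (intro add_mono mult_left_mono mult_right_mono) auto
    with maj show "\<nu> * y + (n * \<nu>) * x + \<epsilon> * (n * \<nu>) * y \<le> majorant s' \<xi>" by linarith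
    have "(n * (\<nu> * p)) * x + (\<nu> * p) * y \<le> jweight s' \<xi> * x + jweight (s' - 1) \<xi> * y"
      using 2 \<nu>p pos by (intro add_mono mult_right_mono) auto
    moreover have "0 \<le> \<epsilon> * jweight s' \<xi> * y" using pos \<epsilon> jweight_pos[THEN less_imp_le] by simp
    ultimately show "(n * (\<nu> * p)) * x + (\<nu> * p) * y \<le> majorant s' \<xi>" using maj by linarith
    show "0 \<le> (n * (\<nu> * p)) * x + (\<nu> * p) * y" using pos \<nu> by simp
  qed (use DE in auto)
  finally show ?thesis by (simp add: D_def algebra_simps)
qed

abbreviation "majorant_norm s' \<equiv> L2norm lborel (\<lambda>\<xi>. complex_of_real (majorant s' \<xi>))"

lemma hdot_norm_le_majorant:
  assumes [measurable]: "F \<in> borel_measurable borel" and "L2norm (period_measure h) F < \<top>" and k: "0 \<le> k"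
    and le: "\<And>\<xi>. \<bar>diff_symbol h \<xi>\<bar> powr \<kappa> * cmod (F \<xi>) \<le> k * majorant s' \<xi>"
  shows "hdot_norm h \<kappa> (idft h F) \<le> ennreal k * majorant_norm s'"
proof -
  have "hdot_norm h \<kappa> (idft h F) = L2norm (period_measure h) (\<lambda>\<xi>. F \<xi> * complex_of_real (\<bar>diff_symbol h \<xi>\<bar> powr \<kappa>))"
    by (rule hdot_norm_idft[OF h]) fact+
  also have "\<dots> \<le> L2norm (period_measure h) (\<lambda>\<xi>. complex_of_real k * complex_of_real (majorant s' \<xi>))"
  proof (intro L2norm_mono_AE AE_I2)
    fix \<xi>
    have "cmod (F \<xi> * complex_of_real (\<bar>diff_symbol h \<xi>\<bar> powr \<kappa>)) = \<bar>diff_symbol h \<xi>\<bar> powr \<kappa> * cmod (F \<xi>)"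
      by (simp add: norm_mult)
    also have "\<dots> \<le> k * majorant s' \<xi>" by (rule le)
    also have "\<dots> = cmod (complex_of_real k * complex_of_real (majorant s' \<xi>))"
      using k majorant_nonneg by (simp add: norm_mult)
    finally show "cmod (F \<xi> * complex_of_real (\<bar>diff_symbol h \<xi>\<bar> powr \<kappa>)) \<le> cmod (complex_of_real k * complex_of_real (majorant s' \<xi>))" .
  qed
  also have "\<dots> = ennreal k * L2norm (period_measure h) (\<lambda>\<xi>. complex_of_real (majorant s' \<xi>))"
    using k by (intro L2norm_cmult) auto
  also have "\<dots> \<le> ennreal k * majorant_norm s'"
    by (intro mult_left_mono L2norm_period_measure_le) auto
  finally show ?thesis .
qed

text \<open>Cauchy-Schwarz against \<open>jweight (- p)\<close>, the inverse of the weight in the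
  hypothesis. Integrating over the whole line instead of the period keeps the constant free of
  \<open>h\<close>.\<close>

lemma linfnorm_le_majorant:
  assumes [measurable]: "F \<in> borel_measurable borel" and "integrable (period_measure h) F" and k: "0 \<le> k"
    and le: "\<And>\<xi>. jweight p \<xi> * cmod (F \<xi>) \<le> k * majorant s' \<xi>"
  shows "linfnorm (idft h F) \<le> ennreal k * (L2norm lborel (\<lambda>\<xi>. complex_of_real (jweight (- p) \<xi>)) * majorant_norm s')"
proof -
  have "linfnorm (idft h F) \<le> (\<integral>\<^sup>+\<xi>. ennreal (cmod (F \<xi>)) \<partial>period_measure h)"
    by (rule linfnorm_idft_le) fact+
  also have "\<dots> \<le> (\<integral>\<^sup>+\<xi>. ennreal (cmod (F \<xi>)) \<partial>lborel)"
    by (rule nn_integral_period_measure_le) measurable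
  also have "\<dots> \<le> (\<integral>\<^sup>+\<xi>. ennreal k * ennreal (cmod (complex_of_real (jweight (- p) \<xi>)) * cmod (complex_of_real (majorant s' \<xi>))) \<partial>lborel)"
  proof (intro nn_integral_mono)
    fix \<xi>
    have "jweight (- p) \<xi> * jweight p \<xi> = 1" using jweight_add[of "- p" p \<xi>] by (simp add: jweight_0)
    then have "cmod (F \<xi>) = jweight (- p) \<xi> * (jweight p \<xi> * cmod (F \<xi>))" by (simp flip: mult.assoc)
    also have "\<dots> \<le> jweight (- p) \<xi> * (k * majorant s' \<xi>)"
      using le jweight_pos[of "- p" \<xi>] by (intro mult_left_mono) auto
    also have "\<dots> = k * (cmod (complex_of_real (jweight (- p) \<xi>)) * cmod (complex_of_real (majorant s' \<xi>)))"
      using jweight_pos[of "- p" \<xi>] majorant_nonneg[of s' \<xi>] by simp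
    finally have "ennreal (cmod (F \<xi>)) \<le> ennreal (k * (cmod (complex_of_real (jweight (- p) \<xi>)) * cmod (complex_of_real (majorant s' \<xi>))))"
      by (rule ennreal_leI)
    then show "ennreal (cmod (F \<xi>)) \<le> ennreal k * ennreal (cmod (complex_of_real (jweight (- p) \<xi>)) * cmod (complex_of_real (majorant s' \<xi>)))"
      using k by (simp add: ennreal_mult)
  qed
  also have "\<dots> = ennreal k * (\<integral>\<^sup>+\<xi>. ennreal (cmod (complex_of_real (jweight (- p) \<xi>)) * cmod (complex_of_real (majorant s' \<xi>))) \<partial>lborel)"
    by (rule nn_integral_cmult) measurable
  also have "\<dots> \<le> ennreal k * (L2norm lborel (\<lambda>\<xi>. complex_of_real (jweight (- p) \<xi>)) * majorant_norm s')"
    by (intro mult_left_mono nn_integral_le_L2norm) auto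
  finally show ?thesis .
qed

text \<open>\<open>esssup\<close> is infinite on functions that are not measurable, so the supremum
  in time cannot be bounded before measurability in time is known. It follows from joint
  measurability in time and frequency by integrating out the frequency.\<close>

lemma measurable_hdot_norm_idft:
  assumes joint [measurable]: "(\<lambda>p. F (fst p) (snd p)) \<in> borel_measurable (lborel \<Otimes>\<^sub>M lborel)"
    and meas: "\<And>t. 0 < t \<Longrightarrow> F t \<in> borel_measurable borel" "\<And>t. 0 < t \<Longrightarrow> L2norm (period_measure h) (F t) < \<top>"
    and g: "\<And>t. 0 < t \<Longrightarrow> g t = idft h (F t)"
  shows "(\<lambda>t. hdot_norm h \<kappa> (g t)) \<in> borel_measurable (restrict_space lborel {0<..<T})"
proof -
  let ?N = "\<lambda>t. ennreal_sqrt (\<integral>\<^sup>+\<xi>. ennreal ((cmod (F t \<xi> * complex_of_real (\<bar>diff_symbol h \<xi>\<bar> powr \<kappa>)))\<^sup>2) * indicator {-pi/h..pi/h} \<xi> \<partial>lborel)"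
  have "?N \<in> borel_measurable lborel"
  proof -
    have "(\<lambda>(t, \<xi>). ennreal ((cmod (F t \<xi> * complex_of_real (\<bar>diff_symbol h \<xi>\<bar> powr \<kappa>)))\<^sup>2) * indicator {-pi/h..pi/h} \<xi>)
        \<in> borel_measurable (lborel \<Otimes>\<^sub>M lborel)"
      unfolding split_beta by measurable
    then show ?thesis by measurable
  qed
  then have "?N \<in> borel_measurable (restrict_space lborel {0<..<T})" by (rule measurable_restrict_space1)
  moreover have "hdot_norm h \<kappa> (g t) = ?N t" if "t \<in> space (restrict_space lborel {0<..<T})" for t
  proof -
    have t: "0 < t" using that by (simp add: space_restrict_space)
    have [measurable]: "F t \<in> borel_measurable borel" by (rule meas(1)[OF t])
    show ?thesis
      unfolding g[OF t] hdot_norm_idft[OF h meas(1)[OF t] meas(2)[OF t]] L2norm_def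
      by (subst nn_integral_period_measure) auto
  qed
  ultimately show ?thesis by (subst measurable_cong) auto
qed

lemma measurable_linfnorm_idft:
  assumes joint [measurable]: "(\<lambda>p. F (fst p) (snd p)) \<in> borel_measurable (lborel \<Otimes>\<^sub>M lborel)"
    and g: "\<And>t. 0 < t \<Longrightarrow> g t = idft h (F t)"
  shows "(\<lambda>t. linfnorm (g t)) \<in> borel_measurable (restrict_space lborel {0<..<T})"
proof -
  have "(\<lambda>t. idft h (F t) n) \<in> borel_measurable lborel" for n
  proof -
    have "(\<lambda>(t, \<xi>). indicator {-pi/h..pi/h} \<xi> *\<^sub>R (exp (\<i> * complex_of_real (\<xi> * real_of_int n * h)) * F t \<xi>))
        \<in> borel_measurable (lborel \<Otimes>\<^sub>M lborel)"
      unfolding split_beta by measurable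
    then show ?thesis unfolding idft_def set_lebesgue_integral_def by measurable
  qed
  then have "(\<lambda>t. linfnorm (idft h (F t))) \<in> borel_measurable lborel"
    unfolding linfnorm_def by measurable
  then have "(\<lambda>t. linfnorm (idft h (F t))) \<in> borel_measurable (restrict_space lborel {0<..<T})"
    by (rule measurable_restrict_space1)
  moreover have "linfnorm (g t) = linfnorm (idft h (F t))" if "t \<in> space (restrict_space lborel {0<..<T})" for t
    using that g[of t] by (simp add: space_restrict_space)
  ultimately show ?thesis by (subst measurable_cong) auto
qed

end

section \<open>From bounds at each time to norms in time\<close>

lemma L1T_le:
  assumes "0 < T" "0 < \<epsilon>" "0 < \<theta>" "0 \<le> A" "0 \<le> B"
    and "\<And>t. 0 < t \<Longrightarrow> N (g t) \<le> ennreal (A * exp (- t / (40 * \<epsilon>\<^sup>2)) + B * \<epsilon>\<^sup>2 * t powr (\<theta> - 1)) * X"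
  shows "L1T T N g \<le> ennreal ((40 * A + B * (T powr \<theta> / \<theta>)) * \<epsilon>\<^sup>2) * X"
proof -
  have "L1T T N g \<le> (\<integral>\<^sup>+t. ennreal (A * exp (- t / (40 * \<epsilon>\<^sup>2)) + B * \<epsilon>\<^sup>2 * t powr (\<theta> - 1)) * X \<partial>restrict_space lborel {0<..<T})"
    unfolding L1T_def by (intro nn_integral_mono assms(6)) (simp add: space_restrict_space)
  also have "\<dots> = (\<integral>\<^sup>+t. ennreal (A * exp (- t / (40 * \<epsilon>\<^sup>2)) + B * \<epsilon>\<^sup>2 * t powr (\<theta> - 1)) \<partial>restrict_space lborel {0<..<T}) * X"
    by (rule nn_integral_multc) (intro measurable_restrict_space1, measurable)
  also have "\<dots> \<le> ennreal ((40 * A + B * (T powr \<theta> / \<theta>)) * \<epsilon>\<^sup>2) * X"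
    by (intro mult_right_mono nn_integral_time_weight assms) auto
  finally show ?thesis .
qed

lemma L1T_const_le:
  assumes "0 < T" "0 \<le> A" "\<And>t. 0 < t \<Longrightarrow> N (g t) \<le> ennreal A * X"
  shows "L1T T N g \<le> ennreal (T * A) * X"
proof -
  have "L1T T N g \<le> (\<integral>\<^sup>+t. ennreal A * X \<partial>restrict_space lborel {0<..<T})"
    unfolding L1T_def by (intro nn_integral_mono assms(3)) (simp add: space_restrict_space)
  also have "\<dots> = ennreal A * X * ennreal T"
    using assms(1) by (simp add: emeasure_restrict_space space_restrict_space)
  also have "\<dots> = ennreal (T * A) * X" using assms(1,2) by (simp add: ennreal_mult mult_ac)
  finally show ?thesis .
qed

lemma LinfT_le:
  assumes "(\<lambda>t. N (g t)) \<in> borel_measurable (restrict_space lborel {0<..<T})" "\<And>t. 0 < t \<Longrightarrow> N (g t) \<le> c"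
  shows "LinfT T N g \<le> c"
  unfolding LinfT_def by (rule esssup_I[OF assms(1)]) (auto simp: AE_restrict_space_iff intro!: AE_I2 assms(2))

subsection \<open>Linearity of the Fourier transform on the line\<close>

text \<open>For \<open>h = pi / R\<close> the period is [-R, R], so the facts on
  \<open>period_measure\<close> apply to the integrals over bounded intervals.\<close>

lemma fourier_cutoff_eq:
  assumes "R > 0" and [measurable]: "f \<in> borel_measurable borel"
  shows "fourier_cutoff R f \<xi> = complex_of_real (1 / sqrt (2 * pi)) *
    (LINT x|period_measure (pi / R). exp (- \<i> * complex_of_real (\<xi> * x)) * f x)"
  using assms(1) by (subst integral_period_measure) (auto simp: fourier_cutoff_def)

lemma measurable_fourier_cutoff:
  assumes [measurable]: "f \<in> borel_measurable borel"
  shows "fourier_cutoff R f \<in> borel_measurable borel"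
proof -
  have "(\<lambda>(\<xi>, x). indicator {-R..R} x *\<^sub>R (exp (- \<i> * complex_of_real (\<xi> * x)) * f x)) \<in> borel_measurable (lborel \<Otimes>\<^sub>M lborel)"
    unfolding split_beta by measurable
  then have "(\<lambda>\<xi>. fourier_cutoff R f \<xi>) \<in> borel_measurable lborel"
    unfolding fourier_cutoff_def set_lebesgue_integral_def by measurable
  then show ?thesis by simp
qed

lemma integrable_fourier_cutoff:
  assumes R: "R > 0" and f: "f \<in> L2_line"
  shows "integrable (period_measure (pi / R)) (\<lambda>x. exp (- \<i> * complex_of_real (\<xi> * x)) * f x)"
proof -
  have [measurable]: "f \<in> borel_measurable borel" using f by (simp add: L2_line_def)
  have "L2norm (period_measure (pi / R)) f < \<top>"
    using L2norm_period_measure_le[of f "pi / R"] f by (auto simp: L2_line_def intro: order.strict_trans1)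
  then have "integrable (period_measure (pi / R)) f"
    by (rule integrable_of_L2(1)[OF finite_measure_period_measure, rotated 2]) (use R in auto)
  then show ?thesis
  proof (rule Bochner_Integration.integrable_bound)
    show "(\<lambda>x. exp (- \<i> * complex_of_real (\<xi> * x)) * f x) \<in> borel_measurable (period_measure (pi / R))"
      by measurable
    show "AE x in period_measure (pi / R). cmod (exp (- \<i> * complex_of_real (\<xi> * x)) * f x) \<le> cmod (f x)"
      by (rule AE_I2) (simp add: norm_mult)
  qed
qed

lemma L2norm_cmult_abs:
  assumes "f \<in> borel_measurable M"
  shows "L2norm M (\<lambda>x. complex_of_real c * f x) = ennreal \<bar>c\<bar> * L2norm M f"
proof -
  have "L2norm M (\<lambda>x. complex_of_real c * f x) = L2norm M (\<lambda>x. complex_of_real \<bar>c\<bar> * f x)"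
    by (simp add: L2norm_def norm_mult)
  then show ?thesis using L2norm_cmult[OF assms, of "\<bar>c\<bar>"] by simp
qed

text \<open>The chosen transform of a combination is meaningful only once some transform of it
  exists; here one is built from those of the parts, by linearity of the integrals over bounded
  intervals.\<close>

lemma has_fourier_L2_lincomb:
  assumes f: "f \<in> L2_line" "has_fourier_L2 f F" and g: "g \<in> L2_line" "has_fourier_L2 g G"
  shows "has_fourier_L2 (\<lambda>x. complex_of_real a * f x + complex_of_real b * g x)
    (\<lambda>\<xi>. complex_of_real a * F \<xi> + complex_of_real b * G \<xi>)"
proof -
  have [measurable]: "f \<in> borel_measurable borel" "g \<in> borel_measurable borel"
    "F \<in> borel_measurable borel" "G \<in> borel_measurable borel"
    using f g by (auto simp: L2_line_def has_fourier_L2_def)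
  have [measurable]: "fourier_cutoff R f \<in> borel_measurable borel" "fourier_cutoff R g \<in> borel_measurable borel" for R
    by (rule measurable_fourier_cutoff, measurable)+
  let ?f = "\<lambda>x. complex_of_real a * f x + complex_of_real b * g x"
  let ?F = "\<lambda>\<xi>. complex_of_real a * F \<xi> + complex_of_real b * G \<xi>"
  have cut: "fourier_cutoff R ?f \<xi> = complex_of_real a * fourier_cutoff R f \<xi> + complex_of_real b * fourier_cutoff R g \<xi>"
    if R: "R > 0" for R \<xi>
  proof -
    let ?e = "\<lambda>x. exp (- \<i> * complex_of_real (\<xi> * x))" and ?M = "period_measure (pi / R)"
    have "(LINT x|?M. ?e x * ?f x) = (LINT x|?M. complex_of_real a * (?e x * f x) + complex_of_real b * (?e x * g x))"
      by (intro Bochner_Integration.integral_cong refl) (simp add: distrib_left mult.left_commute)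
    also have "\<dots> = complex_of_real a * (LINT x|?M. ?e x * f x) + complex_of_real b * (LINT x|?M. ?e x * g x)"
      using integrable_fourier_cutoff[OF R f(1), of \<xi>] integrable_fourier_cutoff[OF R g(1), of \<xi>] by simp
    finally show ?thesis
      by (simp only: fourier_cutoff_eq[OF R \<open>f \<in> borel_measurable borel\<close>] fourier_cutoff_eq[OF R \<open>g \<in> borel_measurable borel\<close>])
        (subst fourier_cutoff_eq[OF R], measurable, simp add: distrib_left mult.left_commute)
  qed
  have le: "L2norm lborel (\<lambda>\<xi>. ?F \<xi> - fourier_cutoff R ?f \<xi>) \<le>
      2 * (ennreal \<bar>a\<bar> * L2norm lborel (\<lambda>\<xi>. F \<xi> - fourier_cutoff R f \<xi>) + ennreal \<bar>b\<bar> * L2norm lborel (\<lambda>\<xi>. G \<xi> - fourier_cutoff R g \<xi>))"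
    if R: "R > 0" for R
  proof -
    have "L2norm lborel (\<lambda>\<xi>. ?F \<xi> - fourier_cutoff R ?f \<xi>) =
        L2norm lborel (\<lambda>\<xi>. complex_of_real a * (F \<xi> - fourier_cutoff R f \<xi>) + complex_of_real b * (G \<xi> - fourier_cutoff R g \<xi>))"
      by (rule arg_cong[of _ _ "L2norm lborel"]) (simp add: cut[OF R] fun_eq_iff algebra_simps)
    also have "\<dots> \<le> 2 * (L2norm lborel (\<lambda>\<xi>. complex_of_real a * (F \<xi> - fourier_cutoff R f \<xi>)) + L2norm lborel (\<lambda>\<xi>. complex_of_real b * (G \<xi> - fourier_cutoff R g \<xi>)))"
      by (rule L2norm_add) measurable
    finally show ?thesis by (simp add: L2norm_cmult_abs)
  qed
  have "((\<lambda>R. 2 * (ennreal \<bar>a\<bar> * L2norm lborel (\<lambda>\<xi>. F \<xi> - fourier_cutoff R f \<xi>) + ennreal \<bar>b\<bar> * L2norm lborel (\<lambda>\<xi>. G \<xi> - fourier_cutoff R g \<xi>)))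
      \<longlongrightarrow> 2 * (ennreal \<bar>a\<bar> * 0 + ennreal \<bar>b\<bar> * 0)) at_top"
    using f(2) g(2) unfolding has_fourier_L2_def by (intro ennreal_tendsto_cmult tendsto_add) auto
  then have lim0: "((\<lambda>R. 2 * (ennreal \<bar>a\<bar> * L2norm lborel (\<lambda>\<xi>. F \<xi> - fourier_cutoff R f \<xi>) + ennreal \<bar>b\<bar> * L2norm lborel (\<lambda>\<xi>. G \<xi> - fourier_cutoff R g \<xi>)))
      \<longlongrightarrow> 0) at_top" by simp
  have "((\<lambda>R. L2norm lborel (\<lambda>\<xi>. ?F \<xi> - fourier_cutoff R ?f \<xi>)) \<longlongrightarrow> 0) at_top"
  proof (rule tendsto_sandwich[OF _ _ tendsto_const lim0])
    show "\<forall>\<^sub>F R in at_top. L2norm lborel (\<lambda>\<xi>. ?F \<xi> - fourier_cutoff R ?f \<xi>) \<le>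
        2 * (ennreal \<bar>a\<bar> * L2norm lborel (\<lambda>\<xi>. F \<xi> - fourier_cutoff R f \<xi>) + ennreal \<bar>b\<bar> * L2norm lborel (\<lambda>\<xi>. G \<xi> - fourier_cutoff R g \<xi>))"
      using eventually_gt_at_top[of 0] by eventually_elim (rule le)
  qed simp
  then show ?thesis unfolding has_fourier_L2_def by simp
qed

lemma fourier_L2_lincomb_AE:
  assumes f: "f \<in> L2_line" "has_fourier_L2 f F" and g: "g \<in> L2_line" "has_fourier_L2 g G"
  shows "AE \<xi> in lborel. fourier_L2 (\<lambda>x. complex_of_real a * f x + complex_of_real b * g x) \<xi> =
    complex_of_real a * F \<xi> + complex_of_real b * G \<xi>"
proof -
  let ?f = "\<lambda>x. complex_of_real a * f x + complex_of_real b * g x"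
  have [measurable]: "f \<in> borel_measurable borel" "g \<in> borel_measurable borel"
    "F \<in> borel_measurable borel" "G \<in> borel_measurable borel"
    using f g by (auto simp: L2_line_def has_fourier_L2_def)
  have [measurable]: "fourier_cutoff R ?f \<in> borel_measurable borel" for R
    by (rule measurable_fourier_cutoff) measurable
  note hF = has_fourier_L2_lincomb[OF assms, of a b]
  have hS: "has_fourier_L2 ?f (fourier_L2 ?f)"
    unfolding fourier_L2_def by (rule someI[of "has_fourier_L2 ?f"]) (rule hF)
  show ?thesis
    by (rule L2norm_limit_unique_AE[where f = "\<lambda>R. fourier_cutoff R ?f" and U = at_top])
      (use hF hS in \<open>auto simp: has_fourier_L2_def\<close>)
qed

lemma sobolev_norm_jweight:
  "sobolev_norm p f = L2norm lborel (\<lambda>\<xi>. complex_of_real (jweight p \<xi>) * fourier_L2 f \<xi>)"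
  by (simp add: sobolev_norm_def jweight_def)

text \<open>Two combinations occur in the data: the mismatch of the initial densities, with
  coefficients 1 and -1, and the scaled velocity, with coefficients \<open>\<epsilon>\<close> and
  0.\<close>

lemma sobolev_norm_lincomb:
  assumes f: "f \<in> L2_line" "has_fourier_L2 f F" and g: "g \<in> L2_line" "has_fourier_L2 g G"
  shows "sobolev_norm p (\<lambda>x. complex_of_real a * f x + complex_of_real b * g x) =
    L2norm lborel (\<lambda>\<xi>. complex_of_real (jweight p \<xi>) * (complex_of_real a * F \<xi> + complex_of_real b * G \<xi>))"
  unfolding sobolev_norm_jweight
  by (rule L2norm_cong_AE) (use fourier_L2_lincomb_AE[OF assms, of a b] in \<open>eventually_elim, simp\<close>)

lemma L2norm_fourier_le_sobolev_norm:
  assumes "0 \<le> p"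
  shows "L2norm lborel (fourier_L2 f) \<le> sobolev_norm p f"
  unfolding sobolev_norm_jweight
proof (intro L2norm_mono_AE AE_I2)
  fix \<xi>
  have "1 \<le> jweight p \<xi>" using jweight_mono[OF assms, of \<xi>] by (simp add: jweight_0)
  then show "cmod (fourier_L2 f \<xi>) \<le> cmod (complex_of_real (jweight p \<xi>) * fourier_L2 f \<xi>)"
    using mult_right_mono[of 1 "jweight p \<xi>" "cmod (fourier_L2 f \<xi>)"] by (simp add: norm_mult)
qed

lemma truncated_fourier_data:
  assumes s': "s' > 2" and "h > 0" "\<epsilon> > 0"
    and data: "truncated_data s' h (\<epsilon>\<^sup>2) \<rho>s us \<rho>0 \<rho>st ust \<rho>0t"
  shows "fourier_data h \<epsilon> (fourier_L2 \<rho>st) (fourier_L2 ust) (fourier_L2 \<rho>0t)"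
proof
  have S: "\<rho>st \<in> sobolev_space s'" "ust \<in> sobolev_space s'" "\<rho>0t \<in> sobolev_space (s' - 2)"
    using data by (auto simp: truncated_data_def)
  show meas: "fourier_L2 \<rho>st \<in> borel_measurable borel" "fourier_L2 ust \<in> borel_measurable borel"
    "fourier_L2 \<rho>0t \<in> borel_measurable borel"
    using S by (auto simp: sobolev_space_def has_fourier_L2_def)
  have fin: "L2norm (period_measure h) (fourier_L2 f) < \<top>"
    if "f \<in> sobolev_space p" "0 \<le> p" for f p
  proof -
    have "fourier_L2 f \<in> borel_measurable borel" using that by (auto simp: sobolev_space_def has_fourier_L2_def)
    then have "L2norm (period_measure h) (fourier_L2 f) \<le> L2norm lborel (fourier_L2 f)"
      by (rule L2norm_period_measure_le)
    also have "\<dots> \<le> sobolev_norm p f" using that by (intro L2norm_fourier_le_sobolev_norm)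
    also have "\<dots> < \<top>" using that by (simp add: sobolev_space_def)
    finally show ?thesis .
  qed
  show "L2norm (period_measure h) (fourier_L2 \<rho>st) < \<top>" "L2norm (period_measure h) (fourier_L2 ust) < \<top>"
    "L2norm (period_measure h) (fourier_L2 \<rho>0t) < \<top>"
    using fin[OF S(1)] fin[OF S(2)] fin[OF S(3)] s' by auto
qed fact+

text \<open>The four parts of the majorant match the summands of the data size, with the pair norm
  serving for two of them. Two nested applications of \<open>L2norm_add\<close> cost a factor 4, and
  counting the pair norm twice costs another 2.\<close>

lemma majorant_norm_le_data_size:
  assumes s': "s' > 2" and h: "h > 0" and \<epsilon>: "\<epsilon> > 0"
    and data: "truncated_data s' h (\<epsilon>\<^sup>2) \<rho>s us \<rho>0 \<rho>st ust \<rho>0t"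
  shows "fourier_data.majorant_norm \<epsilon> (fourier_L2 \<rho>st) (fourier_L2 ust) (fourier_L2 \<rho>0t) s'
    \<le> 8 * data_size s' \<epsilon> \<rho>st ust"
proof -
  interpret fourier_data h \<epsilon> "fourier_L2 \<rho>st" "fourier_L2 ust" "fourier_L2 \<rho>0t"
    by (rule truncated_fourier_data[OF assms])
  have S: "\<rho>st \<in> L2_line" "ust \<in> L2_line" "\<rho>0t \<in> L2_line" "has_fourier_L2 \<rho>st (fourier_L2 \<rho>st)"
    "has_fourier_L2 ust (fourier_L2 ust)" "has_fourier_L2 \<rho>0t (fourier_L2 \<rho>0t)"
    and close: "sobolev_norm (s' - 2) (\<lambda>x. \<rho>0t x - \<rho>st x) < ennreal (\<epsilon>\<^sup>2)"
    using data by (auto simp: truncated_data_def sobolev_space_def)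
  define P where "P = sobolev_norm_pair s' \<rho>st (\<lambda>x. complex_of_real \<epsilon> * ust x)"
  define d where "d = sobolev_norm (s' - 1) ust"
  define A where "A \<xi> = complex_of_real (jweight (s' - 2) \<xi> * cmod (fourier_L2 \<rho>0t \<xi> - fourier_L2 \<rho>st \<xi>) / \<epsilon>\<^sup>2)" for \<xi>
  define B where "B \<xi> = complex_of_real (jweight s' \<xi> * cmod (fourier_L2 \<rho>st \<xi>))" for \<xi>
  define C where "C \<xi> = complex_of_real (\<epsilon> * jweight s' \<xi> * cmod (fourier_L2 ust \<xi>))" for \<xi>
  define D where "D \<xi> = complex_of_real (jweight (s' - 1) \<xi> * cmod (fourier_L2 ust \<xi>))" for \<xi>
  have [measurable]: "A \<in> borel_measurable borel" "B \<in> borel_measurable borel"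
    "C \<in> borel_measurable borel" "D \<in> borel_measurable borel"
    unfolding A_def[abs_def] B_def[abs_def] C_def[abs_def] D_def[abs_def] by measurable
  have norm_eq: "L2norm lborel F = L2norm lborel G" if "\<And>\<xi>. cmod (F \<xi>) = cmod (G \<xi>)" for F G :: "real \<Rightarrow> complex"
    using that by (simp add: L2norm_def)
  have jw: "\<bar>jweight p \<xi>\<bar> = jweight p \<xi>" for p \<xi> using jweight_pos[of p \<xi>] by simp
  have A: "L2norm lborel A \<le> 1"
  proof -
    have "sobolev_norm (s' - 2) (\<lambda>x. complex_of_real 1 * \<rho>0t x + complex_of_real (- 1) * \<rho>st x) =
        L2norm lborel (\<lambda>\<xi>. complex_of_real (jweight (s' - 2) \<xi>) * (complex_of_real 1 * fourier_L2 \<rho>0t \<xi> + complex_of_real (- 1) * fourier_L2 \<rho>st \<xi>))"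
      by (rule sobolev_norm_lincomb) fact+
    then have eq: "sobolev_norm (s' - 2) (\<lambda>x. \<rho>0t x - \<rho>st x) =
        L2norm lborel (\<lambda>\<xi>. complex_of_real (jweight (s' - 2) \<xi>) * (fourier_L2 \<rho>0t \<xi> - fourier_L2 \<rho>st \<xi>))" by simp
    have "L2norm lborel A = L2norm lborel (\<lambda>\<xi>. complex_of_real (1 / \<epsilon>\<^sup>2) * (complex_of_real (jweight (s' - 2) \<xi>) * (fourier_L2 \<rho>0t \<xi> - fourier_L2 \<rho>st \<xi>)))"
      by (rule norm_eq) (simp add: A_def norm_mult norm_divide norm_power jw)
    also have "\<dots> = ennreal (1 / \<epsilon>\<^sup>2) * sobolev_norm (s' - 2) (\<lambda>x. \<rho>0t x - \<rho>st x)"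
      unfolding eq by (rule L2norm_cmult) auto
    also have "\<dots> \<le> ennreal (1 / \<epsilon>\<^sup>2) * ennreal (\<epsilon>\<^sup>2)" using close by (intro mult_left_mono) auto
    also have "\<dots> = 1" using \<epsilon> by (simp flip: ennreal_mult)
    finally show ?thesis .
  qed
  have B: "L2norm lborel B = sobolev_norm s' \<rho>st"
    unfolding sobolev_norm_jweight by (rule norm_eq) (simp add: B_def norm_mult jw)
  have C: "L2norm lborel C = sobolev_norm s' (\<lambda>x. complex_of_real \<epsilon> * ust x)"
  proof -
    have "sobolev_norm s' (\<lambda>x. complex_of_real \<epsilon> * ust x + complex_of_real 0 * ust x) =
        L2norm lborel (\<lambda>\<xi>. complex_of_real (jweight s' \<xi>) * (complex_of_real \<epsilon> * fourier_L2 ust \<xi> + complex_of_real 0 * fourier_L2 ust \<xi>))"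
      by (rule sobolev_norm_lincomb) fact+
    then have "sobolev_norm s' (\<lambda>x. complex_of_real \<epsilon> * ust x) =
        L2norm lborel (\<lambda>\<xi>. complex_of_real (jweight s' \<xi>) * (complex_of_real \<epsilon> * fourier_L2 ust \<xi>))" by simp
    also have "\<dots> = L2norm lborel C" by (rule norm_eq) (use \<epsilon> in \<open>simp add: C_def norm_mult jw\<close>)
    finally show ?thesis by simp
  qed
  have D: "L2norm lborel D = d"
    unfolding d_def sobolev_norm_jweight by (rule norm_eq) (simp add: D_def norm_mult jw)
  have BP: "L2norm lborel B \<le> P" and CP: "L2norm lborel C \<le> P"
    unfolding B C P_def sobolev_norm_pair_def le_ennreal_sqrt_iff by simp_all
  have "majorant_norm s' = L2norm lborel (\<lambda>\<xi>. (A \<xi> + B \<xi>) + (C \<xi> + D \<xi>))"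
    by (simp add: majorant_def A_def B_def C_def D_def add.assoc)
  also have "\<dots> \<le> 2 * (L2norm lborel (\<lambda>\<xi>. A \<xi> + B \<xi>) + L2norm lborel (\<lambda>\<xi>. C \<xi> + D \<xi>))"
    by (rule L2norm_add) measurable
  also have "\<dots> \<le> 2 * (2 * (L2norm lborel A + L2norm lborel B) + 2 * (L2norm lborel C + L2norm lborel D))"
    by (intro mult_left_mono add_mono L2norm_add) auto
  also have "\<dots> \<le> 2 * (2 * (1 + P) + 2 * (P + d))"
    using A BP CP D by (intro mult_left_mono add_mono) auto
  also have "2 * (1 + P) + 2 * (P + d) = 2 * (1 + P + d) + 2 * P"
    by (simp add: distrib_left add_ac)
  also have "2 * (\<dots>) \<le> 2 * (2 * (1 + P + d) + 2 * (1 + P + d))"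
  proof (intro mult_left_mono add_left_mono)
    have "P \<le> 1 + P" by (simp add: add_increasing)
    also have "\<dots> \<le> 1 + P + d" by (simp add: add_increasing2)
    finally show "P \<le> 1 + P + d" .
  qed auto
  also have "\<dots> = 8 * data_size s' \<epsilon> \<rho>st ust"
    by (simp add: data_size_def P_def d_def flip: mult_2 mult.assoc)
  finally show ?thesis .
qed

section \<open>The three error terms in the homogeneous norms and in the sup norm\<close>

context fourier_data
begin

lemma solution_diff_eq_idft:
  assumes "relaxation_solution h \<epsilon> (idft h r) (idft h w) \<rho>\<epsilon> u\<epsilon>" "heat_solution h (idft h r0) \<rho>" and t: "0 \<le> t"
  shows "(\<lambda>n. \<rho>\<epsilon> t n - \<rho> t n) = idft h (err t)"
    and "(\<lambda>n. central_diff h (\<rho>\<epsilon> t) n + u\<epsilon> t n) = idft h (mode t)"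
proof -
  have sol: "\<rho>\<epsilon> t = idft h (dens t)" "u\<epsilon> t = idft h (vel t)" "\<rho> t = idft h (heat t)"
    using relaxation_solution_eq_idft[OF assms(1) t] heat_solution_eq_idft[OF assms(2) t] by auto
  show "(\<lambda>n. \<rho>\<epsilon> t n - \<rho> t n) = idft h (err t)"
    unfolding sol err_def[abs_def]
    by (rule ext, rule idft_diff[symmetric]) (use integrable_dens[OF t] in auto)
  have i: "integrable (period_measure h) (\<lambda>\<xi>. \<i> * diff_symbol h \<xi> * dens t \<xi>)"
    by (rule L2_of_amp_bound(2)[where c = "1 / h"]) (use h symbol_mult_bound[OF amp_bounds(1)[OF t]] in auto)
  show "(\<lambda>n. central_diff h (\<rho>\<epsilon> t) n + u\<epsilon> t n) = idft h (mode t)"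
    unfolding sol mode_def[abs_def]
    by (rule ext, subst idft_add[OF i]) (use integrable_dens[OF t] central_diff_idft[OF h integrable_dens(1)[OF t]] in auto)
qed

lemma err_L2:
  assumes "0 \<le> t"
  shows "L2norm (period_measure h) (err t) < \<top>" "integrable (period_measure h) (err t)"
  by (rule L2_of_amp_bound[OF _ _ err_bound[OF assms]]; simp)+

lemma mode_L2:
  assumes "0 \<le> t"
  shows "L2norm (period_measure h) (mode t) < \<top>" "integrable (period_measure h) (mode t)"
  by (rule L2_of_amp_bound[OF _ _ mode_bound[OF assms]]; use h \<epsilon> in simp)+

lemma symbol_powr_le_jweight:
  assumes "0 \<le> p" "p \<le> q"
  shows "\<bar>diff_symbol h \<xi>\<bar> powr p \<le> jweight q \<xi>"
  using abs_powr_le_jweight[OF abs_diff_symbol_le(1)[OF h] assms(1)] jweight_mono[OF assms(2)] by (rule order_trans)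

text \<open>The constant collects 48 from the sup bound, 40 * 2 and 40 * 10 from the two layer
  terms, and 16 + 6 from the smoothing terms. The weight of order \<open>s\<close> is split so that
  order \<open>s - 2 + 2 * \<theta>\<close> remains on the data, which
  \<open>s + 2 * \<theta> \<le> s'\<close> admits.\<close>

lemma hdot_estimate:
  assumes s: "2 < s" "s < s'" and T: "0 < T" and \<theta>: "0 < \<theta>" "\<theta> \<le> 1/2" "s + 2 * \<theta> \<le> s'"
    and g1: "\<And>t. 0 < t \<Longrightarrow> g1 t = idft h (err t)" and g2: "\<And>t. 0 < t \<Longrightarrow> g2 t = idft h (mode t)"
  shows "LinfT T (hdot_norm h (s - 2)) g1 + L1T T (hdot_norm h s) g1 + L1T T (hdot_norm h (s - 1)) g2
    \<le> ennreal ((528 + 22 * (T powr \<theta> / \<theta>)) * \<epsilon>\<^sup>2) * majorant_norm s'"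
proof -
  let ?c = "T powr \<theta> / \<theta>"
  have c: "0 \<le> ?c" using \<theta> by simp
  have 1: "LinfT T (hdot_norm h (s - 2)) g1 \<le> ennreal (48 * \<epsilon>\<^sup>2) * majorant_norm s'"
  proof (rule LinfT_le)
    show "(\<lambda>t. hdot_norm h (s - 2) (g1 t)) \<in> borel_measurable (restrict_space lborel {0<..<T})"
      by (rule measurable_hdot_norm_idft[OF measurable_err_joint(1)]) (use err_L2 g1 in auto)
    fix t :: real assume t: "0 < t"
    show "hdot_norm h (s - 2) (g1 t) \<le> ennreal (48 * \<epsilon>\<^sup>2) * majorant_norm s'"
      unfolding g1[OF t]
      by (intro hdot_norm_le_majorant err_L2 err_sup_estimate symbol_powr_le_jweight) (use t s in auto)
  qed
  have 2: "L1T T (hdot_norm h s) g1 \<le> ennreal ((40 * 2 + 16 * ?c) * \<epsilon>\<^sup>2) * majorant_norm s'"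
  proof (rule L1T_le[OF T \<epsilon> \<theta>(1)])
    fix t :: real assume t: "0 < t"
    show "hdot_norm h s (g1 t) \<le> ennreal (2 * exp (- t / (40 * \<epsilon>\<^sup>2)) + 16 * \<epsilon>\<^sup>2 * t powr (\<theta> - 1)) * majorant_norm s'"
      unfolding g1[OF t]
    proof (intro hdot_norm_le_majorant err_L2)
      fix \<xi>
      have eq: "\<bar>diff_symbol h \<xi>\<bar> powr (s - 2 + 2 * \<theta>) * \<bar>diff_symbol h \<xi>\<bar> powr (2 - 2 * \<theta>) = \<bar>diff_symbol h \<xi>\<bar> powr s"
        by (simp flip: powr_add)
      show "\<bar>diff_symbol h \<xi>\<bar> powr s * cmod (err t \<xi>) \<le> (2 * exp (- t / (40 * \<epsilon>\<^sup>2)) + 16 * \<epsilon>\<^sup>2 * t powr (\<theta> - 1)) * majorant s' \<xi>"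
        using err_smoothing_estimate[OF t, of \<theta> "\<bar>diff_symbol h \<xi>\<bar> powr (s - 2 + 2 * \<theta>)" s' \<xi>] \<theta> s
          symbol_powr_le_jweight[of "s - 2 + 2 * \<theta>" "s' - 2" \<xi>] symbol_powr_le_jweight[of s s' \<xi>]
        unfolding eq by simp
    qed (use t in auto)
  qed auto
  have 3: "L1T T (hdot_norm h (s - 1)) g2 \<le> ennreal ((40 * 10 + 6 * ?c) * \<epsilon>\<^sup>2) * majorant_norm s'"
  proof (rule L1T_le[OF T \<epsilon> \<theta>(1)])
    fix t :: real assume t: "0 < t"
    show "hdot_norm h (s - 1) (g2 t) \<le> ennreal (10 * exp (- t / (40 * \<epsilon>\<^sup>2)) + 6 * \<epsilon>\<^sup>2 * t powr (\<theta> - 1)) * majorant_norm s'"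
      unfolding g2[OF t]
    proof (intro hdot_norm_le_majorant mode_L2 mode_smoothing_estimate t)
      fix \<xi>
      show "\<bar>diff_symbol h \<xi>\<bar> powr (s - 1) \<le> jweight (s' - 1) \<xi>"
        by (rule symbol_powr_le_jweight) (use s in auto)
      show "\<bar>diff_symbol h \<xi>\<bar> powr (s - 1) * \<bar>diff_symbol h \<xi>\<bar> powr (2 * \<theta>) \<le> jweight (s' - 1) \<xi>"
        unfolding powr_add[symmetric] by (rule symbol_powr_le_jweight) (use s \<theta> in auto)
    qed (use t \<theta> in auto)
  qed auto
  have "LinfT T (hdot_norm h (s - 2)) g1 + L1T T (hdot_norm h s) g1 + L1T T (hdot_norm h (s - 1)) g2 \<le>
      (ennreal (48 * \<epsilon>\<^sup>2) + ennreal ((40 * 2 + 16 * ?c) * \<epsilon>\<^sup>2) + ennreal ((40 * 10 + 6 * ?c) * \<epsilon>\<^sup>2)) * majorant_norm s'"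
    unfolding distrib_right[where c = "majorant_norm s'"] by (intro add_mono 1 2 3)
  also have "ennreal (48 * \<epsilon>\<^sup>2) + ennreal ((40 * 2 + 16 * ?c) * \<epsilon>\<^sup>2) + ennreal ((40 * 10 + 6 * ?c) * \<epsilon>\<^sup>2) =
      ennreal ((528 + 22 * ?c) * \<epsilon>\<^sup>2)"
  proof -
    have n: "0 \<le> 48 * \<epsilon>\<^sup>2" "0 \<le> (40 * 2 + 16 * ?c) * \<epsilon>\<^sup>2" "0 \<le> (40 * 10 + 6 * ?c) * \<epsilon>\<^sup>2" using c by auto
    show ?thesis
      unfolding ennreal_plus[OF n(1,2), symmetric] ennreal_plus[OF add_nonneg_nonneg[OF n(1,2)] n(3), symmetric]
      by (rule arg_cong[of _ _ ennreal]) (simp add: algebra_simps)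
  qed
  finally show ?thesis .
qed

text \<open>All three terms use the weight of order \<open>s' - 2\<close>. The damped mode is
  controlled up to order \<open>s' - 1\<close>, so a whole derivative is to spare and
  \<open>\<theta> = 1/2\<close> can be taken. The density error is bounded uniformly in time at this
  order, and its time integral costs only a factor \<open>T\<close>.\<close>

lemma linf_estimate:
  assumes T: "0 < T" and g1: "\<And>t. 0 < t \<Longrightarrow> g1 t = idft h (err t)" and g2: "\<And>t. 0 < t \<Longrightarrow> g2 t = idft h (mode t)"
  shows "LinfT T linfnorm g1 + L1T T linfnorm g1 + L1T T linfnorm g2
    \<le> ennreal ((448 + 48 * T + 6 * (T powr (1/2) / (1/2))) * \<epsilon>\<^sup>2) *
      (L2norm lborel (\<lambda>\<xi>. complex_of_real (jweight (- (s' - 2)) \<xi>)) * majorant_norm s')"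
proof -
  let ?c = "T powr (1/2) / (1/2)" and ?X = "L2norm lborel (\<lambda>\<xi>. complex_of_real (jweight (- (s' - 2)) \<xi>)) * majorant_norm s'"
  have sup: "linfnorm (g1 t) \<le> ennreal (48 * \<epsilon>\<^sup>2) * ?X" if t: "0 < t" for t
    unfolding g1[OF t]
    by (intro linfnorm_le_majorant err_L2 err_sup_estimate) (use t jweight_pos[THEN less_imp_le] in auto)
  have 1: "LinfT T linfnorm g1 \<le> ennreal (48 * \<epsilon>\<^sup>2) * ?X"
    by (intro LinfT_le measurable_linfnorm_idft[OF measurable_err_joint(1)] g1 sup)
  have 2: "L1T T linfnorm g1 \<le> ennreal (T * (48 * \<epsilon>\<^sup>2)) * ?X"
    by (intro L1T_const_le T sup) auto
  have 3: "L1T T linfnorm g2 \<le> ennreal ((40 * 10 + 6 * ?c) * \<epsilon>\<^sup>2) * ?X"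
  proof (rule L1T_le[OF T \<epsilon>])
    fix t :: real assume t: "0 < t"
    show "linfnorm (g2 t) \<le> ennreal (10 * exp (- t / (40 * \<epsilon>\<^sup>2)) + 6 * \<epsilon>\<^sup>2 * t powr (1/2 - 1)) * ?X"
      unfolding g2[OF t]
    proof (intro linfnorm_le_majorant mode_L2 mode_smoothing_estimate t)
      fix \<xi>
      show "jweight (s' - 2) \<xi> \<le> jweight (s' - 1) \<xi>" by (rule jweight_mono) simp
      show "jweight (s' - 2) \<xi> * \<bar>diff_symbol h \<xi>\<bar> powr (2 * (1/2)) \<le> jweight (s' - 1) \<xi>"
        using jweight_symbol[of \<xi> "s' - 2"] by (simp add: mult.commute)
    qed (use t jweight_pos[THEN less_imp_le] in auto)
  qed auto
  have "LinfT T linfnorm g1 + L1T T linfnorm g1 + L1T T linfnorm g2 \<le>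
      (ennreal (48 * \<epsilon>\<^sup>2) + ennreal (T * (48 * \<epsilon>\<^sup>2)) + ennreal ((40 * 10 + 6 * ?c) * \<epsilon>\<^sup>2)) * ?X"
    unfolding distrib_right[where c = ?X] by (intro add_mono 1 2 3)
  also have "ennreal (48 * \<epsilon>\<^sup>2) + ennreal (T * (48 * \<epsilon>\<^sup>2)) + ennreal ((40 * 10 + 6 * ?c) * \<epsilon>\<^sup>2) =
      ennreal ((448 + 48 * T + 6 * ?c) * \<epsilon>\<^sup>2)"
    using T by (simp add: algebra_simps flip: ennreal_plus)
  finally show ?thesis .
qed

end

theorem corollary2p7:
  fixes s s' :: real
  assumes "s' > 2" and "2 < s" and "s < s'"
  shows
    "(\<forall>T>0. \<exists>K>0. \<forall>h>0. \<forall>\<epsilon>>0. \<forall>\<rho>s us \<rho>0 \<rho>st ust \<rho>0t \<rho>\<epsilon> u\<epsilon> \<rho>.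
        truncated_data s' h (\<epsilon>\<^sup>2) \<rho>s us \<rho>0 \<rho>st ust \<rho>0t \<longrightarrow>
        relaxation_solution h \<epsilon> \<rho>s us \<rho>\<epsilon> u\<epsilon> \<longrightarrow>
        heat_solution h \<rho>0 \<rho> \<longrightarrow>
          LinfT T (hdot_norm h (s - 2)) (\<lambda>t n. \<rho>\<epsilon> t n - \<rho> t n)
        + L1T T (hdot_norm h s) (\<lambda>t n. \<rho>\<epsilon> t n - \<rho> t n)
        + L1T T (hdot_norm h (s - 1)) (\<lambda>t n. central_diff h (\<rho>\<epsilon> t) n + u\<epsilon> t n)
        \<le> ennreal K * data_size s' \<epsilon> \<rho>st ust * ennreal (\<epsilon>\<^sup>2))
     \<and>
     (s' > 5/2 \<longrightarrow>
      (\<forall>T>0. \<exists>K>0. \<forall>h>0. \<forall>\<epsilon>>0. \<forall>\<rho>s us \<rho>0 \<rho>st ust \<rho>0t \<rho>\<epsilon> u\<epsilon> \<rho>.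
        truncated_data s' h (\<epsilon>\<^sup>2) \<rho>s us \<rho>0 \<rho>st ust \<rho>0t \<longrightarrow>
        relaxation_solution h \<epsilon> \<rho>s us \<rho>\<epsilon> u\<epsilon> \<longrightarrow>
        heat_solution h \<rho>0 \<rho> \<longrightarrow>
          LinfT T linfnorm (\<lambda>t n. \<rho>\<epsilon> t n - \<rho> t n)
        + L1T T linfnorm (\<lambda>t n. \<rho>\<epsilon> t n - \<rho> t n)
        + L1T T linfnorm (\<lambda>t n. central_diff h (\<rho>\<epsilon> t) n + u\<epsilon> t n)
        \<le> ennreal K * data_size s' \<epsilon> \<rho>st ust * ennreal (\<epsilon>\<^sup>2)))"
proof (intro conjI impI allI)
  fix T :: real assume T: "T > 0"
  \<comment> \<open>Half the gap between \<open>s\<close> and \<open>s'\<close>, since smoothing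
    with exponent \<open>\<theta>\<close> costs \<open>2 * \<theta>\<close> derivatives; the cap
    keeps wide gaps within the range of the smoothing bounds. The constant \<open>k\<close> then
    depends only on \<open>T\<close> and \<open>s' - s\<close>.\<close>
  define \<theta> where "\<theta> = min (1/2) ((s' - s) / 2)"
  have \<theta>: "0 < \<theta>" "\<theta> \<le> 1/2" "s + 2 * \<theta> \<le> s'" using assms by (auto simp: \<theta>_def min_def field_simps)
  define k where "k = 528 + 22 * (T powr \<theta> / \<theta>)"
  have "0 \<le> T powr \<theta> / \<theta>" using \<theta> by simp
  then have k: "k > 0" by (simp add: k_def)
  show "\<exists>K>0. \<forall>h>0. \<forall>\<epsilon>>0. \<forall>\<rho>s us \<rho>0 \<rho>st ust \<rho>0t \<rho>\<epsilon> u\<epsilon> \<rho>.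
        truncated_data s' h (\<epsilon>\<^sup>2) \<rho>s us \<rho>0 \<rho>st ust \<rho>0t \<longrightarrow>
        relaxation_solution h \<epsilon> \<rho>s us \<rho>\<epsilon> u\<epsilon> \<longrightarrow>
        heat_solution h \<rho>0 \<rho> \<longrightarrow>
          LinfT T (hdot_norm h (s - 2)) (\<lambda>t n. \<rho>\<epsilon> t n - \<rho> t n)
        + L1T T (hdot_norm h s) (\<lambda>t n. \<rho>\<epsilon> t n - \<rho> t n)
        + L1T T (hdot_norm h (s - 1)) (\<lambda>t n. central_diff h (\<rho>\<epsilon> t) n + u\<epsilon> t n)
        \<le> ennreal K * data_size s' \<epsilon> \<rho>st ust * ennreal (\<epsilon>\<^sup>2)"
  proof (intro exI[of _ "8 * k"] conjI allI impI)
    fix h \<epsilon> :: real and \<rho>s us \<rho>0 \<rho>st ust \<rho>0t \<rho>\<epsilon> u\<epsilon> \<rho>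
    assume h: "h > 0" and \<epsilon>: "\<epsilon> > 0" and data: "truncated_data s' h (\<epsilon>\<^sup>2) \<rho>s us \<rho>0 \<rho>st ust \<rho>0t"
      and sol: "relaxation_solution h \<epsilon> \<rho>s us \<rho>\<epsilon> u\<epsilon>" "heat_solution h \<rho>0 \<rho>"
    interpret fourier_data h \<epsilon> "fourier_L2 \<rho>st" "fourier_L2 ust" "fourier_L2 \<rho>0t"
      by (rule truncated_fourier_data[OF assms(1) h \<epsilon> data])
    have "\<rho>s = idft h (fourier_L2 \<rho>st)" "us = idft h (fourier_L2 ust)" "\<rho>0 = idft h (fourier_L2 \<rho>0t)"
      using data by (auto simp: truncated_data_def truncation_eq_idft)
    note g = solution_diff_eq_idft[OF sol[unfolded this] less_imp_le]
    have "LinfT T (hdot_norm h (s - 2)) (\<lambda>t n. \<rho>\<epsilon> t n - \<rho> t n)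
        + L1T T (hdot_norm h s) (\<lambda>t n. \<rho>\<epsilon> t n - \<rho> t n)
        + L1T T (hdot_norm h (s - 1)) (\<lambda>t n. central_diff h (\<rho>\<epsilon> t) n + u\<epsilon> t n)
        \<le> ennreal (k * \<epsilon>\<^sup>2) * majorant_norm s'"
      unfolding k_def by (rule hdot_estimate[OF assms(2,3) T \<theta> g])
    also have "\<dots> \<le> ennreal (k * \<epsilon>\<^sup>2) * (8 * data_size s' \<epsilon> \<rho>st ust)"
      by (intro mult_left_mono majorant_norm_le_data_size[OF assms(1) h \<epsilon> data]) simp
    also have "\<dots> = ennreal (8 * k) * data_size s' \<epsilon> \<rho>st ust * ennreal (\<epsilon>\<^sup>2)"
      using k by (simp add: ennreal_mult mult_ac)
    finally show "LinfT T (hdot_norm h (s - 2)) (\<lambda>t n. \<rho>\<epsilon> t n - \<rho> t n)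
        + L1T T (hdot_norm h s) (\<lambda>t n. \<rho>\<epsilon> t n - \<rho> t n)
        + L1T T (hdot_norm h (s - 1)) (\<lambda>t n. central_diff h (\<rho>\<epsilon> t) n + u\<epsilon> t n)
        \<le> ennreal (8 * k) * data_size s' \<epsilon> \<rho>st ust * ennreal (\<epsilon>\<^sup>2)" .
  qed (use k in simp)
next
  fix T :: real assume s': "s' > 5/2" and T: "T > 0"
  obtain N where N: "L2norm lborel (\<lambda>\<xi>. complex_of_real (jweight (- (s' - 2)) \<xi>)) = ennreal N" "0 \<le> N"
    using L2norm_jweight[of "s' - 2"] s' by (cases "L2norm lborel (\<lambda>\<xi>. complex_of_real (jweight (- (s' - 2)) \<xi>))") auto
  define k where "k = 448 + 48 * T + 6 * (T powr (1/2) / (1/2))"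
  have k: "k > 0" using T by (simp add: k_def add_pos_nonneg)
  show "\<exists>K>0. \<forall>h>0. \<forall>\<epsilon>>0. \<forall>\<rho>s us \<rho>0 \<rho>st ust \<rho>0t \<rho>\<epsilon> u\<epsilon> \<rho>.
        truncated_data s' h (\<epsilon>\<^sup>2) \<rho>s us \<rho>0 \<rho>st ust \<rho>0t \<longrightarrow>
        relaxation_solution h \<epsilon> \<rho>s us \<rho>\<epsilon> u\<epsilon> \<longrightarrow>
        heat_solution h \<rho>0 \<rho> \<longrightarrow>
          LinfT T linfnorm (\<lambda>t n. \<rho>\<epsilon> t n - \<rho> t n)
        + L1T T linfnorm (\<lambda>t n. \<rho>\<epsilon> t n - \<rho> t n)
        + L1T T linfnorm (\<lambda>t n. central_diff h (\<rho>\<epsilon> t) n + u\<epsilon> t n)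
        \<le> ennreal K * data_size s' \<epsilon> \<rho>st ust * ennreal (\<epsilon>\<^sup>2)"
  \<comment> \<open>\<open>N\<close> depends on \<open>s'\<close> alone, so the constant is uniform
    in \<open>h\<close>, \<open>\<epsilon>\<close> and the data; \<open>N + 1\<close> makes it
    positive, as only \<open>0 \<le> N\<close> is recorded.\<close>
  proof (intro exI[of _ "8 * k * (N + 1)"] conjI allI impI)
    fix h \<epsilon> :: real and \<rho>s us \<rho>0 \<rho>st ust \<rho>0t \<rho>\<epsilon> u\<epsilon> \<rho>
    assume h: "h > 0" and \<epsilon>: "\<epsilon> > 0" and data: "truncated_data s' h (\<epsilon>\<^sup>2) \<rho>s us \<rho>0 \<rho>st ust \<rho>0t"
      and sol: "relaxation_solution h \<epsilon> \<rho>s us \<rho>\<epsilon> u\<epsilon>" "heat_solution h \<rho>0 \<rho>"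
    interpret fourier_data h \<epsilon> "fourier_L2 \<rho>st" "fourier_L2 ust" "fourier_L2 \<rho>0t"
      by (rule truncated_fourier_data[OF assms(1) h \<epsilon> data])
    have "\<rho>s = idft h (fourier_L2 \<rho>st)" "us = idft h (fourier_L2 ust)" "\<rho>0 = idft h (fourier_L2 \<rho>0t)"
      using data by (auto simp: truncated_data_def truncation_eq_idft)
    note g = solution_diff_eq_idft[OF sol[unfolded this] less_imp_le]
    have "LinfT T linfnorm (\<lambda>t n. \<rho>\<epsilon> t n - \<rho> t n) + L1T T linfnorm (\<lambda>t n. \<rho>\<epsilon> t n - \<rho> t n)
        + L1T T linfnorm (\<lambda>t n. central_diff h (\<rho>\<epsilon> t) n + u\<epsilon> t n)
        \<le> ennreal (k * \<epsilon>\<^sup>2) * (ennreal N * majorant_norm s')"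
      unfolding k_def N(1)[symmetric] by (rule linf_estimate[OF T g])
    also have "\<dots> \<le> ennreal (k * \<epsilon>\<^sup>2) * (ennreal (N + 1) * (8 * data_size s' \<epsilon> \<rho>st ust))"
      using N(2) by (intro mult_left_mono mult_mono majorant_norm_le_data_size[OF assms(1) h \<epsilon> data] ennreal_leI) auto
    also have "\<dots> = ennreal (8 * k * (N + 1)) * data_size s' \<epsilon> \<rho>st ust * ennreal (\<epsilon>\<^sup>2)"
    proof -
      have "ennreal (8 * k * (N + 1)) = 8 * ennreal k * ennreal (N + 1)"
        using k N(2) by (subst ennreal_mult, simp, simp, subst ennreal_mult, simp_all)
      moreover have "ennreal (k * \<epsilon>\<^sup>2) = ennreal k * ennreal (\<epsilon>\<^sup>2)" using k by (intro ennreal_mult) auto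
      ultimately show ?thesis by (simp only: mult_ac)
    qed
    finally show "LinfT T linfnorm (\<lambda>t n. \<rho>\<epsilon> t n - \<rho> t n) + L1T T linfnorm (\<lambda>t n. \<rho>\<epsilon> t n - \<rho> t n)
        + L1T T linfnorm (\<lambda>t n. central_diff h (\<rho>\<epsilon> t) n + u\<epsilon> t n)
        \<le> ennreal (8 * k * (N + 1)) * data_size s' \<epsilon> \<rho>st ust * ennreal (\<epsilon>\<^sup>2)" .
  qed (use k N(2) in simp)
qed

end
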